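(* Let $X$ be a nilpotent element in $\mathfrak{so}^*(2n)$. Let $\mathbf{d}=[d_1^{t_{d_1}},\dots,d_s^{t_{d_s}}]\in\mathcal{P}(n)$ be the partition corresponding to the orbit of $X$, and let $\mathbb{E}_{\mathbf d}$ be the set of even parts $d_i$. For $\eta\in\mathbb{E}_{\mathbf d}$ let $p_\eta$ and $q_\eta$ be the numbers of $+1$'s and $-1$'s in the first column of the $t_\eta\times\eta$ block of the signed Young diagram of $X$. Then the following statements are equivalent: (1) $X$ is real (with respect to $\mathrm{SO}^*(2n)$). (2) $X$ is strongly real (with respect to $\mathrm{SO}^*(2n)$). (3) $p_\eta=q_\eta=t_\eta/2$ for all $\eta\in\mathbb{E}_{\mathbf d}$.
   Context: For a Lie group $G$ with Lie algebra $\mathfrak{g}$, $X\in\mathfrak{g}$ is real ($\mathrm{Ad}_G$-real) if $-X=\mathrm{Ad}(g)X$ for some $g\in G$, and strongly real if $-X=\mathrm{Ad}(\tau)X$ for some $\tau\in G$ with $\tau^2=\mathrm{Id}$. Let $\mathbb{H}=\mathbb{R}+\mathbf{i}\mathbb{R}+\mathbf{j}\mathbb{R}+\mathbf{k}\mathbb{R}$ with usual conjugation, $V=\mathbb{H}^n$ the right $\mathbb{H}$-vector space of column vectors, and $\langle x,y\rangle=\overline{x}^t\mathbf{j}\mathrm{I}_n y$ (a skew-Hermitian form). $\mathrm{SO}^*(2n)=\{g\in\mathrm{SL}_n(\mathbb{H})\mid\overline{g}^t\mathbf{j}\mathrm{I}_ng=\mathbf{j}\mathrm{I}_n\}$, $\mathfrak{so}^*(2n)=\{z\in\mathfrak{sl}_n(\mathbb{H})\mid\overline{z}^t\mathbf{j}\mathrm{I}_n+\mathbf{j}\mathrm{I}_nz=0\}$,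 where $\mathrm{SL}_n(\mathbb{H})$ (resp. $\mathfrak{sl}_n(\mathbb{H})$) consists of the $n\times n$ quaternionic matrices of reduced norm $1$ (resp. reduced trace $0$). $\mathcal{P}(m)$ is the set of partitions of $m$, written $[d_1^{t_{d_1}},\dots,d_s^{t_{d_s}}]$ with $d_1>\dots>d_s>0$, $t_{d_i}\geq1$ and $\sum_i t_{d_i}d_i=m$. The partition $\mathbf d$ of $X$ is given by the sizes of its Jordan blocks as an $\mathbb{H}$-linear nilpotent map ($t_d$ is the number of blocks of size $d$). If $X\neq0$, choose an $\mathfrak{sl}_2$-triple $\{X,H,Y\}\subset\mathfrak{so}^*(2n)$ ($[H,X]=2X$, $[H,Y]=-2Y$, $[X,Y]=H$). Let $M(d-1)$ be the sum of all irreducible $\mathrm{Span}_{\mathbb{R}}\{X,H,Y\}$-submodules of $V$ of real dimension $d$, and $L(d-1)=\ker Y\cap M(d-1)$; then $t_d=\dim_{\mathbb{H}}L(d-1)$. For each even part $\eta$, $L(\eta-1)$ has an $\mathbb{H}$-basis $v^\eta_1,\dots,v^\eta_{t_\eta}$ with $\langle v^\eta_j,X^{\eta-1}v^\eta_k\rangle=0$ for $j\ne k$ and $\langle v^\eta_j,X^{\eta-1}v^\eta_j\rangle=\pm1$. Then $p_\eta=\#\{j\mid\langle v^\eta_j,X^{\eta-1}v^\eta_j\rangle=1\}$ and $q_\eta=t_\eta-p_\eta$; these numbers depend only on the $\mathrm{SO}^*(2n)$-orbit of $X$. The signed Young diagram of $X$ has $+1$ in $p_\eta$ boxes and $-1$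 in $q_\eta$ boxes of the first column of the rectangular block of size $t_\eta\times\eta$ for even $\eta$. If $X=0$ then $\mathbb{E}_{\mathbf d}=\emptyset$ and condition (3) is vacuous. *)

theory Defs
  imports "HOL-Analysis.Analysis" "HOL-Library.Multiset"
begin

section \<open>Quaternions\<close>

text \<open>\<open>Quat a b c d\<close> is $a + b\mathbf{i} + c\mathbf{j} + d\mathbf{k}$.\<close>

datatype quat = Quat (qRe: real) (qIm1: real) (qIm2: real) (qIm3: real)

lemma quat_eq_iff:
  "x = y \<longleftrightarrow> qRe x = qRe y \<and> qIm1 x = qIm1 y \<and> qIm2 x = qIm2 y \<and> qIm3 x = qIm3 y"
  by (cases x; cases y) simp

instantiation quat :: ab_group_add
begin
definition zero_quat where "0 = Quat 0 0 0 0"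
definition plus_quat where
  "x + y = Quat (qRe x + qRe y) (qIm1 x + qIm1 y) (qIm2 x + qIm2 y) (qIm3 x + qIm3 y)"
definition minus_quat where
  "x - y = Quat (qRe x - qRe y) (qIm1 x - qIm1 y) (qIm2 x - qIm2 y) (qIm3 x - qIm3 y)"
definition uminus_quat where
  "- x = Quat (- qRe x) (- qIm1 x) (- qIm2 x) (- qIm3 x)"
instance
  by standard
    (simp_all add: quat_eq_iff zero_quat_def plus_quat_def minus_quat_def uminus_quat_def)
end

instantiation quat :: real_algebra_1
begin
definition one_quat where "1 = Quat 1 0 0 0"
definition times_quat where
  "x * y = Quat
    (qRe x * qRe y - qIm1 x * qIm1 y - qIm2 x * qIm2 y - qIm3 x * qIm3 y)
    (qRe x * qIm1 y + qIm1 x * qRe y + qIm2 x * qIm3 y - qIm3 x * qIm2 y)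
    (qRe x * qIm2 y - qIm1 x * qIm3 y + qIm2 x * qRe y + qIm3 x * qIm1 y)
    (qRe x * qIm3 y + qIm1 x * qIm2 y - qIm2 x * qIm1 y + qIm3 x * qRe y)"
definition scaleR_quat where
  "r *\<^sub>R x = Quat (r * qRe x) (r * qIm1 x) (r * qIm2 x) (r * qIm3 x)"
instance
  by standard
    (simp_all add: quat_eq_iff zero_quat_def one_quat_def plus_quat_def times_quat_def
      scaleR_quat_def algebra_simps)
end

instantiation quat :: division_ring
begin
definition inverse_quat where
  "inverse x =
    (let N = (qRe x)\<^sup>2 + (qIm1 x)\<^sup>2 + (qIm2 x)\<^sup>2 + (qIm3 x)\<^sup>2
     in Quat (qRe x / N) (- qIm1 x / N) (- qIm2 x / N) (- qIm3 x / N))"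
definition divide_quat where "x div (y :: quat) = x * inverse y"
instance
proof
  fix x :: quat
  assume "x \<noteq> 0"
  then have "(qRe x)\<^sup>2 + (qIm1 x)\<^sup>2 + (qIm2 x)\<^sup>2 + (qIm3 x)\<^sup>2 \<noteq> 0"
    by (simp add: quat_eq_iff zero_quat_def add_nonneg_eq_0_iff)
  then show "inverse x * x = 1" "x * inverse x = 1"
    by (simp_all add: quat_eq_iff one_quat_def times_quat_def inverse_quat_def Let_def
        power2_eq_square flip: add_divide_distrib diff_divide_distrib)
qed (simp_all add: divide_quat_def inverse_quat_def zero_quat_def)
end

definition qj :: quat where "qj = Quat 0 0 1 0"

definition qcnj :: "quat \<Rightarrow> quat" where
  "qcnj x = Quat (qRe x) (- qIm1 x) (- qIm2 x) (- qIm3 x)"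


section \<open>Quaternionic matrices and the right quaternionic space of column vectors\<close>

text \<open>The product of matrices is \<open>**\<close>; the class operations \<open>*\<close> and \<open>^\<close> on nested vectors are
  componentwise, hence the separate matrix power.\<close>

definition matpow :: "'a::semiring_1^'n^'n \<Rightarrow> nat \<Rightarrow> 'a^'n^'n" where
  "matpow A k = (((**) A) ^^ k) (mat 1)"

definition nilpotent_mat :: "quat^'n^'n \<Rightarrow> bool" where
  "nilpotent_mat A \<longleftrightarrow> (\<exists>k. matpow A k = 0)"

definition conj_transpose :: "quat^'n^'m \<Rightarrow> quat^'m^'n" where
  "conj_transpose A = (\<chi> i j. qcnj (A $ j $ i))"

definition rscale :: "quat^'n \<Rightarrow> quat \<Rightarrow> quat^'n"  (infixl "*\<^sub>H" 75) where
  "x *\<^sub>H a = (\<chi> i. x $ i * a)"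

definition H_independent :: "'i set \<Rightarrow> ('i \<Rightarrow> quat^'n) \<Rightarrow> bool" where
  "H_independent I b \<longleftrightarrow>
    (\<forall>a. (\<Sum>i\<in>I. b i *\<^sub>H a i) = 0 \<longrightarrow> (\<forall>i\<in>I. a i = 0))"

definition H_span :: "'i set \<Rightarrow> ('i \<Rightarrow> quat^'n) \<Rightarrow> (quat^'n) set" where
  "H_span I b = {\<Sum>i\<in>I. b i *\<^sub>H a i | a. True}"

definition H_basis :: "'i set \<Rightarrow> ('i \<Rightarrow> quat^'n) \<Rightarrow> (quat^'n) set \<Rightarrow> bool" where
  "H_basis I b W \<longleftrightarrow> finite I \<and> H_independent I b \<and> H_span I b = W"

text \<open>The reduced norm and trace come from the splitting $\mathbb{H} \otimes \mathbb{C} \cong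
  \mathrm{M}_2(\mathbb{C})$: writing $A = A_1 + A_2\mathbf{j}$ with $A_1, A_2$ complex, $A$ is sent to
  the $2n \times 2n$ complex matrix with block rows $(A_1, A_2)$ and
  $(-\overline{A_2}, \overline{A_1})$.\<close>

definition quat_c1 :: "quat \<Rightarrow> complex" where "quat_c1 x = Complex (qRe x) (qIm1 x)"
definition quat_c2 :: "quat \<Rightarrow> complex" where "quat_c2 x = Complex (qIm2 x) (qIm3 x)"

definition complexify :: "quat^'n^'n \<Rightarrow> complex^('n + 'n)^('n + 'n)" where
  "complexify A = (\<chi> r s.
     case (r, s) of
       (Inl i, Inl j) \<Rightarrow> quat_c1 (A $ i $ j)
     | (Inl i, Inr j) \<Rightarrow> quat_c2 (A $ i $ j)
     | (Inr i, Inl j) \<Rightarrow> - cnj (quat_c2 (A $ i $ j))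
     | (Inr i, Inr j) \<Rightarrow> cnj (quat_c1 (A $ i $ j)))"

definition reduced_norm :: "quat^'n^'n \<Rightarrow> complex" where
  "reduced_norm A = det (complexify A)"

definition reduced_trace :: "quat^'n^'n \<Rightarrow> complex" where
  "reduced_trace A = trace (complexify A)"


section \<open>The group $\mathrm{SO}^*(2n)$ and its Lie algebra\<close>

definition SL_H :: "(quat^'n^'n) set" where
  "SL_H = {g. reduced_norm g = 1}"

definition sl_H :: "(quat^'n^'n) set" where
  "sl_H = {z. reduced_trace z = 0}"

definition SO_star :: "(quat^'n^'n) set" where
  "SO_star = {g \<in> SL_H. conj_transpose g ** mat qj ** g = mat qj}"

definition so_star :: "(quat^'n^'n) set" where
  "so_star = {z \<in> sl_H. conj_transpose z ** mat qj + mat qj ** z = 0}"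

definition skew_form :: "quat^'n \<Rightarrow> quat^'n \<Rightarrow> quat" where
  "skew_form x y = (\<Sum>i\<in>UNIV. qcnj (x $ i) * qj * y $ i)"

definition Ad :: "quat^'n^'n \<Rightarrow> quat^'n^'n \<Rightarrow> quat^'n^'n" where
  "Ad g X = g ** X ** matrix_inv g"

definition Ad_real :: "(quat^'n^'n) set \<Rightarrow> quat^'n^'n \<Rightarrow> bool" where
  "Ad_real G X \<longleftrightarrow> (\<exists>g\<in>G. - X = Ad g X)"

definition strongly_Ad_real :: "(quat^'n^'n) set \<Rightarrow> quat^'n^'n \<Rightarrow> bool" where
  "strongly_Ad_real G X \<longleftrightarrow> (\<exists>\<tau>\<in>G. \<tau> ** \<tau> = mat 1 \<and> - X = Ad \<tau> X)"


section \<open>The partition of a nilpotent element\<close>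

text \<open>A multiset of positive integers is the multiset of Jordan block sizes of a nilpotent \<open>X\<close> if
  there is a basis of the whole space consisting of chains $v_i, Xv_i, \dots, X^{d_i - 1}v_i$ with
  $X^{d_i}v_i = 0$, one for each part $d_i$.\<close>

definition is_jordan_type :: "quat^'n^'n \<Rightarrow> nat multiset \<Rightarrow> bool" where
  "is_jordan_type X D \<longleftrightarrow>
    (\<exists>ds v. mset ds = D \<and>
      (\<forall>i<length ds. ds ! i > 0 \<and> matpow X (ds ! i) *v v i = 0) \<and>
      H_basis {(i, l). i < length ds \<and> l < ds ! i} (\<lambda>(i, l). matpow X l *v v i) UNIV)"

definition jordan_type :: "quat^'n^'n \<Rightarrow> nat multiset" where
  "jordan_type X = (THE D. is_jordan_type X D)"

definition multi_part :: "quat^'n^'n \<Rightarrow> nat \<Rightarrow> nat" where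
  "multi_part X d = count (jordan_type X) d"

definition even_parts :: "quat^'n^'n \<Rightarrow> nat set" where
  "even_parts X = {d \<in> set_mset (jordan_type X). even d}"


section \<open>$\mathfrak{sl}_2$-triples and the signed Young diagram\<close>

definition lie_bracket :: "quat^'n^'n \<Rightarrow> quat^'n^'n \<Rightarrow> quat^'n^'n" where
  "lie_bracket A B = A ** B - B ** A"

definition sl2_triple :: "quat^'n^'n \<Rightarrow> quat^'n^'n \<Rightarrow> quat^'n^'n \<Rightarrow> bool" where
  "sl2_triple X H Y \<longleftrightarrow> X \<in> so_star \<and> H \<in> so_star \<and> Y \<in> so_star \<and>
    lie_bracket H X = 2 *\<^sub>R X \<and> lie_bracket H Y = (- 2) *\<^sub>R Y \<and> lie_bracket X Y = H"

definition sl2_submodule ::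
  "quat^'n^'n \<Rightarrow> quat^'n^'n \<Rightarrow> quat^'n^'n \<Rightarrow> (quat^'n) set \<Rightarrow> bool" where
  "sl2_submodule X H Y W \<longleftrightarrow>
    subspace W \<and> (\<forall>w\<in>W. X *v w \<in> W \<and> H *v w \<in> W \<and> Y *v w \<in> W)"

definition irreducible_sl2_submodule ::
  "quat^'n^'n \<Rightarrow> quat^'n^'n \<Rightarrow> quat^'n^'n \<Rightarrow> (quat^'n) set \<Rightarrow> bool" where
  "irreducible_sl2_submodule X H Y W \<longleftrightarrow>
    sl2_submodule X H Y W \<and> W \<noteq> {0} \<and>
    (\<forall>U. sl2_submodule X H Y U \<and> U \<subseteq> W \<longrightarrow> U = {0} \<or> U = W)"

text \<open>\<open>isotypic_M X H Y m\<close> is $M(m)$: its index is one less than the real dimension of the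
  irreducible submodules (\<open>subspace\<close>, \<open>dim\<close> and \<open>span\<close> are the real ones).\<close>

definition isotypic_M :: "quat^'n^'n \<Rightarrow> quat^'n^'n \<Rightarrow> quat^'n^'n \<Rightarrow> nat \<Rightarrow> (quat^'n) set" where
  "isotypic_M X H Y m =
    span (\<Union>{W. irreducible_sl2_submodule X H Y W \<and> dim W = m + 1})"

definition lowest_L :: "quat^'n^'n \<Rightarrow> quat^'n^'n \<Rightarrow> quat^'n^'n \<Rightarrow> nat \<Rightarrow> (quat^'n) set" where
  "lowest_L X H Y m = {v \<in> isotypic_M X H Y m. Y *v v = 0}"

definition signed_basis ::
  "quat^'n^'n \<Rightarrow> quat^'n^'n \<Rightarrow> quat^'n^'n \<Rightarrow> nat \<Rightarrow> (nat \<Rightarrow> quat^'n) \<Rightarrow> bool" where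
  "signed_basis X H Y \<eta> v \<longleftrightarrow>
    H_basis {1..multi_part X \<eta>} v (lowest_L X H Y (\<eta> - 1)) \<and>
    (\<forall>j\<in>{1..multi_part X \<eta>}. \<forall>k\<in>{1..multi_part X \<eta>}. j \<noteq> k \<longrightarrow>
      skew_form (v j) (matpow X (\<eta> - 1) *v v k) = 0) \<and>
    (\<forall>j\<in>{1..multi_part X \<eta>}.
      skew_form (v j) (matpow X (\<eta> - 1) *v v j) = 1 \<or>
      skew_form (v j) (matpow X (\<eta> - 1) *v v j) = - 1)"

text \<open>The signs are read off from one chosen $\mathfrak{sl}_2$-triple containing \<open>X\<close> and, for each
  even part, one chosen basis; the resulting numbers do not depend on these choices.\<close>

definition chosen_triple :: "quat^'n^'n \<Rightarrow> (quat^'n^'n) \<times> (quat^'n^'n)" where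
  "chosen_triple X = (SOME (H, Y). sl2_triple X H Y)"

definition chosen_basis :: "quat^'n^'n \<Rightarrow> nat \<Rightarrow> nat \<Rightarrow> quat^'n" where
  "chosen_basis X \<eta> =
    (SOME v. signed_basis X (fst (chosen_triple X)) (snd (chosen_triple X)) \<eta> v)"

definition p_sign :: "quat^'n^'n \<Rightarrow> nat \<Rightarrow> nat" where
  "p_sign X \<eta> = card {j \<in> {1..multi_part X \<eta>}.
     skew_form (chosen_basis X \<eta> j) (matpow X (\<eta> - 1) *v chosen_basis X \<eta> j) = 1}"

text \<open>No truncation occurs here, since \<open>p_sign X \<eta> \<le> multi_part X \<eta>\<close>.\<close>

definition q_sign :: "quat^'n^'n \<Rightarrow> nat \<Rightarrow> nat" where
  "q_sign X \<eta> = multi_part X \<eta> - p_sign X \<eta>"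

end

(* For a nilpotent X split the space into mutually orthogonal Jordan chains, each carrying its
   own nondegenerate form. An even part e contributes the Hermitian form <v, X^(e-1) w> on
   ker X^e, whose signature modulo its radical is (p_e, q_e) by Sylvester's law of inertia. If g
   conjugates X to -X, it changes the sign of this form because e - 1 is odd, so p_e = q_e.
   Conversely, if p_e = q_e then the even chains can be matched in pairs of opposite sign; sending
   X^l v to (-1)^l X^l v' (with v' the partner of v, and v' = v in odd size) is an involutive
   isometry that anticommutes with X.

   The signs are defined from an arbitrary sl_2-triple, so its lowest weight spaces have to be
   identified as complements of these radicals: they are nondegenerate for the form, which bounds
   their dimensions from above, and a dimension count over all weights forces equality. *)

theory Submission
  imports Defs
begin

section \<open>Quaternions\<close>

text \<open>The form <v, X^k w> is Hermitian for odd k and skew-Hermitian for even k, so real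
  diagonal values, which can be scaled to 1 or -1, belong to even block sizes. The splitting into
  chains works because a nonzero form of either type over the quaternions has a vector with nonzero
  value; this is used for the highest power of X that survives on the part not yet split. The
  involution must also have reduced norm 1. Its sign is settled by a complex structure commuting
  with it: multiplication by \<open>qi\<close> of the coordinates in the chain basis, in which the
  involution has real entries. The triple and the bases are selected by \<open>SOME\<close>, so
  their existence has to be shown: a triple is written down on the chains, and the bases come from a
  Gram-Schmidt process on the lowest weight spaces. The count over the weights of an arbitrary
  triple needs the strings of lowest weight vectors to fill the space V. This follows by iterating V
  = ker Y + X V, which itself comes from comparing four dimension inequalities.\<close>

lemma quat_sel_simps [simp]:
  "qRe 0 = 0" "qIm1 0 = 0" "qIm2 0 = 0" "qIm3 0 = 0"
  "qRe 1 = 1" "qIm1 1 = 0" "qIm2 1 = 0" "qIm3 1 = 0"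
  "qRe (x + y) = qRe x + qRe y" "qIm1 (x + y) = qIm1 x + qIm1 y"
  "qIm2 (x + y) = qIm2 x + qIm2 y" "qIm3 (x + y) = qIm3 x + qIm3 y"
  "qRe (x - y) = qRe x - qRe y" "qIm1 (x - y) = qIm1 x - qIm1 y"
  "qIm2 (x - y) = qIm2 x - qIm2 y" "qIm3 (x - y) = qIm3 x - qIm3 y"
  "qRe (- x) = - qRe x" "qIm1 (- x) = - qIm1 x" "qIm2 (- x) = - qIm2 x" "qIm3 (- x) = - qIm3 x"
  "qRe (r *\<^sub>R x) = r * qRe x" "qIm1 (r *\<^sub>R x) = r * qIm1 x"
  "qIm2 (r *\<^sub>R x) = r * qIm2 x" "qIm3 (r *\<^sub>R x) = r * qIm3 x"
  "qRe (qcnj x) = qRe x" "qIm1 (qcnj x) = - qIm1 x"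
  "qIm2 (qcnj x) = - qIm2 x" "qIm3 (qcnj x) = - qIm3 x"
  "qRe qj = 0" "qIm1 qj = 0" "qIm2 qj = 1" "qIm3 qj = 0"
  by (simp_all add: zero_quat_def one_quat_def plus_quat_def minus_quat_def uminus_quat_def
      scaleR_quat_def qcnj_def qj_def)

lemma quat_sel_mult:
  "qRe (x * y) = qRe x * qRe y - qIm1 x * qIm1 y - qIm2 x * qIm2 y - qIm3 x * qIm3 y"
  "qIm1 (x * y) = qRe x * qIm1 y + qIm1 x * qRe y + qIm2 x * qIm3 y - qIm3 x * qIm2 y"
  "qIm2 (x * y) = qRe x * qIm2 y - qIm1 x * qIm3 y + qIm2 x * qRe y + qIm3 x * qIm1 y"
  "qIm3 (x * y) = qRe x * qIm3 y + qIm1 x * qIm2 y - qIm2 x * qIm1 y + qIm3 x * qRe y"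
  by (simp_all add: times_quat_def)

text \<open>With this instance and the next one \<open>quat^'n\<close> is a euclidean space, so that
  real \<open>dim\<close> formulas and operator norms apply. Quaternionic dimensions appear
  throughout as a quarter of real ones.\<close>

instantiation quat :: real_inner
begin

definition inner_quat :: "quat \<Rightarrow> quat \<Rightarrow> real" where
  "inner_quat x y = qRe x * qRe y + qIm1 x * qIm1 y + qIm2 x * qIm2 y + qIm3 x * qIm3 y"

definition norm_quat :: "quat \<Rightarrow> real" where
  "norm_quat x = sqrt (inner x x)"

definition sgn_quat :: "quat \<Rightarrow> quat" where
  "sgn_quat x = inverse (norm x) *\<^sub>R x"

definition dist_quat :: "quat \<Rightarrow> quat \<Rightarrow> real" where
  "dist_quat x y = norm (x - y)"

definition uniformity_quat :: "(quat \<times> quat) filter" where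
  "uniformity_quat = (INF e\<in>{0<..}. principal {(x, y). dist x y < e})"

definition open_quat :: "quat set \<Rightarrow> bool" where
  "open_quat U \<longleftrightarrow> (\<forall>x\<in>U. eventually (\<lambda>(x', y). x' = x \<longrightarrow> y \<in> U) uniformity)"

instance
proof
  fix x :: quat
  show "inner x x = 0 \<longleftrightarrow> x = 0"
    by (simp add: inner_quat_def quat_eq_iff add_nonneg_eq_0_iff)
qed (simp_all add: inner_quat_def norm_quat_def sgn_quat_def dist_quat_def uniformity_quat_def
    open_quat_def algebra_simps)

end

definition qi :: quat where "qi = Quat 0 1 0 0"
definition qk :: quat where "qk = Quat 0 0 0 1"

lemma qi_qk_sel [simp]:
  "qRe qi = 0" "qIm1 qi = 1" "qIm2 qi = 0" "qIm3 qi = 0"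
  "qRe qk = 0" "qIm1 qk = 0" "qIm2 qk = 0" "qIm3 qk = 1"
  by (simp_all add: qi_def qk_def)

instantiation quat :: euclidean_space
begin

definition Basis_quat :: "quat set" where "Basis_quat = {1, qi, qj, qk}"

instance
proof
  fix u v x :: quat
  have neq: "1 \<noteq> qi" "1 \<noteq> qj" "1 \<noteq> qk" "qi \<noteq> qj" "qi \<noteq> qk" "qj \<noteq> qk"
    by (simp_all add: quat_eq_iff)
  show "(Basis :: quat set) \<noteq> {}" "finite (Basis :: quat set)"
    by (simp_all add: Basis_quat_def)
  show "inner u v = (if u = v then 1 else 0)" if "u \<in> Basis" "v \<in> Basis"
    using that neq neq[symmetric] unfolding Basis_quat_def inner_quat_def by (elim insertE emptyE) simp_all
  show "(\<forall>u\<in>Basis. inner x u = 0) \<longleftrightarrow> x = 0"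
    by (simp add: Basis_quat_def inner_quat_def quat_eq_iff[of x])
qed

end

lemma DIM_quat [simp]: "DIM(quat) = 4"
proof -
  have "1 \<noteq> qi" "1 \<noteq> qj" "1 \<noteq> qk" "qi \<noteq> qj" "qi \<noteq> qk" "qj \<noteq> qk"
    by (simp_all add: quat_eq_iff)
  then show ?thesis by (simp add: Basis_quat_def)
qed

lemma qcnj_simps [simp]:
  "qcnj 0 = 0" "qcnj 1 = 1" "qcnj (qcnj x) = x" "qcnj (x + y) = qcnj x + qcnj y"
  "qcnj (x - y) = qcnj x - qcnj y" "qcnj (- x) = - qcnj x" "qcnj (r *\<^sub>R x) = r *\<^sub>R qcnj x"
  "qcnj qj = - qj"
  by (simp_all add: quat_eq_iff)

lemma qcnj_mult: "qcnj (x * y) = qcnj y * qcnj x"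
  by (simp add: quat_eq_iff quat_sel_mult algebra_simps)

lemma qcnj_sum: "qcnj (\<Sum>i\<in>I. f i) = (\<Sum>i\<in>I. qcnj (f i))"
  by (induction I rule: infinite_finite_induct) auto

lemma qcnj_eq_0_iff [simp]: "qcnj x = 0 \<longleftrightarrow> x = 0"
  by (metis qcnj_simps(1,3))

lemma qj_neq_0 [simp]: "qj \<noteq> 0"
  by (simp add: quat_eq_iff)

lemma qj_qj [simp]: "qj * qj = - 1"
  by (simp add: quat_eq_iff quat_sel_mult)

lemma qi_qi [simp]: "qi * qi = - 1"
  by (simp add: quat_eq_iff quat_sel_mult)

lemma quat_selfadjoint: "qcnj x = x \<Longrightarrow> x = qRe x *\<^sub>R 1"
  by (simp add: quat_eq_iff)

lemma qRe_cnj_mult_nonneg: "0 \<le> qRe (qcnj a * a)"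
  by (simp add: quat_sel_mult)

lemma qRe_cnj_mult_eq_0_iff: "qRe (qcnj a * a) = 0 \<longleftrightarrow> a = 0"
proof -
  have "qRe (qcnj a * a) = inner a a"
    by (simp add: quat_sel_mult inner_quat_def)
  then show ?thesis by simp
qed

lemma qRe_sum: "qRe (\<Sum>i\<in>I. f i) = (\<Sum>i\<in>I. qRe (f i))"
  by (induction I rule: infinite_finite_induct) auto


section \<open>Scalar multiplication on the right\<close>

lemma rscale_simps [simp]:
  "x *\<^sub>H 0 = 0" "(0 :: quat^'n) *\<^sub>H a = 0" "x *\<^sub>H 1 = x"
  "x *\<^sub>H (- a) = - (x *\<^sub>H a)" "(- x) *\<^sub>H a = - (x *\<^sub>H a)"
  by (simp_all add: rscale_def vec_eq_iff)

lemma rscale_add_left: "(x + y) *\<^sub>H a = x *\<^sub>H a + y *\<^sub>H a"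
  and rscale_add_right: "x *\<^sub>H (a + b) = x *\<^sub>H a + x *\<^sub>H b"
  and rscale_diff_right: "x *\<^sub>H (a - b) = x *\<^sub>H a - x *\<^sub>H b"
  and rscale_assoc: "x *\<^sub>H a *\<^sub>H b = x *\<^sub>H (a * b)"
  and rscale_scaleR_left: "(r *\<^sub>R x) *\<^sub>H a = r *\<^sub>R (x *\<^sub>H a)"
  and rscale_scaleR_right: "x *\<^sub>H (r *\<^sub>R a) = r *\<^sub>R (x *\<^sub>H a)"
  for x y :: "quat^'n"
  by (simp_all add: rscale_def vec_eq_iff algebra_simps)

lemma rscale_sum_left: "(\<Sum>i\<in>I. f i) *\<^sub>H a = (\<Sum>i\<in>I. f i *\<^sub>H a)"
  by (induction I rule: infinite_finite_induct) (auto simp: rscale_add_left)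

lemma rscale_eq_0_iff [simp]: "x *\<^sub>H a = 0 \<longleftrightarrow> x = 0 \<or> a = 0"
  by (auto simp: rscale_def vec_eq_iff)

lemma scaleR_as_rscale: "r *\<^sub>R x = x *\<^sub>H (r *\<^sub>R 1)"
  by (simp add: rscale_def vec_eq_iff)

lemma linear_rscale_right: "linear (\<lambda>a. x *\<^sub>H a)"
  by (rule linearI) (simp_all add: rscale_add_right rscale_scaleR_right)

lemma matrix_vector_rscale: "A *v (x *\<^sub>H a) = (A *v x) *\<^sub>H a"
  by (simp add: matrix_vector_mult_def rscale_def vec_eq_iff sum_distrib_right mult.assoc)

lemma matrix_vector_scaleR: "A *v (r *\<^sub>R x) = r *\<^sub>R (A *v x)" for A :: "quat^'n^'m"
  by (simp add: linear_cmul)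

lemma scaleR_matrix_vector: "(r *\<^sub>R A) *v x = r *\<^sub>R (A *v x)" for A :: "quat^'n^'m"
  by (simp add: matrix_vector_mult_def vec_eq_iff scaleR_right.sum)

lemma matrix_vector_sum: "A *v (\<Sum>i\<in>I. f i) = (\<Sum>i\<in>I. A *v f i)" for A :: "quat^'n^'m"
  by (induction I rule: infinite_finite_induct) (auto simp: matrix_vector_right_distrib)

lemma matrix_vector_minus: "A *v (- x) = - (A *v x)" for A :: "quat^'n^'m"
  by (simp add: linear_neg)

lemma minus_matrix_vector: "(- A) *v x = - (A *v x)" for A :: "quat^'n^'m"
  using scaleR_matrix_vector[of "-1" A x] by simp

lemma matpow_vector: "matpow A k *v x = ((*v) A ^^ k) x"
  by (induction k) (simp_all add: matpow_def flip: matrix_vector_mul_assoc)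

text \<open>Entries multiply on the left and scalars on the right, so the maps given by matrices are
  exactly the right-linear ones; the columns are the images of the \<open>axis j 1\<close>.\<close>

lemma H_linear_is_matrix:
  fixes f :: "quat^'n \<Rightarrow> quat^'m"
  assumes "\<And>x y. f (x + y) = f x + f y" "\<And>x a. f (x *\<^sub>H a) = f x *\<^sub>H a"
  shows "\<exists>A. \<forall>x. A *v x = f x"
proof (intro exI allI)
  fix x :: "quat^'n"
  have f0: "f 0 = 0" using assms(2)[of 0 0] by simp
  have fsum: "f (\<Sum>i\<in>I. g i) = (\<Sum>i\<in>I. f (g i))" for g :: "'n \<Rightarrow> quat^'n" and I
    by (induction I rule: infinite_finite_induct) (auto simp: assms f0)
  have "x = (\<Sum>j\<in>UNIV. axis j 1 *\<^sub>H x $ j)"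
    by (simp add: vec_eq_iff rscale_def axis_def if_distribR if_distrib cong: if_cong)
  then have "f x = (\<Sum>j\<in>UNIV. f (axis j 1) *\<^sub>H x $ j)"
    by (metis (no_types, lifting) assms(2) fsum sum.cong)
  then show "(\<chi> i j. f (axis j 1) $ i) *v x = f x"
    by (simp add: matrix_vector_mult_def rscale_def vec_eq_iff)
qed

section \<open>Quaternionic subspaces and real dimension\<close>

definition H_subspace :: "(quat^'n) set \<Rightarrow> bool" where
  "H_subspace W \<longleftrightarrow> subspace W \<and> (\<forall>w\<in>W. \<forall>a. w *\<^sub>H a \<in> W)"

lemma H_subspace_imp_subspace: "H_subspace W \<Longrightarrow> subspace W"
  by (simp add: H_subspace_def)

lemma H_subspace_rscale: "H_subspace W \<Longrightarrow> w \<in> W \<Longrightarrow> w *\<^sub>H a \<in> W"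
  by (simp add: H_subspace_def)

lemma H_subspaceI:
  assumes "0 \<in> W" "\<And>x y. x \<in> W \<Longrightarrow> y \<in> W \<Longrightarrow> x + y \<in> W" "\<And>x a. x \<in> W \<Longrightarrow> x *\<^sub>H a \<in> W"
  shows "H_subspace W"
  using assms by (auto simp: H_subspace_def subspace_def scaleR_as_rscale)

lemma H_span_iff: "x \<in> H_span I b \<longleftrightarrow> (\<exists>a. x = (\<Sum>i\<in>I. b i *\<^sub>H a i))"
  by (auto simp: H_span_def)

lemma H_span_sum [intro]: "(\<Sum>i\<in>I. b i *\<^sub>H a i) \<in> H_span I b"
  by (auto simp: H_span_def)

lemma H_subspace_H_span: "H_subspace (H_span I b)"
proof (rule H_subspaceI)
  show "0 \<in> H_span I b"
    by (auto simp: H_span_def intro!: exI[of _ "\<lambda>_. 0"])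
next
  fix x y assume "x \<in> H_span I b" "y \<in> H_span I b"
  then obtain a c where "x = (\<Sum>i\<in>I. b i *\<^sub>H a i)" "y = (\<Sum>i\<in>I. b i *\<^sub>H c i)"
    by (auto simp: H_span_def)
  then show "x + y \<in> H_span I b"
    by (auto simp: H_span_def rscale_add_right sum.distrib intro!: exI[of _ "\<lambda>i. a i + c i"])
next
  fix x e assume "x \<in> H_span I b"
  then obtain a where "x = (\<Sum>i\<in>I. b i *\<^sub>H a i)"
    by (auto simp: H_span_def)
  then show "x *\<^sub>H e \<in> H_span I b"
    by (auto simp: H_span_def rscale_assoc rscale_sum_left intro!: exI[of _ "\<lambda>i. a i * e"])
qed

lemma H_span_base:
  assumes "finite I" "i \<in> I"
  shows "b i \<in> H_span I b"
proof -
  have "(\<Sum>j\<in>I. b j *\<^sub>H (if j = i then 1 else 0)) = b i"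
    using assms by (simp add: if_distrib[of "rscale _"] cong: if_cong)
  then show ?thesis unfolding H_span_iff by metis
qed

lemma H_span_subset:
  assumes "H_subspace W" "\<And>i. i \<in> I \<Longrightarrow> b i \<in> W"
  shows "H_span I b \<subseteq> W"
  using assms by (auto simp: H_span_def H_subspace_def intro!: subspace_sum)

lemma H_span_insert:
  assumes "finite I" "i \<notin> I"
  shows "H_span (insert i I) b = {x + y | x y. x \<in> range (\<lambda>a. b i *\<^sub>H a) \<and> y \<in> H_span I b}"
proof (intro equalityI subsetI)
  fix x assume "x \<in> H_span (insert i I) b"
  then obtain a where "x = (\<Sum>j\<in>insert i I. b j *\<^sub>H a j)"
    by (auto simp: H_span_def)
  then show "x \<in> {x + y | x y. x \<in> range (\<lambda>a. b i *\<^sub>H a) \<and> y \<in> H_span I b}"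
    using assms by (auto simp: H_span_def)
next
  fix x assume "x \<in> {x + y | x y. x \<in> range (\<lambda>a. b i *\<^sub>H a) \<and> y \<in> H_span I b}"
  then obtain e a where x: "x = b i *\<^sub>H e + (\<Sum>j\<in>I. b j *\<^sub>H a j)"
    by (auto simp: H_span_def)
  have "(\<Sum>j\<in>I. b j *\<^sub>H a j) = (\<Sum>j\<in>I. b j *\<^sub>H (a(i := e)) j)"
    using assms by (intro sum.cong) auto
  then have "x = (\<Sum>j\<in>insert i I. b j *\<^sub>H (a(i := e)) j)"
    using assms x by simp
  then show "x \<in> H_span (insert i I) b"
    unfolding H_span_def by blast
qed

lemma dim_range_rscale_le: "dim (range (\<lambda>a. x *\<^sub>H a)) \<le> 4"
  using dim_image_le[OF linear_rscale_right, of x UNIV] by simp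

lemma dim_range_rscale: "x \<noteq> 0 \<Longrightarrow> dim (range (\<lambda>a. x *\<^sub>H a)) = 4"
proof -
  assume "x \<noteq> 0"
  then have "inj (\<lambda>a. x *\<^sub>H a)"
    by (simp add: linear_injective_0[OF linear_rscale_right])
  then show ?thesis
    using dim_image_eq[OF linear_rscale_right, of x UNIV] by simp
qed

lemma dim_H_span_le:
  assumes "finite I"
  shows "dim (H_span I b) \<le> 4 * card I"
  using assms
proof (induction I rule: finite_induct)
  case empty
  then show ?case by (simp add: H_span_def)
next
  case (insert i I)
  have "dim (H_span (insert i I) b) + dim (range (\<lambda>a. b i *\<^sub>H a) \<inter> H_span I b)
      = dim (range (\<lambda>a. b i *\<^sub>H a)) + dim (H_span I b)"
    unfolding H_span_insert[OF insert.hyps]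
    by (intro dim_sums_Int H_subspace_imp_subspace H_subspace_H_span
        linear_subspace_image[OF linear_rscale_right]) simp
  then show ?case
    using insert dim_range_rscale_le[of "b i"] by simp
qed

lemma H_independent_subset:
  assumes "finite J" "H_independent J b" "I \<subseteq> J"
  shows "H_independent I b"
  unfolding H_independent_def
proof (intro allI impI)
  fix a :: "'a \<Rightarrow> quat" assume a: "(\<Sum>i\<in>I. b i *\<^sub>H a i) = 0"
  have "(\<Sum>i\<in>J. b i *\<^sub>H (if i \<in> I then a i else 0)) = (\<Sum>i\<in>I. b i *\<^sub>H a i)"
    using assms by (intro sum.mono_neutral_cong_right) auto
  then have "\<forall>i\<in>J. (if i \<in> I then a i else 0) = 0"
    using a assms(2)[unfolded H_independent_def, THEN spec, of "\<lambda>i. if i \<in> I then a i else 0"]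
    by simp
  then show "\<forall>i\<in>I. a i = 0"
    using assms(3) by (auto split: if_splits)
qed

text \<open>Each new generator contributes a line of real dimension 4, and independence makes this
  line meet the previous span only in 0.\<close>

lemma dim_H_span:
  assumes "finite I" "H_independent I b"
  shows "dim (H_span I b) = 4 * card I"
  using assms
proof (induction I rule: finite_induct)
  case empty
  then show ?case by (simp add: H_span_def)
next
  case (insert i I)
  have IH: "dim (H_span I b) = 4 * card I"
    using insert H_independent_subset[of "insert i I" b I] by auto
  have ind: "\<forall>j\<in>insert i I. a j = 0" if "(\<Sum>j\<in>insert i I. b j *\<^sub>H a j) = 0" for a
    using that insert.prems unfolding H_independent_def by blast
  have "b i \<noteq> 0"
  proof
    assume "b i = 0"
    then show False
      using ind[of "\<lambda>j. if j = i then 1 else 0"] insert.hyps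
      by (simp add: if_distrib[of "rscale _"] cong: if_cong)
  qed
  have "range (\<lambda>a. b i *\<^sub>H a) \<inter> H_span I b \<subseteq> {0}"
  proof
    fix x assume "x \<in> range (\<lambda>a. b i *\<^sub>H a) \<inter> H_span I b"
    then have "x \<in> range (\<lambda>a. b i *\<^sub>H a)" "x \<in> H_span I b" by simp_all
    then obtain e a where x: "x = b i *\<^sub>H e" "x = (\<Sum>j\<in>I. b j *\<^sub>H a j)"
      unfolding H_span_iff image_iff by metis
    have "(\<Sum>j\<in>I. b j *\<^sub>H a j) = (\<Sum>j\<in>I. b j *\<^sub>H (a(i := - e)) j)"
      using insert.hyps by (intro sum.cong) auto
    then have "(\<Sum>j\<in>insert i I. b j *\<^sub>H (a(i := - e)) j) = 0"
      using insert.hyps x by simp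
    then have "e = 0" using ind by fastforce
    then show "x \<in> {0}" using x by simp
  qed
  then have "dim (range (\<lambda>a. b i *\<^sub>H a) \<inter> H_span I b) = 0"
    by (simp only: dim_eq_0)
  moreover have "dim (H_span (insert i I) b) + dim (range (\<lambda>a. b i *\<^sub>H a) \<inter> H_span I b)
      = dim (range (\<lambda>a. b i *\<^sub>H a)) + dim (H_span I b)"
    unfolding H_span_insert[OF insert.hyps]
    by (intro dim_sums_Int H_subspace_imp_subspace H_subspace_H_span
        linear_subspace_image[OF linear_rscale_right]) simp
  ultimately show ?case
    using insert.hyps IH dim_range_rscale[OF \<open>b i \<noteq> 0\<close>] by (simp del: dim_eq_0)
qed

text \<open>Coordinates in a basis are unique, hence right-linear, and recombining them with the
  prescribed images is right-linear too. The sl2-triple, the involution and the complex structure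
  are all built this way from values on chains.\<close>

lemma exists_matrix_on_H_basis:
  fixes b :: "'i \<Rightarrow> quat^'n" and c :: "'i \<Rightarrow> quat^'m"
  assumes "H_basis I b UNIV"
  shows "\<exists>A. \<forall>i\<in>I. A *v b i = c i"
proof -
  have fin: "finite I" and ind: "H_independent I b" and sp: "H_span I b = UNIV"
    using assms by (auto simp: H_basis_def)
  have "\<exists>a. (\<Sum>i\<in>I. b i *\<^sub>H a i) = x" for x
    using sp H_span_iff[of x I b] by auto
  then obtain co where co: "\<And>x. (\<Sum>i\<in>I. b i *\<^sub>H co x i) = x" by metis
  have uniq: "co x i = a i" if "(\<Sum>i\<in>I. b i *\<^sub>H a i) = x" "i \<in> I" for a x i
  proof -
    have "(\<Sum>i\<in>I. b i *\<^sub>H (co x i - a i)) = 0"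
      using that co[of x] by (simp add: rscale_diff_right sum_subtractf)
    then have "\<forall>i\<in>I. co x i - a i = 0"
      using ind[unfolded H_independent_def, THEN spec, of "\<lambda>i. co x i - a i"] by simp
    then show ?thesis using that by simp
  qed
  define f where "f x = (\<Sum>i\<in>I. c i *\<^sub>H co x i)" for x
  have "co (x + y) i = co x i + co y i" if "i \<in> I" for x y i
    by (rule uniq[OF _ that]) (simp add: rscale_add_right sum.distrib co)
  then have 1: "f (x + y) = f x + f y" for x y
    by (simp add: f_def rscale_add_right sum.distrib)
  have "co (x *\<^sub>H a) i = co x i * a" if "i \<in> I" for x a i
    by (rule uniq[OF _ that]) (simp add: co flip: rscale_assoc rscale_sum_left)
  then have 2: "f (x *\<^sub>H a) = f x *\<^sub>H a" for x a
    by (simp add: f_def rscale_sum_left rscale_assoc)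
  have "f (b i) = c i" if "i \<in> I" for i
  proof -
    have *: "(\<Sum>j\<in>I. b j *\<^sub>H (if j = i then 1 else 0)) = b i"
      using that fin by (simp add: if_distrib[of "rscale _"] cong: if_cong)
    have "co (b i) j = (if j = i then 1 else 0)" if "j \<in> I" for j
      by (rule uniq[OF * that])
    then show ?thesis
      using that fin by (simp add: f_def if_distrib[of "rscale _"] cong: if_cong)
  qed
  then show ?thesis using H_linear_is_matrix[of f] 1 2 by metis
qed

lemma matrix_eq_on_H_span:
  fixes A B :: "quat^'n^'m"
  assumes "H_span I b = UNIV" "\<And>i. i \<in> I \<Longrightarrow> A *v b i = B *v b i"
  shows "A = B"
  unfolding matrix_eq
proof
  fix x :: "quat^'n"
  obtain a where "x = (\<Sum>i\<in>I. b i *\<^sub>H a i)"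
    using assms(1) H_span_iff[of x I b] by auto
  then show "A *v x = B *v x"
    using assms(2) by (simp add: matrix_vector_sum matrix_vector_rscale)
qed

section \<open>Reduced norm and reduced trace\<close>

lemma quat_c_mult:
  "quat_c1 (x * y) = quat_c1 x * quat_c1 y - quat_c2 x * cnj (quat_c2 y)"
  "quat_c2 (x * y) = quat_c1 x * quat_c2 y + quat_c2 x * cnj (quat_c1 y)"
  by (simp_all add: quat_c1_def quat_c2_def complex_eq_iff quat_sel_mult algebra_simps)

lemma quat_c_sum:
  "quat_c1 (\<Sum>i\<in>I. f i) = (\<Sum>i\<in>I. quat_c1 (f i))"
  "quat_c2 (\<Sum>i\<in>I. f i) = (\<Sum>i\<in>I. quat_c2 (f i))"
  by (induction I rule: infinite_finite_induct)
    (auto simp: quat_c1_def quat_c2_def complex_eq_iff)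

lemma quat_c_simps [simp]:
  "quat_c1 0 = 0" "quat_c2 0 = 0" "quat_c1 1 = 1" "quat_c2 1 = 0"
  "quat_c1 qj = 0" "quat_c2 qj = 1" "quat_c1 (- x) = - quat_c1 x" "quat_c2 (- x) = - quat_c2 x"
  by (simp_all add: quat_c1_def quat_c2_def complex_eq_iff)

lemma sum_UNIV_sum_type:
  fixes f :: "'a::finite + 'b::finite \<Rightarrow> 'c::comm_monoid_add"
  shows "(\<Sum>x\<in>UNIV. f x) = (\<Sum>i\<in>UNIV. f (Inl i)) + (\<Sum>i\<in>UNIV. f (Inr i))"
  by (simp add: UNIV_Plus_UNIV[symmetric] sum.Plus del: UNIV_Plus_UNIV)

lemma complexify_nth [simp]:
  "complexify A $ Inl i $ Inl j = quat_c1 (A $ i $ j)"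
  "complexify A $ Inl i $ Inr j = quat_c2 (A $ i $ j)"
  "complexify A $ Inr i $ Inl j = - cnj (quat_c2 (A $ i $ j))"
  "complexify A $ Inr i $ Inr j = cnj (quat_c1 (A $ i $ j))"
  by (simp_all add: complexify_def)

lemma complexify_mult: "complexify (A ** B) = complexify A ** complexify B"
proof -
  have "complexify (A ** B) $ r $ s = (complexify A ** complexify B) $ r $ s" for r s
    by (cases r; cases s)
      (simp_all add: matrix_matrix_mult_def sum_UNIV_sum_type quat_c_mult quat_c_sum
        sum_subtractf sum.distrib sum_negf)
  then show ?thesis by (simp add: vec_eq_iff)
qed

lemma complexify_one: "complexify (mat 1 :: quat^'n^'n) = mat 1"
proof -
  have "complexify (mat 1 :: quat^'n^'n) $ r $ s = mat 1 $ r $ s" for r s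
    by (cases r; cases s) (auto simp: mat_def)
  then show ?thesis by (simp add: vec_eq_iff)
qed

lemma reduced_norm_mult: "reduced_norm (A ** B) = reduced_norm A * reduced_norm B"
  by (simp add: reduced_norm_def complexify_mult det_mul)

lemma reduced_norm_one: "reduced_norm (mat 1) = 1"
  by (simp add: reduced_norm_def complexify_one)

lemma det_cnj: "det (\<chi> i j. cnj (M $ i $ j)) = cnj (det M)"
  by (simp add: det_def)

lemma mat_qj_vector: "(mat qj *v y) $ i = qj * y $ i"
  by (simp add: matrix_vector_mult_def mat_def if_distribR[of _ "(*) qj"] if_distrib[of "\<lambda>q. q * _"] cong: if_cong)

lemma mat_qj_sq: "mat qj ** mat qj = (- mat 1 :: quat^'n^'n)"
  by (simp add: matrix_eq vec_eq_iff mat_qj_vector minus_matrix_vector mult.assoc[symmetric]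
      flip: matrix_vector_mul_assoc)

text \<open>The complexification of a quaternionic matrix is similar to its complex conjugate, by
  means of the complexification of \<open>mat qj\<close>.\<close>

lemma reduced_norm_real: "cnj (reduced_norm A) = reduced_norm A"
  for A :: "quat^'n^'n"
proof -
  let ?J = "complexify (mat qj :: quat^'n^'n)" and ?M = "complexify A"
  let ?Mc = "\<chi> i j. cnj (?M $ i $ j)"
  have "(?J ** ?M) $ r $ s = (?Mc ** ?J) $ r $ s" for r s
    by (cases r; cases s)
      (simp_all add: matrix_matrix_mult_def sum_UNIV_sum_type mat_def if_distrib if_distribR
        cong: if_cong)
  then have "?J ** ?M = ?Mc ** ?J" by (simp add: vec_eq_iff)
  then have "det ?J * det ?M = cnj (det ?M) * det ?J"
    by (metis det_mul det_cnj)
  moreover have "det ?J \<noteq> 0"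
  proof
    assume "det ?J = 0"
    then have "det (?J ** ?J ** (?J ** ?J)) = 0" by (simp add: det_mul)
    also have "?J ** ?J ** (?J ** ?J) = complexify (mat qj ** mat qj ** (mat qj ** mat qj))"
      by (simp add: complexify_mult)
    also have "mat qj ** mat qj ** (mat qj ** mat qj) = (mat 1 :: quat^'n^'n)"
      unfolding mat_qj_sq
      by (simp add: matrix_eq minus_matrix_vector flip: matrix_vector_mul_assoc)
    finally show False by (simp add: complexify_one)
  qed
  ultimately show ?thesis by (simp add: reduced_norm_def)
qed

text \<open>Such a \<open>\<tau>\<close> is the square of \<open>(1 + J)/2 + \<tau>(1 - J)/2\<close>, whose reduced norm is real.\<close>

lemma reduced_norm_involution:
  fixes \<tau> J :: "quat^'n^'n"
  assumes inv: "\<tau> ** \<tau> = mat 1" and J: "J ** J = - mat 1" and comm: "\<tau> ** J = J ** \<tau>"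
  shows "reduced_norm \<tau> = 1"
proof -
  define \<sigma> where "\<sigma> = (1/2) *\<^sub>R ((mat 1 + J) + \<tau> ** (mat 1 - J))"
  have \<sigma>: "\<sigma> *v x = (1/2) *\<^sub>R ((x + J *v x) + (\<tau> *v x - \<tau> *v (J *v x)))" for x
    by (simp add: \<sigma>_def scaleR_matrix_vector matrix_vector_mult_add_rdistrib
        matrix_vector_mult_diff_rdistrib matrix_vector_mult_diff_distrib
        flip: matrix_vector_mul_assoc)
  have tt: "\<tau> *v (\<tau> *v x) = x" and JJ: "J *v (J *v x) = - x"
    and tJ: "\<tau> *v (J *v x) = J *v (\<tau> *v x)" for x
    by (simp_all add: matrix_vector_mul_assoc inv J comm minus_matrix_vector)
  \<comment> \<open>Since \<open>J\<close> squares to -1, (1 + J)^2 = 2J and (1 - J)^2 = -2J; these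
    cancel because \<open>\<tau>\<close> squares to 1, and the two mixed terms add up to
    \<open>4 \<tau>\<close> before the factor 1/4.\<close>
  have "\<sigma> *v (\<sigma> *v x) = \<tau> *v x" for x
    unfolding \<sigma>
    by (simp add: tJ tt JJ matrix_vector_right_distrib matrix_vector_mult_diff_distrib
        matrix_vector_scaleR matrix_vector_minus algebra_simps flip: scaleR_add_left)
  then have "\<sigma> ** \<sigma> = \<tau>"
    by (simp add: matrix_eq flip: matrix_vector_mul_assoc)
  then have sq: "reduced_norm \<tau> = (reduced_norm \<sigma>)\<^sup>2"
    by (metis reduced_norm_mult power2_eq_square)
  have "(reduced_norm \<tau>)\<^sup>2 = 1"
    by (metis inv reduced_norm_mult reduced_norm_one power2_eq_square)
  moreover have "reduced_norm \<tau> \<noteq> - 1"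
  proof -
    have "Im (reduced_norm \<sigma>) = 0"
      using reduced_norm_real[of \<sigma>] by (simp add: complex_eq_iff)
    then have "Re (reduced_norm \<tau>) = (Re (reduced_norm \<sigma>))\<^sup>2"
      by (simp add: sq)
    then have "0 \<le> Re (reduced_norm \<tau>)" by simp
    then show ?thesis by auto
  qed
  ultimately show ?thesis by (simp add: power2_eq_1_iff)
qed

lemma reduced_trace_eq: "reduced_trace A = of_real (2 * (\<Sum>i\<in>UNIV. qRe (A $ i $ i)))"
proof -
  have "reduced_trace A = (\<Sum>i\<in>UNIV. quat_c1 (A $ i $ i) + cnj (quat_c1 (A $ i $ i)))"
    by (simp add: reduced_trace_def trace_def sum_UNIV_sum_type sum.distrib)
  also have "\<dots> = (\<Sum>i\<in>UNIV. of_real (2 * qRe (A $ i $ i)))"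
    by (intro sum.cong) (simp_all add: quat_c1_def complex_eq_iff)
  finally show ?thesis by (simp add: sum_distrib_left)
qed

section \<open>The skew-Hermitian form\<close>

lemma skew_form_simps:
  "skew_form (x + y) z = skew_form x z + skew_form y z"
  "skew_form x (y + z) = skew_form x y + skew_form x z"
  "skew_form (x - y) z = skew_form x z - skew_form y z"
  "skew_form x (y - z) = skew_form x y - skew_form x z"
  "skew_form (- x) z = - skew_form x z" "skew_form x (- z) = - skew_form x z"
  "skew_form (r *\<^sub>R x) z = r *\<^sub>R skew_form x z" "skew_form x (r *\<^sub>R z) = r *\<^sub>R skew_form x z"
  "skew_form 0 z = 0" "skew_form x 0 = 0"
  by (simp_all add: skew_form_def algebra_simps sum.distrib sum_subtractf sum_negf
      scaleR_right.sum)

lemma skew_form_rscale_right: "skew_form x (y *\<^sub>H a) = skew_form x y * a"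
  by (simp add: skew_form_def rscale_def sum_distrib_right mult.assoc)

lemma skew_form_rscale_left: "skew_form (x *\<^sub>H a) y = qcnj a * skew_form x y"
  by (simp add: skew_form_def rscale_def sum_distrib_left mult.assoc qcnj_mult)

lemma skew_form_sum_right: "skew_form x (\<Sum>i\<in>I. f i) = (\<Sum>i\<in>I. skew_form x (f i))"
  by (induction I rule: infinite_finite_induct) (auto simp: skew_form_simps)

lemma skew_form_sum_left: "skew_form (\<Sum>i\<in>I. f i) x = (\<Sum>i\<in>I. skew_form (f i) x)"
  by (induction I rule: infinite_finite_induct) (auto simp: skew_form_simps)

lemma skew_form_swap: "skew_form y x = - qcnj (skew_form x y)"
  by (simp add: skew_form_def qcnj_sum qcnj_mult mult.assoc flip: sum_negf)

lemma skew_form_axis: "skew_form (axis i 1) y = qj * y $ i"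
proof -
  have "qcnj (axis i 1 $ k) * qj * y $ k = (if k = i then qj * y $ k else 0)" for k
    by (simp add: axis_def)
  then show ?thesis unfolding skew_form_def by simp
qed

lemma skew_form_axis_right: "skew_form x (axis i 1) = qcnj (x $ i) * qj"
proof -
  have "qcnj (x $ k) * qj * axis i 1 $ k = (if k = i then qcnj (x $ k) * qj else 0)" for k
    by (simp add: axis_def)
  then show ?thesis unfolding skew_form_def by simp
qed

lemma skew_form_nondegenerate: "(\<And>y. skew_form y x = 0) \<Longrightarrow> x = 0"
  using skew_form_axis[of _ x] by (simp add: vec_eq_iff)

text \<open>Collects both matrices in one Gram matrix, so that the matrix equations in
  \<open>SO_star\<close> and \<open>so_star\<close> can be exchanged for identities of the
  form.\<close>

lemma skew_form_matrix:
  "skew_form (A *v x) (B *v y) =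
    (\<Sum>i\<in>UNIV. qcnj (x $ i) * ((conj_transpose A ** mat qj ** B) *v y) $ i)"
proof -
  have "skew_form (A *v x) (B *v y) =
      (\<Sum>k\<in>UNIV. \<Sum>i\<in>UNIV. qcnj (x $ i) * qcnj (A $ k $ i) * qj * (B *v y) $ k)"
    by (simp add: skew_form_def matrix_vector_mult_def[of A] qcnj_sum qcnj_mult sum_distrib_right)
  also have "\<dots> = (\<Sum>i\<in>UNIV. \<Sum>k\<in>UNIV. qcnj (x $ i) * qcnj (A $ k $ i) * qj * (B *v y) $ k)"
    by (rule sum.swap)
  also have "\<dots> = (\<Sum>i\<in>UNIV. qcnj (x $ i) * (conj_transpose A *v (mat qj *v (B *v y))) $ i)"
    unfolding matrix_vector_mult_def[of "conj_transpose A"]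
    by (simp add: conj_transpose_def sum_distrib_left mult.assoc mat_qj_vector)
  finally show ?thesis
    by (simp add: matrix_vector_mul_assoc matrix_mul_assoc)
qed

lemma sesquilinear_matrix_eq:
  assumes "\<And>x y. (\<Sum>i\<in>UNIV. qcnj (x $ i) * (A *v y) $ i) = (\<Sum>i\<in>UNIV. qcnj (x $ i) * (B *v y) $ i)"
  shows "A = (B :: quat^'n^'n)"
  unfolding matrix_eq
proof
  fix y
  have *: "(\<Sum>i\<in>UNIV. qcnj (axis k 1 $ i) * z $ i) = z $ k" for z :: "quat^'n" and k
    by (simp add: axis_def if_distrib if_distribR cong: if_cong)
  have "(A *v y) $ k = (B *v y) $ k" for k
    using assms[of "axis k 1" y] by (simp add: *)
  then show "A *v y = B *v y" by (simp add: vec_eq_iff)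
qed

lemma form_preserving_iff:
  "conj_transpose g ** mat qj ** g = mat qj \<longleftrightarrow>
    (\<forall>x y. skew_form (g *v x) (g *v y) = skew_form x y)"
proof -
  have form: "skew_form x y = (\<Sum>i\<in>UNIV. qcnj (x $ i) * (mat qj *v y) $ i)" for x y :: "quat^'n"
    by (simp add: skew_form_def mat_qj_vector mult.assoc)
  show ?thesis
  proof
    assume "conj_transpose g ** mat qj ** g = mat qj"
    then show "\<forall>x y. skew_form (g *v x) (g *v y) = skew_form x y"
      unfolding skew_form_matrix by (simp add: form)
  next
    assume "\<forall>x y. skew_form (g *v x) (g *v y) = skew_form x y"
    then show "conj_transpose g ** mat qj ** g = mat qj"
      unfolding skew_form_matrix by (intro sesquilinear_matrix_eq) (simp add: form)
  qed
qed

lemma skew_adjoint_iff: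
  "conj_transpose z ** mat qj + mat qj ** z = 0 \<longleftrightarrow>
    (\<forall>x y. skew_form (z *v x) y = - skew_form x (z *v y))"
proof -
  have *: "skew_form (z *v x) y + skew_form x (z *v y) =
      (\<Sum>i\<in>UNIV. qcnj (x $ i) * ((conj_transpose z ** mat qj + mat qj ** z) *v y) $ i)" for x y
  proof -
    have 1: "skew_form (z *v x) y =
        (\<Sum>i\<in>UNIV. qcnj (x $ i) * ((conj_transpose z ** mat qj) *v y) $ i)"
      using skew_form_matrix[of z x "mat 1" y] by simp
    have 2: "skew_form x (z *v y) = (\<Sum>i\<in>UNIV. qcnj (x $ i) * ((mat qj ** z) *v y) $ i)"
      by (simp add: skew_form_def mult.assoc mat_qj_vector flip: matrix_vector_mul_assoc)
    show ?thesis
      unfolding 1 2 by (simp add: matrix_vector_mult_add_rdistrib distrib_left sum.distrib)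
  qed
  show ?thesis
  proof
    assume "conj_transpose z ** mat qj + mat qj ** z = 0"
    then show "\<forall>x y. skew_form (z *v x) y = - skew_form x (z *v y)"
      unfolding eq_neg_iff_add_eq_0 * by simp
  next
    assume "\<forall>x y. skew_form (z *v x) y = - skew_form x (z *v y)"
    then show "conj_transpose z ** mat qj + mat qj ** z = 0"
      unfolding eq_neg_iff_add_eq_0 * by (intro sesquilinear_matrix_eq) simp
  qed
qed

lemma SO_star_iff:
  "g \<in> SO_star \<longleftrightarrow> reduced_norm g = 1 \<and> (\<forall>x y. skew_form (g *v x) (g *v y) = skew_form x y)"
  by (simp add: SO_star_def SL_H_def form_preserving_iff)

text \<open>The reduced trace is twice the sum of the real parts of the diagonal. Skewness on
  \<open>axis i 1\<close> gives the equation \<open>qcnj a * qj = - (qj * a)\<close> for the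
  diagonal entry a, and its \<open>qIm2\<close> component says that the real part of a equals its
  own negative.\<close>

lemma so_star_iff:
  "z \<in> so_star \<longleftrightarrow> (\<forall>x y. skew_form (z *v x) y = - skew_form x (z *v y))"
proof
  assume "z \<in> so_star"
  then show "\<forall>x y. skew_form (z *v x) y = - skew_form x (z *v y)"
    by (simp add: so_star_def skew_adjoint_iff)
next
  assume skew: "\<forall>x y. skew_form (z *v x) y = - skew_form x (z *v y)"
  have "qRe (z $ i $ i) = 0" for i
  proof -
    have col: "(z *v axis i 1) $ i = z $ i $ i"
      by (simp add: matrix_vector_mult_def axis_def if_distrib if_distribR cong: if_cong)
    have "qcnj (z $ i $ i) * qj = - (qj * z $ i $ i)"
      using skew[rule_format, of "axis i 1" "axis i 1"]
      by (simp add: skew_form_axis skew_form_axis_right col)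
    then have "qIm2 (qcnj (z $ i $ i) * qj) = qIm2 (- (qj * z $ i $ i))"
      by simp
    then show ?thesis by (simp add: quat_sel_mult)
  qed
  then have "z \<in> sl_H" by (simp add: sl_H_def reduced_trace_eq)
  then show "z \<in> so_star" using skew by (simp add: so_star_def skew_adjoint_iff)
qed

text \<open>\<open>matrix_inv\<close> is a choice, so a two-sided inverse has to be exhibited. The
  defining equation, multiplied by \<open>- mat qj\<close>, shows a left inverse; it is also a right
  inverse because an injective linear map is surjective here.\<close>

lemma SO_star_inverse:
  fixes g :: "quat^'n^'n"
  assumes "g \<in> SO_star"
  shows "matrix_inv g ** g = mat 1"
proof -
  let ?B = "(- mat qj) ** conj_transpose g ** mat qj"
  have "conj_transpose g ** mat qj ** g = mat qj"
    using assms by (simp add: SO_star_def)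
  then have "?B ** g = - mat qj ** mat qj"
    by (simp flip: matrix_mul_assoc)
  also have "\<dots> = mat 1"
    by (simp add: matrix_eq vec_eq_iff mat_qj_vector minus_matrix_vector mult.assoc[symmetric]
        flip: matrix_vector_mul_assoc)
  finally have B: "?B ** g = mat 1" .
  then have Bv: "?B *v (g *v x) = x" for x by (simp add: matrix_vector_mul_assoc)
  then have "inj ((*v) g)" by (metis injI)
  then have "surj ((*v) g)"
    by (intro linear_injective_imp_surjective) auto
  then have "g *v (?B *v x) = x" for x by (metis Bv surjD)
  then have "g ** ?B = mat 1" by (simp add: matrix_eq flip: matrix_vector_mul_assoc)
  then have "\<exists>A'. g ** A' = mat 1 \<and> A' ** g = mat 1" using B by blast
  then show ?thesis unfolding matrix_inv_def by (rule someI2_ex) simp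
qed

lemma SO_star_Ad_eq_minus:
  assumes "g \<in> SO_star" "- X = Ad g X"
  shows "g *v (X *v x) = - (X *v (g *v x))"
proof -
  have "- X ** g = g ** X ** (matrix_inv g ** g)"
    unfolding assms(2) Ad_def by (simp add: matrix_mul_assoc)
  then have "- X ** g = g ** X" by (simp add: SO_star_inverse[OF assms(1)])
  then show ?thesis
    by (metis matrix_vector_mul_assoc minus_matrix_vector)
qed

section \<open>Hermitian and skew-Hermitian forms\<close>

text \<open>Treats Hermitian forms (\<open>e = 1\<close>) and skew-Hermitian forms
  (\<open>e = - 1\<close>) together, since inserting successive powers of X into
  \<open>skew_form\<close> alternates between the two.\<close>

locale sesquilinear_form =
  fixes f :: "quat^'n \<Rightarrow> quat^'n \<Rightarrow> quat" and e :: real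
  assumes add_right: "f x (y + z) = f x y + f x z"
    and rscale_right: "f x (y *\<^sub>H a) = f x y * a"
    and swap: "f y x = e *\<^sub>R qcnj (f x y)"
    and sign: "e = 1 \<or> e = - 1"
begin

lemma add_left: "f (x + y) z = f x z + f y z"
  by (subst (1 2 3) swap) (simp add: add_right scaleR_right_distrib)

lemma rscale_left: "f (x *\<^sub>H a) z = qcnj a * f x z"
  by (subst (1 2) swap) (simp add: rscale_right qcnj_mult)

lemma zero_right [simp]: "f x 0 = 0"
  using rscale_right[of x 0 0] by simp

lemma zero_left [simp]: "f 0 x = 0"
  by (subst swap) simp

lemma minus_right: "f x (- y) = - f x y"
  using rscale_right[of x y "- 1"] by simp

lemma diff_right: "f x (y - z) = f x y - f x z"
  using add_right[of x y "- z"] by (simp add: minus_right)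

lemma sum_right: "f x (\<Sum>i\<in>I. g i) = (\<Sum>i\<in>I. f x (g i))"
  by (induction I rule: infinite_finite_induct) (auto simp: add_right)

lemma sum_left: "f (\<Sum>i\<in>I. g i) x = (\<Sum>i\<in>I. f (g i) x)"
  by (induction I rule: infinite_finite_induct) (auto simp: add_left)

lemma eq_0_swap: "f x y = 0 \<longleftrightarrow> f y x = 0"
  using sign by (subst swap) auto

text \<open>Polarization. If \<open>f\<close> vanished on the diagonal of \<open>W\<close>, then \<open>f x y * a\<close> would be
  self-adjoint up to a fixed sign for every \<open>a\<close>, which fails for \<open>a\<close> such that \<open>f x y * a\<close>
  is \<open>1\<close> or \<open>qi\<close>.\<close>

lemma anisotropic:
  assumes W: "H_subspace W" and xy: "x \<in> W" "y \<in> W" "f x y \<noteq> 0"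
  shows "\<exists>u\<in>W. f u u \<noteq> 0"
proof (rule ccontr)
  assume "\<not> ?thesis"
  then have 0: "f u u = 0" if "u \<in> W" for u using that by blast
  have *: "f x z = - e *\<^sub>R qcnj (f x z)" if "z \<in> W" for z
  proof -
    have "f (x + z) (x + z) = 0"
      using 0 W xy(1) that by (simp add: H_subspace_def subspace_add)
    then have "f x z + f z x = 0"
      using 0[OF xy(1)] 0[OF that] by (simp add: add_left add_right add.commute)
    then show ?thesis by (simp add: swap[of z x] eq_neg_iff_add_eq_0)
  qed
  have "q = - e *\<^sub>R qcnj q" for q
    using *[of "y *\<^sub>H (inverse (f x y) * q)"] W xy
    by (simp add: H_subspace_rscale rscale_right mult.assoc[symmetric])
  from this[of 1] this[of qi] show False
    using sign by (auto simp: quat_eq_iff)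
qed

end

section \<open>Orthogonal systems of Jordan chains\<close>

lemma matrix_funpow_linear: "linear ((*v) A ^^ k)" for A :: "quat^'n^'n"
proof (induction k)
  case (Suc k)
  then show ?case using linear_compose[OF Suc matrix_vector_mul_linear] by (simp add: o_def)
qed (simp add: linear_id[unfolded id_def] id_def)

lemma matrix_funpow_rscale: "((*v) A ^^ k) (x *\<^sub>H a) = ((*v) A ^^ k) x *\<^sub>H a" for A :: "quat^'n^'n"
  by (induction k) (simp_all add: matrix_vector_rscale)

lemmas matrix_funpow_simps =
  linear_add[OF matrix_funpow_linear] linear_diff[OF matrix_funpow_linear]
  linear_neg[OF matrix_funpow_linear] linear_0[OF matrix_funpow_linear]
  linear_cmul[OF matrix_funpow_linear] linear_sum[OF matrix_funpow_linear]
  matrix_funpow_rscale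

lemma funpow_mono_zero:
  fixes f :: "'a::zero \<Rightarrow> 'a"
  assumes "(f ^^ k) x = 0" "k \<le> m" "f 0 = 0"
  shows "(f ^^ m) x = 0"
proof -
  have "(f ^^ j) 0 = 0" for j using assms(3) by (induction j) auto
  moreover have "(f ^^ m) x = (f ^^ (m - k)) ((f ^^ k) x)"
    using assms(2) by (simp flip: funpow_add o_apply[of "f ^^ (m - k)"])
  ultimately show ?thesis using assms(1) by simp
qed

definition chain_index :: "nat \<Rightarrow> (nat \<Rightarrow> nat) \<Rightarrow> (nat \<times> nat) set" where
  "chain_index n d = {(i, l). i < n \<and> l < d i}"

lemma chain_index_Sigma: "chain_index n d = Sigma {..<n} (\<lambda>i. {..<d i})"
  by (auto simp: chain_index_def)

lemma finite_chain_index [simp]: "finite (chain_index n d)"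
  by (simp add: chain_index_Sigma)

lemma card_chain_index: "card (chain_index n d) = (\<Sum>i<n. d i)"
  by (simp add: chain_index_Sigma)

locale so_star_element =
  fixes X :: "quat^'n^'n"
  assumes X_so: "X \<in> so_star"
begin

abbreviation pw :: "nat \<Rightarrow> quat^'n \<Rightarrow> quat^'n" where
  "pw k \<equiv> (*v) X ^^ k"

abbreviation chain :: "(nat \<Rightarrow> quat^'n) \<Rightarrow> nat \<times> nat \<Rightarrow> quat^'n" where
  "chain v p \<equiv> pw (snd p) (v (fst p))"

lemma pw_pw: "pw j (pw k x) = pw (j + k) x"
  by (simp add: funpow_add)

lemma pw_mono_zero: "pw k x = 0 \<Longrightarrow> k \<le> m \<Longrightarrow> pw m x = 0"
  by (rule funpow_mono_zero) auto

lemma skew: "skew_form (X *v x) y = - skew_form x (X *v y)"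
  using X_so by (simp add: so_star_iff)

lemma skew_form_pw: "skew_form (pw k x) y = (- 1) ^ k *\<^sub>R skew_form x (pw k y)"
proof (induction k arbitrary: y)
  case (Suc k)
  have "skew_form (pw (Suc k) x) y = - skew_form (pw k x) (X *v y)"
    by (simp add: skew)
  also have "\<dots> = - ((- 1) ^ k *\<^sub>R skew_form x (pw (Suc k) y))"
    by (simp add: Suc funpow_swap1)
  finally show ?case by simp
qed simp

lemma skew_form_pw_eq_0_iff: "skew_form (pw k x) y = 0 \<longleftrightarrow> skew_form x (pw k y) = 0"
  by (simp add: skew_form_pw)

lemma sesquilinear_pw: "sesquilinear_form (\<lambda>x y. skew_form x (pw k y)) ((- 1) ^ Suc k)"
proof
  fix x y z a
  show "skew_form x (pw k (y + z)) = skew_form x (pw k y) + skew_form x (pw k z)"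
    by (simp add: matrix_funpow_simps skew_form_simps)
  show "skew_form x (pw k (y *\<^sub>H a)) = skew_form x (pw k y) * a"
    by (simp add: matrix_funpow_simps skew_form_rscale_right)
  have "skew_form y (pw k x) = - qcnj (skew_form (pw k x) y)"
    by (rule skew_form_swap)
  then show "skew_form y (pw k x) = (- 1) ^ Suc k *\<^sub>R qcnj (skew_form x (pw k y))"
    by (simp add: skew_form_pw)
  show "(- 1 :: real) ^ Suc k = 1 \<or> (- 1 :: real) ^ Suc k = - 1"
    by (cases "even k") auto
qed

sublocale pwf: sesquilinear_form "\<lambda>x y. skew_form x (pw k y)" "(- 1) ^ Suc k" for k
  by (rule sesquilinear_pw)

lemma skew_form_pw_swap_0: "skew_form x (pw k y) = 0 \<longleftrightarrow> skew_form y (pw k x) = 0"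
  by (rule pwf.eq_0_swap)

text \<open>Each generator pairs nontrivially only with the top of its own chain. The value is
  normalized for even \<open>d i\<close> only: for odd \<open>d i\<close> the form is skew-Hermitian
  and the value is purely imaginary, so it is just required to be nonzero.\<close>

definition orthogonal_chains :: "nat \<Rightarrow> (nat \<Rightarrow> nat) \<Rightarrow> (nat \<Rightarrow> quat^'n) \<Rightarrow> bool" where
  "orthogonal_chains n d v \<longleftrightarrow>
    (\<forall>i<n. 0 < d i \<and> pw (d i) (v i) = 0 \<and> skew_form (v i) (pw (d i - 1) (v i)) \<noteq> 0 \<and>
      (even (d i) \<longrightarrow> skew_form (v i) (pw (d i - 1) (v i)) \<in> {1, - 1})) \<and>
    (\<forall>i<n. \<forall>j<n. \<forall>l. i \<noteq> j \<or> l \<noteq> d i - 1 \<longrightarrow> skew_form (v i) (pw l (v j)) = 0)"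

text \<open>As powers of X can be moved across the form up to sign, this is the orthogonal
  complement of all chain vectors, not only of the generators. Letting the powers act on
  \<open>w\<close> makes stability under X immediate.\<close>

definition chains_perp :: "nat \<Rightarrow> (nat \<Rightarrow> quat^'n) \<Rightarrow> (quat^'n) set" where
  "chains_perp n v = {w. \<forall>i<n. \<forall>l. skew_form (v i) (pw l w) = 0}"

context
  fixes n d v
  assumes chains: "orthogonal_chains n d v"
begin

lemma chains_pos: "i < n \<Longrightarrow> 0 < d i"
  and chains_zero: "i < n \<Longrightarrow> pw (d i) (v i) = 0"
  and chains_nonzero: "i < n \<Longrightarrow> skew_form (v i) (pw (d i - 1) (v i)) \<noteq> 0"
  and chains_sign: "i < n \<Longrightarrow> even (d i) \<Longrightarrow>
    skew_form (v i) (pw (d i - 1) (v i)) = 1 \<or> skew_form (v i) (pw (d i - 1) (v i)) = - 1"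
  and chains_orth: "i < n \<Longrightarrow> j < n \<Longrightarrow> i \<noteq> j \<or> l \<noteq> d i - 1 \<Longrightarrow> skew_form (v i) (pw l (v j)) = 0"
  using chains unfolding orthogonal_chains_def by blast+

lemma chains_pw_ge_zero: "i < n \<Longrightarrow> d i \<le> m \<Longrightarrow> skew_form (v i) (pw m y) = 0"
  using pw_mono_zero[OF chains_zero, of i m] skew_form_pw_eq_0_iff[of m "v i" y]
  by (simp add: skew_form_simps)

text \<open>Pairing with \<open>v i\<close> after applying X^m sees only the position whose total
  power is \<open>d i - 1\<close>. So these functionals form, up to nonzero scalars, the dual basis
  of the chains, with the order in each chain reversed.\<close>

lemma chain_coeff:
  assumes i: "i < n" and m: "m < d i"
  shows "skew_form (v i) (pw m (\<Sum>p\<in>chain_index n d. chain v p *\<^sub>H a p)) =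
    skew_form (v i) (pw (d i - 1) (v i)) * a (i, d i - 1 - m)"
proof -
  let ?p = "(i, d i - 1 - m)"
  have "skew_form (v i) (pw m (\<Sum>p\<in>chain_index n d. chain v p *\<^sub>H a p)) =
      (\<Sum>p\<in>chain_index n d. skew_form (v i) (pw (m + snd p) (v (fst p))) * a p)"
    by (simp add: matrix_funpow_simps skew_form_sum_right skew_form_rscale_right pw_pw)
  also have "\<dots> = (\<Sum>p\<in>chain_index n d.
      if p = ?p then skew_form (v i) (pw (d i - 1) (v i)) * a ?p else 0)"
  proof (rule sum.cong[OF refl])
    fix p assume p: "p \<in> chain_index n d"
    obtain j l where jl: "p = (j, l)" by (cases p)
    show "skew_form (v i) (pw (m + snd p) (v (fst p))) * a p =
      (if p = ?p then skew_form (v i) (pw (d i - 1) (v i)) * a ?p else 0)"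
    proof (cases "p = ?p")
      case True
      then show ?thesis using m by simp
    next
      case False
      then have "i \<noteq> j \<or> m + l \<noteq> d i - 1" using m jl by auto
      then have "skew_form (v i) (pw (m + l) (v j)) = 0"
        using p jl i by (intro chains_orth) (auto simp: chain_index_def)
      then show ?thesis using False jl by (simp only: if_False fst_conv snd_conv mult_zero_left)
    qed
  qed
  also have "\<dots> = skew_form (v i) (pw (d i - 1) (v i)) * a ?p"
  proof -
    have "?p \<in> chain_index n d" using i m by (simp add: chain_index_def)
    then show ?thesis by simp
  qed
  finally show ?thesis .
qed

lemma chains_independent: "H_independent (chain_index n d) (chain v)"
  unfolding H_independent_def
proof (intro allI impI ballI)
  fix a p assume 0: "(\<Sum>p\<in>chain_index n d. chain v p *\<^sub>H a p) = 0" and p: "p \<in> chain_index n d"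
  obtain i l where il: "p = (i, l)" "i < n" "l < d i" using p by (auto simp: chain_index_def)
  then have "skew_form (v i) (pw (d i - 1) (v i)) * a (i, d i - 1 - (d i - 1 - l)) = 0"
    using chain_coeff[of i "d i - 1 - l" a] 0 by (simp add: matrix_funpow_simps skew_form_simps)
  then show "a p = 0" using il chains_nonzero[of i] by simp
qed

text \<open>Solves \<open>chain_coeff\<close> for the coefficient; for a general \<open>x\<close> it
  gives the orthogonal projection onto the chains.\<close>

definition chain_coord :: "quat^'n \<Rightarrow> nat \<times> nat \<Rightarrow> quat" where
  "chain_coord x p = inverse (skew_form (v (fst p)) (pw (d (fst p) - 1) (v (fst p)))) *
     skew_form (v (fst p)) (pw (d (fst p) - 1 - snd p) x)"

lemma chain_residual:
  "x - (\<Sum>p\<in>chain_index n d. chain v p *\<^sub>H chain_coord x p) \<in> chains_perp n v"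
proof -
  have "skew_form (v i) (pw m (x - (\<Sum>p\<in>chain_index n d. chain v p *\<^sub>H chain_coord x p))) = 0"
    if i: "i < n" for i m
  proof (cases "m < d i")
    case True
    then show ?thesis
      using chain_coeff[OF i True, of "chain_coord x"] chains_nonzero[OF i]
      by (simp add: chain_coord_def matrix_funpow_simps(2) skew_form_simps mult.assoc[symmetric])
  next
    case False
    then show ?thesis using chains_pw_ge_zero[OF i] by simp
  qed
  then show ?thesis by (simp add: chains_perp_def)
qed

lemma chains_expand:
  assumes "chains_perp n v = {0}"
  shows "x = (\<Sum>p\<in>chain_index n d. chain v p *\<^sub>H chain_coord x p)"
  using chain_residual[of x] assms by simp

lemma chains_H_basis:
  assumes "chains_perp n v = {0}"
  shows "H_basis (chain_index n d) (chain v) UNIV"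
proof -
  have "x \<in> H_span (chain_index n d) (chain v)" for x
    unfolding H_span_iff by (rule exI, rule chains_expand[OF assms])
  then show ?thesis using chains_independent by (auto simp: H_basis_def)
qed

end

lemma chains_perp_H_subspace: "H_subspace (chains_perp n v)"
  by (rule H_subspaceI)
    (auto simp: chains_perp_def matrix_funpow_simps skew_form_simps skew_form_rscale_right)

lemma chains_perp_pw: "w \<in> chains_perp n v \<Longrightarrow> pw k w \<in> chains_perp n v"
  by (simp add: chains_perp_def pw_pw)

text \<open>For \<open>c = skew_form u (pw (d - 1) u)\<close> and \<open>s = skew_form u (pw k u)\<close>, adding
  \<open>pw (d - 1 - k) u\<close> times \<open>- (1/2) c\<^sup>-\<^sup>1 s\<close> to \<open>u\<close> kills \<open>s\<close> and changes none of the
  products of higher order.\<close>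

lemma adjust_chain_step:
  assumes W: "H_subspace W" "\<And>w. w \<in> W \<Longrightarrow> X *v w \<in> W" "\<And>w. w \<in> W \<Longrightarrow> pw d w = 0"
    and u: "u \<in> W" "skew_form u (pw (d - 1) u) = c" "c \<noteq> 0"
    and k: "k < d - 1" and orth: "\<And>m. k < m \<Longrightarrow> m < d - 1 \<Longrightarrow> skew_form u (pw m u) = 0"
  shows "\<exists>u'\<in>W. skew_form u' (pw (d - 1) u') = c \<and>
    (\<forall>m. k \<le> m \<and> m < d - 1 \<longrightarrow> skew_form u' (pw m u') = 0)"
proof -
  define s where "s = skew_form u (pw k u)"
  define a where "a = - (1/2) *\<^sub>R (inverse c * s)"
  define e where "e = d - 1 - k"
  define u' where "u' = u + pw e u *\<^sub>H a"
  have W_pw: "pw j w \<in> W" if "w \<in> W" for j w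
    using that W(2) by (induction j) auto
  have big: "pw m u = 0" if "d \<le> m" for m
    using pw_mono_zero[OF W(3)[OF u(1)] that] .
  have expand: "skew_form u' (pw m u') =
      skew_form u (pw m u) + skew_form u (pw (m + e) u) * a
      + (- 1) ^ e *\<^sub>R (qcnj a * skew_form u (pw (m + e) u))
      + (- 1) ^ e *\<^sub>R (qcnj a * skew_form u (pw (m + e + e) u)) * a" for m
    by (simp add: u'_def matrix_funpow_simps skew_form_simps skew_form_rscale_left
        skew_form_rscale_right skew_form_pw pw_pw algebra_simps)
  have e: "0 < e" "k + e = d - 1" "d \<le> k + e + e" using k by (auto simp: e_def)
  have "skew_form u' (pw k u') = 0"
  proof -
    have cc: "qcnj c = (- 1) ^ d *\<^sub>R c"
      using pwf.swap[of u "d - 1" u] u(2) k by (cases d) (auto simp: minus_one_power_iff equation_minus_iff)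
    have ss: "qcnj s = (- 1) ^ Suc k *\<^sub>R s"
      using pwf.swap[of u k u] by (auto simp: s_def minus_one_power_iff equation_minus_iff split: if_splits)
    have "qcnj (inverse c) = (- 1) ^ d *\<^sub>R inverse c"
    proof -
      have "qcnj (inverse c) * qcnj c = 1"
        using u(3) by (simp flip: qcnj_mult)
      then have "qcnj (inverse c) * ((- 1) ^ d *\<^sub>R c) = 1" by (simp add: cc)
      then have "((- 1) ^ d *\<^sub>R qcnj (inverse c)) * c = 1" by simp
      then have "(- 1) ^ d *\<^sub>R qcnj (inverse c) = inverse c"
        by (metis inverse_unique inverse_inverse_eq)
      then have "(- 1) ^ d *\<^sub>R ((- 1) ^ d *\<^sub>R qcnj (inverse c)) = (- 1) ^ d *\<^sub>R inverse c"
        by simp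
      then show ?thesis by (simp flip: power_add)
    qed
    then have "qcnj a * c = - (1/2) *\<^sub>R ((- 1) ^ Suc k *\<^sub>R (- 1) ^ d *\<^sub>R s)"
      using u(3) by (simp add: a_def qcnj_mult ss mult.assoc)
    \<comment> \<open>The exponents add up to the even number 2d. Hence both cross terms of the
      expansion equal -s/2 and cancel \<open>s\<close>, while the quadratic term contains a power of
      X that is at least d and vanishes.\<close>
    moreover have "(- 1 :: real) ^ e * ((- 1) ^ Suc k * (- 1) ^ d) = 1"
      using e(2) k by (auto simp: minus_one_power_iff e_def even_diff_nat)
    ultimately have "(- 1) ^ e *\<^sub>R (qcnj a * c) = - (1/2) *\<^sub>R s"
      by (simp add: mult.assoc)
    moreover have "c * a = - (1/2) *\<^sub>R s"
      using u(3) by (simp add: a_def mult.assoc[symmetric])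
    moreover have "skew_form u (pw (d - 1 + e) u) = 0"
      using big[of "d - 1 + e"] e(1) k by (simp add: skew_form_simps)
    ultimately have "skew_form u' (pw k u') = s - (1/2) *\<^sub>R s - (1/2) *\<^sub>R s"
      unfolding expand e(2) u(2) s_def[symmetric] by simp
    then show ?thesis by (simp add: quat_eq_iff)
  qed
  moreover have "skew_form u' (pw m u') = skew_form u (pw m u)" if "k < m" for m
    unfolding expand using big[of "m + e"] big[of "m + e + e"] that k
    by (simp add: e_def skew_form_simps)
  moreover have "u' \<in> W"
    using W(1) W_pw[OF u(1), of e] u(1) by (simp add: u'_def H_subspace_def subspace_add)
  ultimately show ?thesis
    using orth u(2) k by (metis nat_less_le)
qed

text \<open>The products are killed from the top power downwards, because a correction at power k
  leaves all higher ones unchanged; \<open>j\<close> counts those already killed.\<close>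

lemma adjust_chain:
  assumes W: "H_subspace W" "\<And>w. w \<in> W \<Longrightarrow> X *v w \<in> W" "\<And>w. w \<in> W \<Longrightarrow> pw d w = 0"
    and u: "u \<in> W" "skew_form u (pw (d - 1) u) = c" "c \<noteq> 0"
  shows "\<exists>u'\<in>W. skew_form u' (pw (d - 1) u') = c \<and> (\<forall>m<d - 1. skew_form u' (pw m u') = 0)"
proof -
  have "\<exists>u'\<in>W. skew_form u' (pw (d - 1) u') = c \<and>
      (\<forall>m. d - 1 - j \<le> m \<and> m < d - 1 \<longrightarrow> skew_form u' (pw m u') = 0)" for j
  proof (induction j)
    case 0
    then show ?case using u by auto
  next
    case (Suc j)
    show ?case
    proof (cases "j < d - 1")
      case True
      from Suc obtain w where w: "w \<in> W" "skew_form w (pw (d - 1) w) = c"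
        "\<And>m. d - 1 - j \<le> m \<Longrightarrow> m < d - 1 \<Longrightarrow> skew_form w (pw m w) = 0" by blast
      show ?thesis
        by (rule adjust_chain_step[OF W w(1,2) u(3)]) (use True w(3) in auto)
    next
      case False
      then show ?thesis using Suc by simp
    qed
  qed
  from this[of "d - 1"] show ?thesis by simp
qed

text \<open>For odd \<open>k\<close> the diagonal values are self-adjoint, hence real.\<close>

lemma normalize_sign:
  assumes "odd k" "H_subspace W" "u \<in> W" "skew_form u (pw k u) \<noteq> 0"
  shows "\<exists>u'\<in>W. skew_form u' (pw k u') \<in> {1, - 1}"
proof -
  define r where "r = qRe (skew_form u (pw k u))"
  have r: "skew_form u (pw k u) = r *\<^sub>R 1"
    unfolding r_def using pwf.swap[of u k u] assms(1) by (intro quat_selfadjoint) simp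
  then have r0: "r \<noteq> 0" using assms(4) by auto
  define t where "t = 1 / sqrt \<bar>r\<bar>"
  have "t * (t * r) = sgn r"
    using r0 by (simp add: t_def real_sgn_eq flip: real_sqrt_mult)
  then have "skew_form (t *\<^sub>R u) (pw k (t *\<^sub>R u)) = sgn r *\<^sub>R 1"
    by (simp add: matrix_funpow_simps skew_form_simps r)
  moreover have "t *\<^sub>R u \<in> W"
    using assms by (simp add: H_subspace_def subspace_scale)
  moreover have "sgn r *\<^sub>R (1 :: quat) \<in> {1, - 1}" using r0 by (auto simp: sgn_if)
  ultimately show ?thesis by metis
qed

text \<open>The size \<open>e\<close> of the new chain is the exact nilpotency order of X on the
  complement. Then X^e vanishes there, as \<open>adjust_chain\<close> requires, while X^(e-1) does
  not, so the form with X^(e-1) is nonzero on the complement and has a vector of nonzero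
  value.\<close>

lemma extend_chains:
  assumes chains: "orthogonal_chains n d v" and nil: "\<And>x. pw K x = 0"
    and nz: "chains_perp n v \<noteq> {0}"
  shows "\<exists>d' v'. orthogonal_chains (Suc n) d' v' \<and> dim (chains_perp (Suc n) v') < dim (chains_perp n v)"
proof -
  let ?W = "chains_perp n v"
  have W: "H_subspace ?W" by (rule chains_perp_H_subspace)
  have W_pw: "pw k w \<in> ?W" if "w \<in> ?W" for w k using that by (rule chains_perp_pw)
  define e where "e = (LEAST k. \<forall>w\<in>?W. pw k w = 0)"
  have e: "\<forall>w\<in>?W. pw e w = 0"
    unfolding e_def by (rule LeastI[of _ K]) (simp add: nil)
  obtain w0 where "w0 \<in> ?W" "w0 \<noteq> 0"
    using nz subspace_0[OF H_subspace_imp_subspace[OF W]] by blast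
  then have e0: "0 < e" using e by (cases e) auto
  have "\<not> (\<forall>w\<in>?W. pw (e - 1) w = 0)"
    using not_less_Least[of "e - 1" "\<lambda>k. \<forall>w\<in>?W. pw k w = 0"] e0 unfolding e_def by simp
  then obtain y where y: "y \<in> ?W" "pw (e - 1) y \<noteq> 0" by blast
  \<comment> \<open>Nondegeneracy of the ambient form gives a partner \<open>x\<close> in the whole
    space. Its projection \<open>s\<close> to the old chains is orthogonal to the complement, so
    \<open>x - s\<close> is a partner inside the complement.\<close>
  then obtain x where x: "skew_form x (pw (e - 1) y) \<noteq> 0"
    using skew_form_nondegenerate by blast
  define s where "s = (\<Sum>p\<in>chain_index n d. chain v p *\<^sub>H chain_coord d v x p)"
  have "skew_form (chain v p) (pw (e - 1) y) = 0" if "p \<in> chain_index n d" for p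
    using that y(1) unfolding skew_form_pw pw_pw by (auto simp: chains_perp_def chain_index_def)
  then have "skew_form s (pw (e - 1) y) = 0"
    by (simp add: s_def skew_form_sum_left skew_form_rscale_left)
  then have "skew_form (x - s) (pw (e - 1) y) \<noteq> 0"
    using x by (simp add: skew_form_simps)
  moreover have "x - s \<in> ?W" unfolding s_def by (rule chain_residual[OF chains])
  ultimately obtain u0 where u0: "u0 \<in> ?W" "skew_form u0 (pw (e - 1) u0) \<noteq> 0"
    using pwf.anisotropic[OF W _ y(1)] by blast
  have "\<exists>u1\<in>?W. skew_form u1 (pw (e - 1) u1) \<noteq> 0 \<and>
      (even e \<longrightarrow> skew_form u1 (pw (e - 1) u1) \<in> {1, - 1})"
  proof (cases "even e")
    case True
    then have "odd (e - 1)" using e0 by simp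
    from normalize_sign[OF this W u0] obtain u1 where
      "u1 \<in> ?W" "skew_form u1 (pw (e - 1) u1) \<in> {1, - 1}" by blast
    then show ?thesis by (intro bexI[of _ u1]) auto
  next
    case False
    then show ?thesis using u0 by blast
  qed
  then obtain u1 where u1: "u1 \<in> ?W" "skew_form u1 (pw (e - 1) u1) \<noteq> 0"
    "even e \<longrightarrow> skew_form u1 (pw (e - 1) u1) \<in> {1, - 1}" by blast
  obtain u where u: "u \<in> ?W" "skew_form u (pw (e - 1) u) = skew_form u1 (pw (e - 1) u1)"
    "\<And>m. m < e - 1 \<Longrightarrow> skew_form u (pw m u) = 0"
    using adjust_chain[OF W _ _ u1(1) refl u1(2)] W_pw[of _ 1] e by auto
  define d' where "d' = d(n := e)"
  define v' where "v' = v(n := u)"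
  have ul: "skew_form u (pw l u) = 0" if "l \<noteq> e - 1" for l
    using u(3)[of l] that pw_mono_zero[of e u l] e u(1)
    by (cases "l < e - 1") (auto simp: skew_form_simps)
  have uv: "skew_form (v i) (pw l u) = 0" if "i < n" for i l
    using u(1) that by (simp add: chains_perp_def)
  have vu: "skew_form u (pw l (v i)) = 0" if "i < n" for i l
    using uv[OF that] skew_form_pw_swap_0 by blast
  have "orthogonal_chains (Suc n) d' v'"
    unfolding orthogonal_chains_def d'_def v'_def
    using chains[unfolded orthogonal_chains_def] u u1 ul uv vu e e0
    by (auto simp: less_Suc_eq)
  moreover have "dim (chains_perp (Suc n) v') < dim ?W"
  proof (rule dim_psubset)
    have "chains_perp (Suc n) v' \<subseteq> ?W"
      by (auto simp: chains_perp_def v'_def)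
    moreover have "u \<notin> chains_perp (Suc n) v'"
      using u(2) u1(2) unfolding chains_perp_def v'_def by (metis (mono_tags, lifting) fun_upd_same lessI mem_Collect_eq)
    ultimately show "span (chains_perp (Suc n) v') \<subset> span ?W"
      using u(1) by (auto simp: span_eq_iff[THEN iffD2] H_subspace_imp_subspace chains_perp_H_subspace)
  qed
  ultimately show ?thesis by blast
qed

lemma exists_orthogonal_chains:
  assumes nil: "\<And>x. pw K x = 0"
  shows "\<exists>n d v. orthogonal_chains n d v \<and> chains_perp n v = {0}"
proof -
  have "\<exists>n d v. orthogonal_chains n d v \<and> chains_perp n v = {0}"
    if "orthogonal_chains n d v" for n d v
    using that
  proof (induction "dim (chains_perp n v)" arbitrary: n d v rule: less_induct)
    case less
    then show ?case using extend_chains[OF less.prems nil] by blast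
  qed
  from this[of 0] show ?thesis
    by (simp add: orthogonal_chains_def)
qed

end

section \<open>The Jordan type\<close>

text \<open>The quaternionic rank of X^k: a block of size d contributes d - k, truncated at
  0.\<close>

definition trunc_sum :: "nat multiset \<Rightarrow> nat \<Rightarrow> nat" where
  "trunc_sum D k = (\<Sum>d\<in>#D. d - k)"

text \<open>As a function of k, the truncated difference d - k is piecewise linear with its only
  bend at k = d, so its second difference is 1 exactly when d = k + 1.\<close>

lemma trunc_sum_second_difference:
  "trunc_sum D k + trunc_sum D (Suc (Suc k)) = 2 * trunc_sum D (Suc k) + count D (Suc k)"
  by (induction D) (auto simp: trunc_sum_def)

text \<open>X^k shifts positions in a chain by k, so its range is spanned by the basis vectors at
  positions at least k.\<close>

lemma dim_range_matpow:
  fixes X :: "quat^'n^'n"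
  assumes "is_jordan_type X D"
  shows "dim (range ((*v) X ^^ k)) = 4 * trunc_sum D k"
proof -
  let ?P = "\<lambda>k. (*v) X ^^ k"
  obtain ds v where D: "mset ds = D" and
    zero: "\<And>i. i < length ds \<Longrightarrow> ?P (ds ! i) (v i) = 0" and
    basis: "H_basis {(i, l). i < length ds \<and> l < ds ! i} (\<lambda>(i, l). ?P l (v i)) UNIV"
    using assms unfolding is_jordan_type_def matpow_vector by blast
  let ?I = "{(i, l). i < length ds \<and> l < ds ! i}" and ?b = "\<lambda>(i, l). ?P l (v i)"
  let ?J = "{(i, l). i < length ds \<and> k \<le> l \<and> l < ds ! i}"
  have sub: "H_subspace (range (?P k))"
  proof (rule H_subspaceI)
    show "0 \<in> range (?P k)"
      by (rule range_eqI[of _ _ 0]) (simp add: matrix_funpow_simps)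
    show "x + y \<in> range (?P k)" if "x \<in> range (?P k)" "y \<in> range (?P k)" for x y
      using that by (auto simp: matrix_funpow_simps(1)[symmetric])
    show "x *\<^sub>H a \<in> range (?P k)" if "x \<in> range (?P k)" for x a
      using that by (auto simp: matrix_funpow_simps(7)[symmetric])
  qed
  have fin: "finite ?J"
    by (rule finite_subset[of _ ?I]) (use basis in \<open>auto simp: H_basis_def\<close>)
  have "range (?P k) = H_span ?J ?b"
  proof
    show "H_span ?J ?b \<subseteq> range (?P k)"
    proof (rule H_span_subset[OF sub])
      fix p assume "p \<in> ?J"
      then obtain i l where p: "p = (i, l)" "k \<le> l" by auto
      then have "?b p = ?P k (?P (l - k) (v i))"
        by (simp flip: funpow_add o_apply[of "?P k"])
      then show "?b p \<in> range (?P k)" by simp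
    qed
    show "range (?P k) \<subseteq> H_span ?J ?b"
    proof
      fix y assume "y \<in> range (?P k)"
      then obtain x where y: "y = ?P k x" by auto
      have "x \<in> H_span ?I ?b" using basis by (simp add: H_basis_def)
      then obtain a where "x = (\<Sum>p\<in>?I. ?b p *\<^sub>H a p)" unfolding H_span_iff by blast
      then have "y = (\<Sum>p\<in>?I. ?P k (?b p) *\<^sub>H a p)" by (simp add: y matrix_funpow_simps)
      also have "\<dots> \<in> H_span ?J ?b"
      proof (rule subspace_sum[OF H_subspace_imp_subspace[OF H_subspace_H_span]],
          rule H_subspace_rscale[OF H_subspace_H_span])
        fix p assume "p \<in> ?I"
        then obtain i l where p: "p = (i, l)" "i < length ds" "l < ds ! i" by auto
        then have *: "?P k (?b p) = ?P (k + l) (v i)" by (simp add: funpow_add)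
        show "?P k (?b p) \<in> H_span ?J ?b"
        proof (cases "k + l < ds ! i")
          case True
          then have "(i, k + l) \<in> ?J" using p by auto
          from H_span_base[OF fin this, of ?b] show ?thesis by (simp add: *)
        next
          case False
          then have "?P (k + l) (v i) = 0"
            using funpow_mono_zero[OF zero[OF p(2)], of "k + l"] by auto
          then show ?thesis
            using subspace_0[OF H_subspace_imp_subspace[OF H_subspace_H_span]] by (simp only: *)
        qed
      qed
      finally show "y \<in> H_span ?J ?b" .
    qed
  qed
  moreover have "H_independent ?J ?b"
    by (rule H_independent_subset[of ?I]) (use basis in \<open>auto simp: H_basis_def\<close>)
  moreover have "card ?J = trunc_sum D k"
  proof -
    have "?J = Sigma {..<length ds} (\<lambda>i. {k..<ds ! i})" by auto
    then have "card ?J = (\<Sum>i<length ds. ds ! i - k)" by simp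
    also have "\<dots> = sum_list (map (\<lambda>d. d - k) ds)"
      by (simp add: sum_list_sum_nth atLeast0LessThan)
    also have "\<dots> = trunc_sum D k"
      by (simp add: trunc_sum_def flip: D sum_mset_sum_list mset_map)
    finally show ?thesis .
  qed
  ultimately show ?thesis using dim_H_span[OF fin] by simp
qed

lemma is_jordan_type_unique:
  assumes "is_jordan_type X D" "is_jordan_type X D'"
  shows "D = D'"
proof (rule multiset_eqI)
  fix k
  have eq: "trunc_sum D j = trunc_sum D' j" for j
    using dim_range_matpow[OF assms(1), of j] dim_range_matpow[OF assms(2), of j] by simp
  \<comment> \<open>The ranks determine the multiplicities of positive parts; the part 0 is excluded
    by the definition.\<close>
  have "0 \<notin># E" if "is_jordan_type X E" for E
    using that unfolding is_jordan_type_def by (metis in_set_conv_nth less_irrefl set_mset_mset)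
  then have "count D 0 = count D' 0" using assms by (simp add: not_in_iff)
  then show "count D k = count D' k"
    using trunc_sum_second_difference[of D "k - 1"] trunc_sum_second_difference[of D' "k - 1"]
    by (cases k) (auto simp: eq)
qed

lemma jordan_type_eq: "is_jordan_type X D \<Longrightarrow> jordan_type X = D"
  unfolding jordan_type_def by (rule the_equality) (auto intro: is_jordan_type_unique)

section \<open>Constructions on a complete orthogonal system of chains\<close>

locale orthogonal_basis = so_star_element X for X :: "quat^'n^'n" +
  fixes n :: nat and d :: "nat \<Rightarrow> nat" and v :: "nat \<Rightarrow> quat^'n"
  assumes chains: "orthogonal_chains n d v" and perp: "chains_perp n v = {0}"
begin

lemmas pos = chains_pos[OF chains]
  and zero = chains_zero[OF chains]
  and nonzero = chains_nonzero[OF chains]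
  and sign = chains_sign[OF chains]
  and orth = chains_orth[OF chains]
  and basis = chains_H_basis[OF chains perp]

lemma span: "H_span (chain_index n d) (chain v) = UNIV"
  using basis by (simp add: H_basis_def)

lemma pw_ge_zero: "i < n \<Longrightarrow> d i \<le> l \<Longrightarrow> pw l (v i) = 0"
  using zero pw_mono_zero by blast

lemma is_jordan_type: "is_jordan_type X (mset (map d [0..<n]))"
proof -
  let ?ds = "map d [0..<n]"
  have "{(i, l). i < length ?ds \<and> l < ?ds ! i} = chain_index n d"
    by (auto simp: chain_index_def)
  moreover have "(\<lambda>(i, l). matpow X l *v v i) = chain v"
    by (auto simp: matpow_vector)
  moreover have "\<forall>i<length ?ds. ?ds ! i > 0 \<and> matpow X (?ds ! i) *v v i = 0"
    using pos zero by (simp add: matpow_vector)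
  ultimately show ?thesis
    unfolding is_jordan_type_def
    by (intro exI[of _ ?ds] exI[of _ v]) (simp only: basis simp_thms)
qed

lemma jordan_type: "jordan_type X = mset (map d [0..<n])"
  by (rule jordan_type_eq[OF is_jordan_type])

lemma multi_part: "multi_part X e = card {i. i < n \<and> d i = e}"
proof -
  have "multi_part X e = length (filter (\<lambda>i. d i = e) [0..<n])"
  proof -
    have "count_list (map d xs) e = length (filter (\<lambda>i. d i = e) xs)" for xs
      by (induction xs) auto
    then show ?thesis unfolding multi_part_def jordan_type count_mset .
  qed
  also have "\<dots> = card {i. i < n \<and> d i = e}"
    by (subst distinct_card[symmetric]) (auto intro: arg_cong[of _ _ card])
  finally show ?thesis .
qed

lemma even_parts: "even_parts X = {e. even e \<and> (\<exists>i<n. d i = e)}"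
  by (auto simp: even_parts_def jordan_type)

lemma dim_UNIV_eq: "dim (UNIV :: (quat^'n) set) = 4 * (\<Sum>i<n. d i)"
  using dim_H_span[of "chain_index n d" "chain v"] basis span card_chain_index[of n d]
  by (simp add: H_basis_def)

lemma form_chain: "skew_form (pw l x) (pw m y) = (- 1) ^ l *\<^sub>R skew_form x (pw (l + m) y)"
  by (simp add: skew_form_pw pw_pw)

lemma form_chain_0:
  "i < n \<Longrightarrow> j < n \<Longrightarrow> i \<noteq> j \<or> l + m \<noteq> d i - 1 \<Longrightarrow> skew_form (pw l (v i)) (pw m (v j)) = 0"
  by (simp add: form_chain orth)

text \<open>The general shape has two instances: skewness of Z (Z against \<open>mat 1\<close>,
  \<open>r = - 1\<close>) and invariance under \<open>\<tau>\<close> (\<open>\<tau>\<close> in both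
  arguments, \<open>r = 1\<close>).\<close>

lemma sesquilinear_on_chains:
  fixes A B C E :: "quat^'n^'n"
  assumes "\<And>i l j m. i < n \<Longrightarrow> l < d i \<Longrightarrow> j < n \<Longrightarrow> m < d j \<Longrightarrow>
    skew_form (A *v pw l (v i)) (B *v pw m (v j)) = r *\<^sub>R skew_form (C *v pw l (v i)) (E *v pw m (v j))"
  shows "skew_form (A *v x) (B *v y) = r *\<^sub>R skew_form (C *v x) (E *v y)"
proof -
  let ?I = "chain_index n d"
  obtain a where x: "x = (\<Sum>p\<in>?I. chain v p *\<^sub>H a p)"
    using span H_span_iff[of x ?I "chain v"] by auto
  obtain b where y: "y = (\<Sum>p\<in>?I. chain v p *\<^sub>H b p)"
    using span H_span_iff[of y ?I "chain v"] by auto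
  have "skew_form (A *v chain v p) (B *v chain v q) = r *\<^sub>R skew_form (C *v chain v p) (E *v chain v q)"
    if "p \<in> ?I" "q \<in> ?I" for p q
    using that assms by (auto simp: chain_index_def)
  then show ?thesis
    by (simp add: x y matrix_vector_sum matrix_vector_rscale skew_form_sum_left skew_form_sum_right
        skew_form_rscale_left skew_form_rscale_right flip: scaleR_sum_right)
qed

text \<open>Prescribing 0 beyond the end of a chain, where the chain vectors vanish as well, makes
  the equation valid for every \<open>l\<close> and spares later case distinctions.\<close>

lemma exists_matrix_on_chains:
  assumes "\<And>i l. i < n \<Longrightarrow> d i \<le> l \<Longrightarrow> c i l = 0"
  shows "\<exists>A :: quat^'n^'n. \<forall>i<n. \<forall>l. A *v pw l (v i) = c i l"
proof -
  obtain A :: "quat^'n^'n" where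
    A: "\<forall>p\<in>chain_index n d. A *v chain v p = c (fst p) (snd p)"
    using exists_matrix_on_H_basis[OF basis, of "\<lambda>p. c (fst p) (snd p)"] by blast
  have "A *v pw l (v i) = c i l" if "i < n" for i l
  proof (cases "l < d i")
    case True
    then show ?thesis using A[THEN bspec, of "(i, l)"] that by (simp add: chain_index_def)
  next
    case False
    then show ?thesis using pw_ge_zero[OF that, of l] assms[OF that, of l] by simp
  qed
  then show ?thesis by blast
qed

lemma matrix_eq_on_chains:
  fixes A B :: "quat^'n^'n"
  assumes "\<And>i l. i < n \<Longrightarrow> A *v pw l (v i) = B *v pw l (v i)"
  shows "A = B"
  by (rule matrix_eq_on_H_span[OF span]) (use assms in \<open>auto simp: chain_index_def\<close>)

text \<open>A Jacobson-Morozov triple in explicit form, with \<open>v i\<close> as lowest weight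
  vector of its chain. Skewness only has to be compared where the pairing survives: at l + m = d - 1
  the weights are opposite, and at l + m = d the coefficients of Y agree.\<close>

lemma exists_sl2_triple: "\<exists>H Y. sl2_triple X H Y"
proof -
  \<comment> \<open>Weights rise by 2 along the chain and are symmetric about 0.\<close>
  define h where "h i l = 2 * real l + 1 - real (d i)" for i l
  \<comment> \<open>The solution of c(l) - c(l+1) = h(l) with c(0) = 0, as [X, Y] = H demands. It
    also vanishes at l = d, where the chain vector is 0 but its predecessor is not.\<close>
  define c where "c i l = real l * (real (d i) - real l)" for i l
  obtain H :: "quat^'n^'n" where H: "\<And>i l. i < n \<Longrightarrow> H *v pw l (v i) = h i l *\<^sub>R pw l (v i)"
    using exists_matrix_on_chains[of "\<lambda>i l. h i l *\<^sub>R pw l (v i)"] pw_ge_zero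
    by (metis (no_types, lifting) scaleR_zero_right)
  have "c i l *\<^sub>R pw (l - 1) (v i) = 0" if "i < n" "d i \<le> l" for i l
    using that pw_ge_zero[of i "l - 1"] by (cases "l = d i") (auto simp: c_def)
  from exists_matrix_on_chains[of "\<lambda>i l. c i l *\<^sub>R pw (l - 1) (v i)", OF this]
  obtain Y :: "quat^'n^'n" where Y: "\<And>i l. i < n \<Longrightarrow> Y *v pw l (v i) = c i l *\<^sub>R pw (l - 1) (v i)"
    by blast
  have X: "X *v pw l (v i) = pw (Suc l) (v i)" for i l by simp
  have skewI: "Z \<in> so_star" if "\<And>i l j m. i < n \<Longrightarrow> l < d i \<Longrightarrow> j < n \<Longrightarrow> m < d j \<Longrightarrow>
      skew_form (Z *v pw l (v i)) (pw m (v j)) = - skew_form (pw l (v i)) (Z *v pw m (v j))" for Z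
    unfolding so_star_iff
    using sesquilinear_on_chains[of Z "mat 1" "- 1" "mat 1" Z] that by simp
  have "H \<in> so_star"
  proof (rule skewI)
    fix i l j m assume *: "i < n" "l < d i" "j < n" "m < d j"
    show "skew_form (H *v pw l (v i)) (pw m (v j)) = - skew_form (pw l (v i)) (H *v pw m (v j))"
    proof (cases "i = j \<and> l + m = d i - 1")
      case True
      then have "h i l = - h j m" using * by (auto simp: h_def)
      then show ?thesis by (simp add: H * skew_form_simps)
    next
      case False
      then show ?thesis using form_chain_0[of i j l m] * by (simp add: H skew_form_simps)
    qed
  qed
  moreover have "Y \<in> so_star"
  proof (rule skewI)
    fix i l j m assume *: "i < n" "l < d i" "j < n" "m < d j"
    show "skew_form (Y *v pw l (v i)) (pw m (v j)) = - skew_form (pw l (v i)) (Y *v pw m (v j))"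
    proof (cases "l = 0 \<or> m = 0")
      case True
      have "m \<noteq> d i" if "i = j" using * that by simp
      have "l \<noteq> d i" using * by simp
      have "skew_form (v i) (pw (m - 1) (v j)) = 0" if "m \<noteq> 0"
        using that * by (intro orth) auto
      moreover have "skew_form (pw (l - 1) (v i)) (v j) = 0" if "l \<noteq> 0"
      proof -
        have "l - 1 + 0 \<noteq> d i - 1" using that * by linarith
        then show ?thesis using form_chain_0[of i j "l - 1" 0] * by simp
      qed
      ultimately show ?thesis
        using True by (auto simp: Y * c_def skew_form_simps)
    next
      case False
      then obtain l' m' where lm: "l = Suc l'" "m = Suc m'" by (metis not0_implies_Suc)
      show ?thesis
      proof (cases "i = j \<and> l' + m = d i - 1")
        case True
        then have "d i = l + m" using * lm by linarith
        then have "c i l = c j m" using True by (auto simp: c_def)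
        then show ?thesis using True
          by (simp add: Y * skew_form_simps form_chain lm del: funpow.simps)
      next
        case False
        then show ?thesis using form_chain_0[of i j l' m] form_chain_0[of i j l m'] * lm
          by (simp add: Y skew_form_simps del: funpow.simps)
      qed
    qed
  qed
  moreover have "lie_bracket H X = 2 *\<^sub>R X"
  proof (rule matrix_eq_on_chains)
    fix i l assume i: "i < n"
    show "lie_bracket H X *v pw l (v i) = (2 *\<^sub>R X) *v pw l (v i)"
      unfolding lie_bracket_def matrix_vector_mult_diff_rdistrib scaleR_matrix_vector
        matrix_vector_mul_assoc[symmetric] X H[OF i] matrix_vector_scaleR scaleR_left_diff_distrib[symmetric]
      by (simp add: h_def)
  qed
  moreover have "lie_bracket H Y = (- 2) *\<^sub>R Y"
  proof (rule matrix_eq_on_chains)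
    fix i l assume i: "i < n"
    show "lie_bracket H Y *v pw l (v i) = ((- 2) *\<^sub>R Y) *v pw l (v i)"
      unfolding lie_bracket_def matrix_vector_mult_diff_rdistrib scaleR_matrix_vector
        matrix_vector_mul_assoc[symmetric] Y[OF i] H[OF i] matrix_vector_scaleR
      by (cases l) (simp_all add: h_def c_def algebra_simps flip: scaleR_left_diff_distrib scaleR_add_left)
  qed
  moreover have "lie_bracket X Y = H"
  proof (rule matrix_eq_on_chains)
    fix i l assume i: "i < n"
    show "lie_bracket X Y *v pw l (v i) = H *v pw l (v i)"
    proof (cases l)
      case 0
      then show ?thesis
        unfolding lie_bracket_def matrix_vector_mult_diff_rdistrib
          matrix_vector_mul_assoc[symmetric] X Y[OF i] H[OF i] matrix_vector_scaleR
        by (simp add: h_def c_def algebra_simps)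
    next
      case (Suc k)
      have "X *v pw k (v i) = pw l (v i)" by (simp add: Suc)
      then show ?thesis
        unfolding lie_bracket_def matrix_vector_mult_diff_rdistrib
          matrix_vector_mul_assoc[symmetric] X Y[OF i] H[OF i] matrix_vector_scaleR
        using Suc by (simp add: h_def c_def algebra_simps flip: scaleR_left_diff_distrib)
    qed
  qed
  ultimately show ?thesis using X_so unfolding sl2_triple_def by blast
qed

text \<open>The alternating sign along a chain makes the map anticommute with X. It multiplies the
  value of the form at the top of a chain by (-1)^(d-1), which is exactly compensated by
  \<open>val\<close>: the partner has the opposite value for even size and the same value for odd
  size.\<close>

lemma strongly_real_if_swap:
  assumes \<pi>: "\<And>i. i < n \<Longrightarrow> \<pi> i < n" "\<And>i. i < n \<Longrightarrow> \<pi> (\<pi> i) = i" "\<And>i. i < n \<Longrightarrow> d (\<pi> i) = d i"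
    and val: "\<And>i. i < n \<Longrightarrow> skew_form (v (\<pi> i)) (pw (d i - 1) (v (\<pi> i))) =
      (- 1) ^ (d i - 1) *\<^sub>R skew_form (v i) (pw (d i - 1) (v i))"
  shows "strongly_Ad_real SO_star X"
proof -
  have "(- 1) ^ l *\<^sub>R pw l (v (\<pi> i)) = 0" if "i < n" "d i \<le> l" for i l
    using that pw_ge_zero[of "\<pi> i" l] \<pi> by simp
  from exists_matrix_on_chains[of "\<lambda>i l. (- 1) ^ l *\<^sub>R pw l (v (\<pi> i))", OF this] obtain \<tau> :: "quat^'n^'n" where
    \<tau>: "\<And>i l. i < n \<Longrightarrow> \<tau> *v pw l (v i) = (- 1) ^ l *\<^sub>R pw l (v (\<pi> i))" by blast
  \<comment> \<open>The complex structure needed for the reduced norm multiplies coordinates by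
    \<open>qi\<close>. It commutes with \<open>\<tau>\<close> since the entries of
    \<open>\<tau>\<close> on chain vectors are real.\<close>
  have "pw l (v i) *\<^sub>H qi = 0" if "i < n" "d i \<le> l" for i l
    using that pw_ge_zero[of i l] by simp
  from exists_matrix_on_chains[of "\<lambda>i l. pw l (v i) *\<^sub>H qi", OF this] obtain J :: "quat^'n^'n" where
    J: "\<And>i l. i < n \<Longrightarrow> J *v pw l (v i) = pw l (v i) *\<^sub>H qi" by blast
  have inv: "\<tau> ** \<tau> = mat 1"
    by (rule matrix_eq_on_chains)
      (simp add: \<tau> \<pi> matrix_vector_scaleR power_add[symmetric] flip: matrix_vector_mul_assoc)
  have "J ** J = - mat 1"
    by (rule matrix_eq_on_chains)
      (simp add: J matrix_vector_rscale rscale_assoc minus_matrix_vector flip: matrix_vector_mul_assoc)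
  moreover have "\<tau> ** J = J ** \<tau>"
    by (rule matrix_eq_on_chains)
      (simp add: J \<tau> \<pi> matrix_vector_rscale matrix_vector_scaleR rscale_scaleR_left flip: matrix_vector_mul_assoc)
  ultimately have norm: "reduced_norm \<tau> = 1"
    by (rule reduced_norm_involution[OF inv])
  have "skew_form (\<tau> *v x) (\<tau> *v y) = 1 *\<^sub>R skew_form (mat 1 *v x) (mat 1 *v y)" for x y
  proof (rule sesquilinear_on_chains)
    fix i l j m assume *: "i < n" "l < d i" "j < n" "m < d j"
    show "skew_form (\<tau> *v pw l (v i)) (\<tau> *v pw m (v j)) =
        1 *\<^sub>R skew_form (mat 1 *v pw l (v i)) (mat 1 *v pw m (v j))"
    proof (cases "i = j \<and> l + m = d i - 1")
      case True
      then have lm: "j = i" "d i - 1 = l + m" by auto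
      have "skew_form (\<tau> *v pw l (v i)) (\<tau> *v pw m (v j)) =
          ((- 1) ^ l * (- 1) ^ m * (- 1) ^ l) *\<^sub>R skew_form (v (\<pi> i)) (pw (l + m) (v (\<pi> i)))"
        using * lm by (simp add: \<tau> skew_form_simps form_chain mult.commute)
      also have "\<dots> = ((- 1) ^ l * (- 1) ^ m * (- 1) ^ l * (- 1) ^ (l + m)) *\<^sub>R
          skew_form (v i) (pw (l + m) (v i))"
        using val[OF *(1)] unfolding lm by simp
      \<comment> \<open>Three signs come from \<open>\<tau>\<close> on both arguments and from
        moving X^l across the form, the fourth from \<open>val\<close>. What remains is the sign of
        the untransformed pair in \<open>form_chain\<close>.\<close>
      also have "(- 1) ^ l * (- 1) ^ m * (- 1) ^ l * (- 1) ^ (l + m) = ((- 1) ^ l :: real)"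
        by (simp add: minus_one_power_iff)
      finally show ?thesis using lm by (simp add: form_chain)
    next
      case False
      then have "skew_form (pw l (v i)) (pw m (v j)) = 0"
        using * by (intro form_chain_0) auto
      moreover have "\<pi> i \<noteq> \<pi> j \<or> l + m \<noteq> d (\<pi> i) - 1"
        using False * \<pi> by metis
      then have "skew_form (pw l (v (\<pi> i))) (pw m (v (\<pi> j))) = 0"
        using * \<pi> by (intro form_chain_0) auto
      ultimately show ?thesis using * by (simp add: \<tau> skew_form_simps)
    qed
  qed
  then have SO: "\<tau> \<in> SO_star" using norm by (simp add: SO_star_iff)
  have "matrix_inv \<tau> = matrix_inv \<tau> ** \<tau> ** \<tau>"
    using inv by (simp flip: matrix_mul_assoc)
  then have "matrix_inv \<tau> = \<tau>" using SO_star_inverse[OF SO] by simp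
  moreover have "\<tau> ** X ** \<tau> = - X"
  proof (rule matrix_eq_on_chains)
    fix i l assume i: "i < n"
    have X: "X *v pw l (v j) = pw (Suc l) (v j)" for j by simp
    show "\<tau> ** X ** \<tau> *v pw l (v i) = - X *v pw l (v i)"
      unfolding matrix_vector_mul_assoc[symmetric] minus_matrix_vector \<tau>[OF i] X
        matrix_vector_scaleR \<tau>[OF \<pi>(1)[OF i]] \<pi>(2)[OF i]
      by (simp flip: power_add)
  qed
  ultimately have "- X = Ad \<tau> X" by (simp add: Ad_def)
  then show ?thesis using SO inv unfolding strongly_Ad_real_def by blast
qed

end

section \<open>Representations of $\mathfrak{sl}_2$\<close>

text \<open>A nilpotent map strictly lowers the dimension of a nonzero invariant subspace, and the
  images of \<open>W\<close> stay nonzero for m steps. This bounds the dimension of a string from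
  below without a proof of independence.\<close>

lemma dim_ge_of_nilpotent:
  fixes T :: "'a::euclidean_space \<Rightarrow> 'a"
  assumes T: "linear T" and W: "subspace W" "\<And>w. w \<in> W \<Longrightarrow> T w \<in> W"
    and nil: "\<And>w. w \<in> W \<Longrightarrow> (T ^^ K) w = 0" and w: "w \<in> W" "(T ^^ m) w \<noteq> 0"
  shows "m + 1 \<le> dim W"
  using W nil w
proof (induction m arbitrary: W w)
  case 0
  then have "dim W \<noteq> 0" by (auto simp: dim_eq_0)
  then show ?case by (simp del: dim_eq_0)
next
  case (Suc m)
  have sub: "subspace (T ` W)" by (rule linear_subspace_image[OF T Suc.prems(1)])
  have TW: "T ` W \<subseteq> W" using Suc.prems(2) by auto
  have "m + 1 \<le> dim (T ` W)"
  proof (rule Suc.IH[OF sub])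
    show "T w \<in> T ` W" using Suc.prems(4) by simp
    show "(T ^^ m) (T w) \<noteq> 0" using Suc.prems(5) by (simp add: funpow_swap1)
  qed (use TW Suc.prems(3) in auto)
  moreover have "T ` W \<noteq> W"
  proof
    assume eq: "T ` W = W"
    have "(T ^^ k) ` W = W" for k
    proof (induction k)
      case (Suc k)
      have "(T ^^ Suc k) ` W = T ` ((T ^^ k) ` W)" by (simp only: funpow.simps image_comp)
      then show ?case by (simp only: Suc eq)
    qed simp
    then have "(T ^^ K) ` W = W" .
    moreover have "(T ^^ K) ` W \<subseteq> {0}" using Suc.prems(3) by auto
    ultimately have "w = 0" using Suc.prems(4) by auto
    moreover have "(T ^^ Suc m) 0 = 0" using T by (induction m) (auto simp: linear_0)
    ultimately show False using Suc.prems(5) by simp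
  qed
  then have "dim (T ` W) < dim W"
    using TW sub Suc.prems(1) by (intro dim_psubset) (auto simp: span_eq_iff[THEN iffD2])
  ultimately show ?case by simp
qed

lemma exists_first_zero:
  fixes f :: "nat \<Rightarrow> 'a::zero"
  assumes "f K = 0" "f 0 \<noteq> 0"
  shows "\<exists>k<K. f k \<noteq> 0 \<and> f (Suc k) = 0"
  using assms by (induction K) (metis less_Suc_eq zero_less_Suc lessI, metis less_Suc_eq)

lemma rank_nullity_ge:
  fixes f :: "'a::euclidean_space \<Rightarrow> 'b::euclidean_space"
  assumes "linear f"
  shows "DIM('a) \<le> dim {x. f x = 0} + dim (range f)"
proof -
  let ?N = "{x. f x = 0}" and ?C = "{y \<in> UNIV. \<forall>x\<in>{x. f x = 0}. orthogonal x y}"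
  have N: "subspace ?N" using assms by (auto simp: subspace_def linear_add linear_cmul linear_0)
  have C: "subspace ?C" by (auto simp: subspace_def orthogonal_def inner_simps)
  have "inj_on f ?C"
  proof (rule inj_onI)
    fix x y assume "x \<in> ?C" "y \<in> ?C" "f x = f y"
    then have "x - y \<in> ?C" "x - y \<in> ?N"
      using subspace_diff[OF C] assms by (auto simp: linear_diff)
    then have "orthogonal (x - y) (x - y)" by blast
    then show "x = y" by (simp add: orthogonal_self)
  qed
  then have "dim (f ` ?C) = dim ?C"
    using assms C by (intro dim_image_eq) (auto simp: span_eq_iff[THEN iffD2])
  moreover have "dim (f ` ?C) \<le> dim (range f)" by (rule dim_subset) auto
  moreover have "dim ?C + dim ?N = DIM('a)"
    using dim_subspace_orthogonal_to_vectors[OF N subspace_UNIV] by simp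
  ultimately show ?thesis by linarith
qed

lemma dim_UN_le:
  fixes S :: "'i \<Rightarrow> 'a::euclidean_space set"
  assumes "finite I"
  shows "dim (\<Union>i\<in>I. S i) \<le> (\<Sum>i\<in>I. dim (S i))"
  using assms
proof (induction I rule: finite_induct)
  case (insert i I)
  have "dim (\<Union>j\<in>insert i I. S j) = dim (S i \<union> (\<Union>j\<in>I. S j))" by simp
  also have "\<dots> = dim (span (S i \<union> (\<Union>j\<in>I. S j)))" by simp
  also have "\<dots> \<le> dim (span (S i)) + dim (span (\<Union>j\<in>I. S j))"
    using dim_sums_Int[of "span (S i)" "span (\<Union>j\<in>I. S j)"] by (simp add: span_Un)
  finally show ?case using insert by simp
qed (simp)

section \<open>Real representations: weights and lowest weight vectors\<close>

locale sl2_rep =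
  fixes X H Y :: "'a::euclidean_space \<Rightarrow> 'a"
  assumes lin: "linear X" "linear H" "linear Y"
    and HX: "H (X w) = X (H w) + 2 *\<^sub>R X w"
    and HY: "H (Y w) = Y (H w) - 2 *\<^sub>R Y w"
    and XY: "X (Y w) = Y (X w) + H w"
begin

lemmas lin_simps =
  lin[THEN linear_add] lin[THEN linear_diff] lin[THEN linear_cmul] lin[THEN linear_0]
  lin[THEN linear_neg]

lemma linear_funpow: "linear (X ^^ k)" "linear (Y ^^ k)" "linear (H ^^ k)"
proof -
  have *: "linear (f ^^ k)" if "linear f" for f :: "'a \<Rightarrow> 'a"
  proof (induction k)
    case (Suc k)
    then show ?case using linear_compose[OF Suc that] by (simp add: o_def)
  qed (simp add: linear_id[unfolded id_def] id_def)
  show "linear (X ^^ k)" "linear (Y ^^ k)" "linear (H ^^ k)" using lin * by auto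
qed

lemmas funpow_simps =
  linear_funpow[THEN linear_add] linear_funpow[THEN linear_diff] linear_funpow[THEN linear_cmul]
  linear_funpow[THEN linear_0] linear_funpow[THEN linear_neg] linear_funpow[THEN linear_sum]

text \<open>The Weyl reflection: each statement about Y and lowest weights also yields one about X
  and highest weights.\<close>

lemma opposite: "sl2_rep Y (\<lambda>w. - H w) X"
  by unfold_locales (auto simp: lin HX HY XY lin_simps linear_compose_neg)

lemma H_X_pow: "H ((X ^^ k) w) = (X ^^ k) (H w) + (2 * real k) *\<^sub>R (X ^^ k) w"
proof (induction k)
  case (Suc k)
  show ?case
    by (simp only: funpow.simps o_apply HX Suc lin_simps) (simp add: algebra_simps)
qed simp

lemma H_Y_pow: "H ((Y ^^ k) w) = (Y ^^ k) (H w) - (2 * real k) *\<^sub>R (Y ^^ k) w"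
proof (induction k)
  case (Suc k)
  show ?case
    by (simp only: funpow.simps o_apply HY Suc lin_simps) (simp add: algebra_simps)
qed simp

text \<open>\<open>Y ^^ k\<close> is an eigenvector of \<open>ad H\<close> for the eigenvalue \<open>- 2 * k\<close>, which is bounded
  by \<open>2 * onorm H\<close> unless \<open>Y ^^ k\<close> vanishes.\<close>

lemma Y_nilpotent: "\<exists>K. \<forall>w. (Y ^^ K) w = 0"
proof -
  obtain K :: nat where K: "onorm H < real K" using reals_Archimedean2 by blast
  have blH: "bounded_linear H" and bl: "bounded_linear (Y ^^ K)"
    using lin linear_funpow by (auto simp: linear_conv_bounded_linear)
  have "norm ((Y ^^ K) w) \<le> (onorm H * onorm (Y ^^ K) / real K) * norm w" for w
  proof -
    have "(2 * real K) *\<^sub>R (Y ^^ K) w = (Y ^^ K) (H w) - H ((Y ^^ K) w)"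
      by (simp add: H_Y_pow)
    then have "2 * real K * norm ((Y ^^ K) w) = norm ((Y ^^ K) (H w) - H ((Y ^^ K) w))"
      by (metis norm_scaleR abs_of_nonneg mult_nonneg_nonneg of_nat_0_le_iff zero_le_numeral)
    also have "\<dots> \<le> norm ((Y ^^ K) (H w)) + norm (H ((Y ^^ K) w))"
      by (rule norm_triangle_ineq4)
    also have "\<dots> \<le> onorm (Y ^^ K) * (onorm H * norm w) + onorm H * (onorm (Y ^^ K) * norm w)"
      by (intro add_mono order_trans[OF onorm[OF bl]] order_trans[OF onorm[OF blH]]
          mult_left_mono onorm[OF bl] onorm[OF blH] onorm_pos_le bl blH)
    finally have "real K * norm ((Y ^^ K) w) \<le> onorm H * onorm (Y ^^ K) * norm w" by (simp add: ac_simps)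
    moreover have "0 < real K" using K onorm_pos_le[OF blH] by linarith
    ultimately show ?thesis by (simp add: field_simps)
  qed
  \<comment> \<open>As \<open>onorm H < real K\<close>, a norm is bounded by itself times a factor
    below 1, so it is 0.\<close>
  then have *: "onorm (Y ^^ K) \<le> onorm H * onorm (Y ^^ K) / real K" by (rule onorm_le)
  have "onorm (Y ^^ K) = 0"
  proof (rule ccontr)
    assume "onorm (Y ^^ K) \<noteq> 0"
    then have "0 < onorm (Y ^^ K)" using onorm_pos_le[OF bl] by simp
    moreover have "0 < real K" using K onorm_pos_le[OF blH] by linarith
    ultimately show False using * K by (simp add: field_simps)
  qed
  then show ?thesis using onorm_eq_0[OF bl] by blast
qed

lemma X_nilpotent: "\<exists>K. \<forall>w. (X ^^ K) w = 0"
  by (rule sl2_rep.Y_nilpotent[OF opposite])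

text \<open>Assumed is only that Y kills \<open>w\<close>, not that \<open>w\<close> is a weight
  vector. If X^(k+1) kills \<open>w\<close>, the formula shows that X^k kills (H + k) w, which is
  how weights are produced later.\<close>

lemma Y_X_pow:
  assumes "Y w = 0"
  shows "Y ((X ^^ Suc k) w) = - real (Suc k) *\<^sub>R (X ^^ k) (H w + real k *\<^sub>R w)"
proof (induction k)
  case 0
  have "Y (X w) = X (Y w) - H w" by (simp add: XY)
  then show ?case using assms by (simp add: lin_simps)
next
  case (Suc k)
  have "Y ((X ^^ Suc (Suc k)) w) = X (Y ((X ^^ Suc k) w)) - H ((X ^^ Suc k) w)"
    by (simp add: XY)
  also have "\<dots> = X (- real (Suc k) *\<^sub>R (X ^^ k) (H w + real k *\<^sub>R w)) -
      ((X ^^ Suc k) (H w) + (2 * real (Suc k)) *\<^sub>R (X ^^ Suc k) w)"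
    by (simp only: Suc H_X_pow)
  also have "\<dots> = - real (Suc (Suc k)) *\<^sub>R (X ^^ Suc k) (H w + real (Suc k) *\<^sub>R w)"
    by (simp add: lin_simps funpow_simps algebra_simps scaleR_2)
  finally show ?case .
qed

definition lowest_weight :: "nat \<Rightarrow> 'a set" where
  "lowest_weight m = {w. Y w = 0 \<and> H w = - real m *\<^sub>R w}"

lemma lowest_weight_subspace: "subspace (lowest_weight m)"
  by (auto simp: subspace_def lowest_weight_def lin_simps algebra_simps)

lemma Y_X_pow_lowest:
  "w \<in> lowest_weight m \<Longrightarrow> Y ((X ^^ Suc k) w) = (real (Suc k) * (real m - real k)) *\<^sub>R (X ^^ k) w"
  by (simp add: Y_X_pow lowest_weight_def lin_simps funpow_simps algebra_simps
      del: funpow.simps)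

text \<open>The factor (k+1)(m-k) in \<open>Y_X_pow_lowest\<close> is nonzero for k > m, so a
  nonzero X^(m+1) w would force all higher powers to be nonzero, against nilpotency.\<close>

lemma lowest_weight_X_zero:
  assumes "w \<in> lowest_weight m"
  shows "(X ^^ Suc m) w = 0"
proof (rule ccontr)
  assume nz: "(X ^^ Suc m) w \<noteq> 0"
  have "(X ^^ (Suc m + k)) w \<noteq> 0" for k
  proof (induction k)
    case (Suc k)
    show ?case
    proof
      assume "(X ^^ (Suc m + Suc k)) w = 0"
      then have "(real (Suc (Suc m + k)) * (real m - real (Suc m + k))) *\<^sub>R (X ^^ (Suc m + k)) w = 0"
        using Y_X_pow_lowest[OF assms, of "Suc m + k"] by (simp add: lin_simps del: funpow.simps)
      then show False using Suc by (simp del: funpow.simps)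
    qed
  qed (use nz in simp)
  moreover obtain K where "\<forall>w. (X ^^ K) w = 0" using X_nilpotent by blast
  then have "(X ^^ (Suc m + K)) w = 0"
    using funpow_mono_zero[where f = X and k = K and m = "Suc m + K"] lin_simps by simp
  ultimately show False by blast
qed

lemma lowest_weight_X_nonzero:
  assumes w: "w \<in> lowest_weight m" "w \<noteq> 0" and "k \<le> m"
  shows "(X ^^ k) w \<noteq> 0"
  using assms(3)
proof (induction k)
  case (Suc k)
  show ?case
  proof
    assume "(X ^^ Suc k) w = 0"
    then have "(real (Suc k) * (real m - real k)) *\<^sub>R (X ^^ k) w = 0"
      using Y_X_pow_lowest[OF w(1), of k] by (simp add: lin_simps del: funpow.simps)
    then show False using Suc by simp
  qed
qed (use w in simp)

lemma no_positive_lowest_weight: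
  assumes "Y w = 0" "H w = r *\<^sub>R w" "0 < r"
  shows "w = 0"
proof (rule ccontr)
  assume "w \<noteq> 0"
  have "(X ^^ k) w \<noteq> 0" for k
  proof (induction k)
    case (Suc k)
    show ?case
    proof
      assume "(X ^^ Suc k) w = 0"
      then have "- real (Suc k) *\<^sub>R (X ^^ k) (r *\<^sub>R w + real k *\<^sub>R w) = 0"
        using Y_X_pow[OF assms(1), of k] assms(2) by (simp add: lin_simps del: funpow.simps)
      then have "(real (Suc k) * (r + real k)) *\<^sub>R (X ^^ k) w = 0"
        by (simp add: funpow_simps flip: scaleR_add_left)
      then show False using Suc assms(3) by simp
    qed
  qed (use \<open>w \<noteq> 0\<close> in simp)
  then show False using X_nilpotent by blast
qed

text \<open>H + k maps the vectors of ker Y killed by X^(k+1) to those killed by X^k, which the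
  induction hypothesis splits into weights -m with m < k. Thus H is diagonalizable on ker Y.\<close>

lemma kernel_Y_decompose:
  assumes "Y w = 0" "(X ^^ k) w = 0"
  shows "\<exists>u. (\<forall>m<k. u m \<in> lowest_weight m) \<and> w = (\<Sum>m<k. u m)"
  using assms
proof (induction k arbitrary: w)
  case (Suc k)
  let ?w = "H w + real k *\<^sub>R w"
  have "(real (Suc k)) *\<^sub>R (X ^^ k) ?w = 0"
    using Y_X_pow[OF Suc.prems(1), of k] Suc.prems(2) by (simp add: lin_simps del: funpow.simps)
  then have "(X ^^ k) ?w = 0" by simp
  moreover have "Y ?w = 0"
    using HY[of w] Suc.prems(1) by (simp add: lin_simps)
  ultimately obtain u where u: "\<forall>m<k. u m \<in> lowest_weight m" "?w = (\<Sum>m<k. u m)"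
    using Suc.IH by blast
  \<comment> \<open>H + k acts on weight -m as the nonzero scalar k - m, so these are preimages of
    the \<open>u m\<close>; the difference \<open>z\<close> is annihilated by H + k and has weight
    -k.\<close>
  define u' where "u' m = (1 / (real k - real m)) *\<^sub>R u m" for m
  define z where "z = w - (\<Sum>m<k. u' m)"
  have u': "u' m \<in> lowest_weight m" if "m < k" for m
    using u(1) that lowest_weight_subspace by (auto simp: u'_def intro: subspace_scale)
  have "H (\<Sum>m<k. u' m) + real k *\<^sub>R (\<Sum>m<k. u' m) = (\<Sum>m<k. H (u' m) + real k *\<^sub>R u' m)"
    by (simp add: linear_sum[OF lin(2)] scaleR_sum_right sum.distrib)
  also have "\<dots> = (\<Sum>m<k. u m)"
  proof (rule sum.cong[OF refl])
    fix m assume m: "m \<in> {..<k}"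
    then have "H (u' m) + real k *\<^sub>R u' m = (real k - real m) *\<^sub>R u' m"
      using u' by (simp add: lowest_weight_def algebra_simps)
    then show "H (u' m) + real k *\<^sub>R u' m = u m" using m by (simp add: u'_def)
  qed
  finally have "H z + real k *\<^sub>R z = 0"
    using u(2) by (simp add: z_def lin_simps algebra_simps)
  moreover have "Y (\<Sum>m<k. u' m) = 0"
    using u' by (simp add: linear_sum[OF lin(3)] lowest_weight_def)
  then have "Y z = 0" using Suc.prems(1) by (simp add: z_def lin_simps)
  ultimately have "z \<in> lowest_weight k"
    by (simp add: lowest_weight_def eq_neg_iff_add_eq_0)
  then have "\<forall>m<Suc k. (u'(k := z)) m \<in> lowest_weight m" "w = (\<Sum>m<Suc k. (u'(k := z)) m)"
    using u' by (auto simp: less_Suc_eq z_def)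
  then show ?case by blast
qed (auto)

text \<open>A vector of minimal nilpotency order in \<open>Z\<close> is a weight vector.\<close>

lemma exists_lowest_weight:
  assumes Z: "subspace Z" "\<And>z. z \<in> Z \<Longrightarrow> Y z = 0" "\<And>z. z \<in> Z \<Longrightarrow> H z \<in> Z"
    and nz: "z0 \<in> Z" "z0 \<noteq> 0"
  shows "\<exists>m. \<exists>z\<in>Z. z \<noteq> 0 \<and> z \<in> lowest_weight m"
proof -
  obtain K where K: "\<forall>w. (X ^^ K) w = 0" using X_nilpotent by blast
  define k where "k = (LEAST k. \<exists>z\<in>Z. z \<noteq> 0 \<and> (X ^^ k) z = 0)"
  have "\<exists>z\<in>Z. z \<noteq> 0 \<and> (X ^^ k) z = 0"
    unfolding k_def by (rule LeastI[of _ K]) (use nz K in blast)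
  then obtain z where z: "z \<in> Z" "z \<noteq> 0" "(X ^^ k) z = 0" by blast
  have least: "k \<le> j" if "u \<in> Z" "u \<noteq> 0" "(X ^^ j) u = 0" for j u
    unfolding k_def by (rule Least_le) (use that in blast)
  obtain m where k: "k = Suc m" using z by (cases k) auto
  let ?w = "H z + real m *\<^sub>R z"
  have "real (Suc m) *\<^sub>R (X ^^ m) ?w = 0"
    using Y_X_pow[OF Z(2)[OF z(1)], of m] z(3) by (simp add: k lin_simps del: funpow.simps)
  then have "(X ^^ m) ?w = 0" by simp
  moreover have "?w \<in> Z" using Z z by (simp add: subspace_add subspace_scale)
  ultimately have "?w = 0" using least k by fastforce
  then have "z \<in> lowest_weight m"
    using Z(2) z(1) by (simp add: lowest_weight_def eq_neg_iff_add_eq_0)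
  then show ?thesis using z by blast
qed

text \<open>By \<open>kernel_Y_decompose\<close> for the opposite triple, H is diagonalizable on ker
  X with eigenvalues at least 0, so H + r can be inverted there.\<close>

lemma kernel_X_shift_surj:
  assumes "X w = 0" "0 < r"
  shows "\<exists>u. X u = 0 \<and> H u + r *\<^sub>R u = w"
proof -
  interpret op: sl2_rep Y "\<lambda>w. - H w" X by (rule opposite)
  obtain K where "\<forall>w. (Y ^^ K) w = 0" using Y_nilpotent by blast
  then obtain u where u: "\<forall>m<K. u m \<in> op.lowest_weight m" "w = (\<Sum>m<K. u m)"
    using op.kernel_Y_decompose[OF assms(1), of K] by blast
  have um: "X (u m) = 0" "H (u m) = real m *\<^sub>R u m" if "m < K" for m
    using u(1) that by (auto simp: op.lowest_weight_def)
  let ?u = "\<Sum>m<K. (1 / (real m + r)) *\<^sub>R u m"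
  have "H ?u + r *\<^sub>R ?u = (\<Sum>m<K. (1 / (real m + r)) *\<^sub>R H (u m) + r *\<^sub>R (1 / (real m + r)) *\<^sub>R u m)"
    by (simp add: linear_sum[OF lin(2)] lin_simps scaleR_sum_right sum.distrib)
  also have "\<dots> = (\<Sum>m<K. u m)"
  proof (rule sum.cong[OF refl])
    fix m assume m: "m \<in> {..<K}"
    define q where "q = 1 / (real m + r)"
    have "q *\<^sub>R H (u m) + r *\<^sub>R q *\<^sub>R u m = (q * (real m + r)) *\<^sub>R u m"
      using m by (simp add: um distrib_left scaleR_add_left mult.commute)
    also have "q * (real m + r) = 1" using assms(2) by (simp add: q_def)
    finally show "(1 / (real m + r)) *\<^sub>R H (u m) + r *\<^sub>R (1 / (real m + r)) *\<^sub>R u m = u m"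
      by (simp add: q_def)
  qed
  finally have "H ?u + r *\<^sub>R ?u = w" using u(2) by simp
  moreover have "X ?u = 0" by (simp add: linear_sum[OF lin(1)] lin_simps um)
  ultimately show ?thesis by blast
qed

text \<open>For a lowest weight vector \<open>X u\<close> of weight \<open>- m\<close>, the vector \<open>u\<close> can be corrected by an
  element of the kernel of \<open>X\<close> so as to have weight \<open>- (m + 2)\<close>; then \<open>X (Y ^^ Suc k) u\<close> is a
  nonzero multiple of \<open>(Y ^^ k) u\<close> for every \<open>k\<close>.\<close>

lemma kernel_Y_Int_range_X: "{w. Y w = 0} \<inter> range X = {0}"
proof (rule ccontr)
  let ?Z = "{w. Y w = 0} \<inter> range X"
  have Z: "subspace ?Z"
    by (intro subspace_inter linear_subspace_image[OF lin(1)])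
      (auto simp: subspace_def lin_simps)
  assume "?Z \<noteq> {0}"
  then obtain z0 where "z0 \<in> ?Z" "z0 \<noteq> 0" using subspace_0[OF Z] by blast
  moreover have "H z \<in> ?Z" if z: "z \<in> ?Z" for z
  proof -
    obtain u where u: "z = X u" using z by auto
    have "H z = X (H u + 2 *\<^sub>R u)" by (simp add: u HX lin_simps)
    moreover have "Y (H z) = 0" using z HY[of z] by (simp add: lin_simps)
    ultimately show ?thesis by blast
  qed
  ultimately obtain m z where z: "z \<in> ?Z" "z \<noteq> 0" "z \<in> lowest_weight m"
    using exists_lowest_weight[OF Z] by blast
  obtain u where u: "z = X u" using z(1) by blast
  have "X (H u + (real m + 2) *\<^sub>R u) = H z + real m *\<^sub>R z"
    by (simp add: u HX lin_simps algebra_simps)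
  also have "\<dots> = 0" using z(3) by (simp add: lowest_weight_def)
  finally obtain u0 where u0: "X u0 = 0" "H u0 + (real m + 2) *\<^sub>R u0 = H u + (real m + 2) *\<^sub>R u"
    using kernel_X_shift_surj[of _ "real m + 2"] by fastforce
  define w where "w = u - u0"
  have Xw: "X w = z" by (simp add: w_def lin_simps u0 u)
  have Hw: "H w = - (real m + 2) *\<^sub>R w"
    using u0(2) by (simp add: w_def lin_simps algebra_simps)
  \<comment> \<open>Only the sign of the factor matters: it starts at -(m+2), and every further step
    subtracts a positive amount. Hence no power of Y kills \<open>w\<close>, against
    nilpotency.\<close>
  have rec: "\<exists>c<0. X ((Y ^^ Suc k) w) = c *\<^sub>R (Y ^^ k) w" for k
  proof (induction k)
    case 0
    have "Y z = 0" using z(1) by simp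
    then have "X (Y w) = - (real m + 2) *\<^sub>R w" by (simp add: XY Xw Hw)
    then show ?case by (intro exI[of _ "- (real m + 2)"]) simp
  next
    case (Suc k)
    then obtain c where c: "c < 0" "X ((Y ^^ Suc k) w) = c *\<^sub>R (Y ^^ k) w" by blast
    have "X ((Y ^^ Suc (Suc k)) w) = Y (X ((Y ^^ Suc k) w)) + H ((Y ^^ Suc k) w)"
      by (simp add: XY)
    also have "\<dots> = (c - (real m + 2) - 2 * real (Suc k)) *\<^sub>R (Y ^^ Suc k) w"
      unfolding c(2) H_Y_pow Hw
      by (simp add: lin_simps funpow_simps algebra_simps) (simp flip: scaleR_add_left)
    finally show ?case using c(1)
      by (intro exI[of _ "c - (real m + 2) - 2 * real (Suc k)"]) auto
  qed
  have "(Y ^^ k) w \<noteq> 0" for k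
  proof (induction k)
    case 0
    then show ?case using Xw z(2) by (auto simp: lin_simps)
  next
    case (Suc k)
    obtain c where "c < 0" "X ((Y ^^ Suc k) w) = c *\<^sub>R (Y ^^ k) w" using rec by blast
    then show ?case using Suc by (metis lin_simps(10) scaleR_eq_0_iff less_irrefl)
  qed
  then show False using Y_nilpotent by blast
qed

lemma dim_kernel_Y_le: "dim {w. Y w = 0} + dim (range X) \<le> DIM('a)"
proof -
  have "subspace {w. Y w = 0}" by (auto simp: subspace_def lin_simps)
  then have "dim {x + y |x y. x \<in> {w. Y w = 0} \<and> y \<in> range X} + dim ({w. Y w = 0} \<inter> range X)
      = dim {w. Y w = 0} + dim (range X)"
    by (intro dim_sums_Int linear_subspace_image[OF lin(1)]) simp_all
  then show ?thesis
    using dim_subset_UNIV[of "{x + y |x y. x \<in> {w. Y w = 0} \<and> y \<in> range X}"]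
    by (simp add: kernel_Y_Int_range_X)
qed

text \<open>The bound dim ker Y + rank X <= dim V, its mirror image with X and Y exchanged, and the
  rank-nullity bounds for X and for Y can hold together only as equalities.\<close>

lemma kernel_Y_plus_range_X: "\<exists>k u. Y k = 0 \<and> w = k + X u"
proof -
  let ?S = "{x + y |x y. x \<in> {w. Y w = 0} \<and> y \<in> range X}"
  have k: "subspace {w. Y w = 0}" "subspace (range X)"
    by (auto simp: subspace_def[of "{w. Y w = 0}"] lin_simps intro: linear_subspace_image[OF lin(1)])
  have "dim {w. X w = 0} + dim (range Y) \<le> DIM('a)"
    by (rule sl2_rep.dim_kernel_Y_le[OF opposite])
  moreover have "dim {w. Y w = 0} + dim (range X) \<le> DIM('a)" by (rule dim_kernel_Y_le)
  moreover have "DIM('a) \<le> dim {w. X w = 0} + dim (range X)"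
    "DIM('a) \<le> dim {w. Y w = 0} + dim (range Y)"
    using lin by (auto intro: rank_nullity_ge)
  ultimately have "dim {w. Y w = 0} + dim (range X) = DIM('a)" by linarith
  then have "dim ?S = DIM('a)"
    using dim_sums_Int[OF k] by (simp add: kernel_Y_Int_range_X)
  then have "?S = UNIV"
    by (intro subspace_dim_equal subspace_sums[OF k]) (simp_all only: subspace_UNIV subset_UNIV dim_UNIV)
  then show ?thesis by blast
qed

definition chains_span :: "nat \<Rightarrow> 'a set" where
  "chains_span K = span (\<Union>m<K. \<Union>l\<le>m. (X ^^ l) ` lowest_weight m)"

text \<open>Substituting V = ker Y + X V into itself gives V = S + X^j V for every j, where S is the
  span of the strings: it contains ker Y and is stable under X. At j = K the last summand is
  0.\<close>

lemma chains_span_UNIV: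
  assumes K: "\<And>w. (X ^^ K) w = 0"
  shows "chains_span K = UNIV"
proof -
  let ?B = "\<Union>m<K. \<Union>l\<le>m. (X ^^ l) ` lowest_weight m"
  have sub: "subspace (chains_span K)" by (simp add: chains_span_def)
  have base: "(X ^^ l) w \<in> chains_span K" if "m < K" "w \<in> lowest_weight m" for l m w
  proof (cases "l \<le> m")
    case True
    then show ?thesis using that unfolding chains_span_def by (intro span_base) blast
  next
    case False
    then have "(X ^^ l) w = 0"
      using funpow_mono_zero[OF lowest_weight_X_zero[OF that(2)], of l] lin_simps by simp
    then show ?thesis using subspace_0[OF sub] by simp
  qed
  have ker: "w \<in> chains_span K" if w: "Y w = 0" for w
  proof -
    obtain u where "\<forall>m<K. u m \<in> lowest_weight m" "w = (\<Sum>m<K. u m)"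
      using kernel_Y_decompose[OF w K] by blast
    then show ?thesis using base[of _ _ 0] by (auto intro!: subspace_sum[OF sub])
  qed
  have stable: "X w \<in> chains_span K" if "w \<in> chains_span K" for w
    using that unfolding chains_span_def
  proof (induction rule: span_induct_alt)
    case base
    then show ?case by (simp add: lin_simps span_zero)
  next
    case (step c x y)
    then obtain m l z where "m < K" "z \<in> lowest_weight m" "x = (X ^^ l) z" by blast
    then have "X x \<in> span ?B" using base[of m z "Suc l"] by (simp add: chains_span_def)
    then show ?case using step.IH by (simp add: lin_simps span_add span_scale)
  qed
  have X_pow: "(X ^^ j) w \<in> chains_span K" if "w \<in> chains_span K" for j w
    using that stable by (induction j) auto
  have "\<exists>s\<in>chains_span K. \<exists>u. w = s + (X ^^ j) u" for w j
  proof (induction j)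
    case 0
    then show ?case using subspace_0[OF sub] by (intro bexI[of _ 0]) auto
  next
    case (Suc j)
    then obtain s u where s: "s \<in> chains_span K" "w = s + (X ^^ j) u" by blast
    obtain k u' where k: "Y k = 0" "u = k + X u'" using kernel_Y_plus_range_X by blast
    have "w = (s + (X ^^ j) k) + (X ^^ Suc j) u'"
      using s k by (simp add: funpow_simps funpow_swap1)
    moreover have "s + (X ^^ j) k \<in> chains_span K"
      using s X_pow[OF ker[OF k(1)]] subspace_add[OF sub] by blast
    ultimately show ?case by blast
  qed
  from this[of _ K] have "w \<in> chains_span K" for w using K by (metis add.right_neutral)
  then show ?thesis by blast
qed

lemma dim_le_sum_lowest_weight:
  assumes K: "\<And>w. (X ^^ K) w = 0"
  shows "DIM('a) \<le> (\<Sum>m<K. Suc m * dim (lowest_weight m))"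
proof -
  have "DIM('a) = dim (\<Union>m<K. \<Union>l\<le>m. (X ^^ l) ` lowest_weight m)"
    using arg_cong[OF chains_span_UNIV[OF K], of dim] unfolding chains_span_def dim_span dim_UNIV
    by (rule sym)
  also have "\<dots> \<le> (\<Sum>m<K. dim (\<Union>l\<le>m. (X ^^ l) ` lowest_weight m))"
    by (rule dim_UN_le) simp
  also have "\<dots> \<le> (\<Sum>m<K. \<Sum>l\<le>m. dim ((X ^^ l) ` lowest_weight m))"
    by (intro sum_mono dim_UN_le) simp
  also have "\<dots> \<le> (\<Sum>m<K. \<Sum>l\<le>m. dim (lowest_weight m))"
    by (intro sum_mono dim_image_le linear_funpow)
  finally show ?thesis by simp
qed

text \<open>The Casimir operator H^2 + 2(XY + YX), rewritten with XY - YX = H so that the last term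
  vanishes on ker Y. It is constant on strings and tells their highest weights apart.\<close>

definition casimir :: "'a \<Rightarrow> 'a" where
  "casimir w = H (H w) - 2 *\<^sub>R H w + 4 *\<^sub>R X (Y w)"

lemma casimir_X: "casimir (X w) = X (casimir w)"
proof -
  have "Y (X w) = X (Y w) - H w" by (simp add: XY)
  then show ?thesis
    by (simp only: casimir_def HX lin_simps)
      (simp add: euclidean_eq_iff[where 'a = 'a] inner_simps algebra_simps)
qed

lemma casimir_lowest: "w \<in> lowest_weight m \<Longrightarrow> casimir w = (real m * (real m + 2)) *\<^sub>R w"
  by (simp add: casimir_def lowest_weight_def lin_simps algebra_simps)

section \<open>Irreducible submodules, strings and isotypic components\<close>

definition submodule :: "'a set \<Rightarrow> bool" where
  "submodule W \<longleftrightarrow> subspace W \<and> (\<forall>w\<in>W. X w \<in> W \<and> H w \<in> W \<and> Y w \<in> W)"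

definition irreducible_submodule :: "'a set \<Rightarrow> bool" where
  "irreducible_submodule W \<longleftrightarrow> submodule W \<and> W \<noteq> {0} \<and>
    (\<forall>U. submodule U \<and> U \<subseteq> W \<longrightarrow> U = {0} \<or> U = W)"

text \<open>The last nonzero Y^k w lies in the intersection of \<open>W\<close> with ker Y, which is
  stable under H.\<close>

lemma submodule_lowest_weight:
  assumes W: "submodule W" "W \<noteq> {0}"
  shows "\<exists>m. \<exists>w\<in>W. w \<noteq> 0 \<and> w \<in> lowest_weight m"
proof -
  have sub: "subspace W" using W(1) by (simp add: submodule_def)
  obtain w where w: "w \<in> W" "w \<noteq> 0" using W(2) subspace_0[OF sub] by blast
  obtain K where "\<forall>w. (Y ^^ K) w = 0" using Y_nilpotent by blast
  then obtain k where k: "(Y ^^ k) w \<noteq> 0" "(Y ^^ Suc k) w = 0"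
    using exists_first_zero[of "\<lambda>k. (Y ^^ k) w" K] w(2) by auto
  have Yk: "(Y ^^ k) w \<in> W"
    using w(1) W(1) by (induction k) (auto simp: submodule_def)
  have "\<exists>m. \<exists>z\<in>W \<inter> {w. Y w = 0}. z \<noteq> 0 \<and> z \<in> lowest_weight m"
  proof (rule exists_lowest_weight)
    show "subspace (W \<inter> {w. Y w = 0})"
      using sub by (intro subspace_inter) (auto simp: subspace_def lin_simps)
    show "H z \<in> W \<inter> {w. Y w = 0}" if "z \<in> W \<inter> {w. Y w = 0}" for z
      using that W(1) HY[of z] by (auto simp: submodule_def lin_simps)
    show "(Y ^^ k) w \<in> W \<inter> {w. Y w = 0}" using Yk k(2) by simp
  qed (use k in auto)
  then show ?thesis by blast
qed

definition string :: "'a \<Rightarrow> nat \<Rightarrow> 'a set" where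
  "string w m = span ((\<lambda>l. (X ^^ l) w) ` {..m})"

lemma string_submodule:
  assumes w: "w \<in> lowest_weight m"
  shows "submodule (string w m)"
  unfolding submodule_def
proof (intro conjI ballI)
  let ?B = "(\<lambda>l. (X ^^ l) w) ` {..m}"
  show "subspace (string w m)" by (simp add: string_def)
  have B: "(X ^^ l) w \<in> span ?B" for l
  proof (cases "l \<le> m")
    case True
    then show ?thesis by (intro span_base) auto
  next
    case False
    then have "(X ^^ l) w = 0"
      using funpow_mono_zero[OF lowest_weight_X_zero[OF w], of l] lin_simps by simp
    then show ?thesis by (simp add: span_zero)
  qed
  have stable: "f u \<in> string w m"
    if "u \<in> string w m" and f: "linear f" "\<And>l. f ((X ^^ l) w) \<in> span ?B" for f :: "'a \<Rightarrow> 'a" and u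
    using that(1) unfolding string_def
  proof (induction rule: span_induct_alt)
    case base
    then show ?case by (simp add: linear_0[OF f(1)] span_zero)
  next
    case (step c x y)
    then show ?case using f by (auto simp: linear_add linear_cmul span_add span_scale)
  qed
  have "X ((X ^^ l) w) \<in> span ?B" for l using B[of "Suc l"] by simp
  then show "X u \<in> string w m" if "u \<in> string w m" for u by (rule stable[OF that lin(1)])
  have "H ((X ^^ l) w) \<in> span ?B" for l
    using w B[of l] by (simp add: H_X_pow lowest_weight_def lin_simps funpow_simps span_add span_diff span_scale span_neg)
  then show "H u \<in> string w m" if "u \<in> string w m" for u by (rule stable[OF that lin(2)])
  have "Y ((X ^^ l) w) \<in> span ?B" for l
  proof (cases l)
    case 0
    then show ?thesis using w by (simp add: lowest_weight_def span_zero)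
  next
    case (Suc k)
    then show ?thesis using B[of k] by (simp only: Y_X_pow_lowest[OF w] span_scale)
  qed
  then show "Y u \<in> string w m" if "u \<in> string w m" for u by (rule stable[OF that lin(3)])
qed

lemma dim_submodule_ge:
  assumes "submodule W" "w \<in> W" "w \<noteq> 0" "w \<in> lowest_weight m"
  shows "m + 1 \<le> dim W"
proof -
  obtain K where "\<forall>w. (X ^^ K) w = 0" using X_nilpotent by blast
  then show ?thesis
    using assms lowest_weight_X_nonzero[OF assms(4,3), of m]
    by (intro dim_ge_of_nilpotent[OF lin(1), of W K]) (auto simp: submodule_def)
qed

lemma string_base: "w \<in> string w m"
  unfolding string_def by (rule span_base) (auto intro: image_eqI[of _ _ 0])

lemma dim_string:
  assumes w: "w \<in> lowest_weight m" "w \<noteq> 0"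
  shows "dim (string w m) = m + 1"
proof -
  have "dim (string w m) \<le> card ((\<lambda>l. (X ^^ l) w) ` {..m})"
    unfolding string_def by (intro dim_le_card) auto
  also have "\<dots> \<le> m + 1" using card_image_le[of "{..m}"] by fastforce
  finally show ?thesis
    using dim_submodule_ge[OF string_submodule[OF w(1)] string_base w(2,1)] by simp
qed

lemma casimir_string:
  assumes w: "w \<in> lowest_weight m" and "u \<in> string w m"
  shows "casimir u = (real m * (real m + 2)) *\<^sub>R u"
  using assms(2) unfolding string_def
proof (induction rule: span_induct_alt)
  case base
  then show ?case by (simp add: casimir_def lin_simps)
next
  case (step c x y)
  have "casimir ((X ^^ l) w) = (real m * (real m + 2)) *\<^sub>R (X ^^ l) w" for l
    by (induction l) (simp_all add: casimir_lowest[OF w] casimir_X lin_simps)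
  then have "casimir x = (real m * (real m + 2)) *\<^sub>R x" using step by blast
  moreover have "casimir (c *\<^sub>R x + y) = c *\<^sub>R casimir x + casimir y"
    by (simp add: casimir_def lin_simps algebra_simps)
  ultimately show ?case using step.IH by (simp add: algebra_simps)
qed

lemma weight_eq_of_casimir: "real m * (real m + 2) = real k * (real k + 2) \<Longrightarrow> m = k"
proof -
  assume *: "real m * (real m + 2) = real k * (real k + 2)"
  have "(real m + 1)\<^sup>2 = (real k + 1)\<^sup>2" using * by (simp add: power2_eq_square algebra_simps)
  then show ?thesis by (simp add: power2_eq_iff_nonneg)
qed

text \<open>A nonzero submodule contains a lowest weight vector, the Casimir operator forces its
  weight to be -m, and then the submodule already has dimension at least m + 1.\<close>

lemma string_irreducible:
  assumes w: "w \<in> lowest_weight m" "w \<noteq> 0"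
  shows "irreducible_submodule (string w m)"
  unfolding irreducible_submodule_def
proof (intro conjI allI impI)
  show "submodule (string w m)" by (rule string_submodule[OF w(1)])
  show "string w m \<noteq> {0}" using string_base[of w m] w(2) by blast
next
  fix U assume U: "submodule U \<and> U \<subseteq> string w m"
  show "U = {0} \<or> U = string w m"
  proof (cases "U = {0}")
    case False
    then obtain k u where u: "u \<in> U" "u \<noteq> 0" "u \<in> lowest_weight k"
      using submodule_lowest_weight U by blast
    have "(real m * (real m + 2)) *\<^sub>R u = (real k * (real k + 2)) *\<^sub>R u"
      using casimir_string[OF w(1), of u] casimir_lowest[OF u(3)] u(1) U by auto
    then have "m = k" using u(2) weight_eq_of_casimir by simp
    then have "dim (string w m) \<le> dim U"
      using dim_submodule_ge[OF _ u] U dim_string[OF w] by simp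
    then have "U = string w m"
      using U by (intro subspace_dim_equal) (auto simp: submodule_def string_def)
    then show ?thesis by simp
  qed simp
qed

lemma irreducible_submodule_string:
  assumes "irreducible_submodule W"
  shows "\<exists>w m. w \<in> lowest_weight m \<and> w \<noteq> 0 \<and> W = string w m"
proof -
  have W: "submodule W" "W \<noteq> {0}" "\<And>U. submodule U \<Longrightarrow> U \<subseteq> W \<Longrightarrow> U = {0} \<or> U = W"
    using assms unfolding irreducible_submodule_def by blast+
  obtain m w where w: "w \<in> W" "w \<noteq> 0" "w \<in> lowest_weight m"
    using submodule_lowest_weight[OF W(1,2)] by blast
  have "(X ^^ l) w \<in> W" for l
    using w(1) W(1) by (induction l) (auto simp: submodule_def)
  then have "string w m \<subseteq> W"
    unfolding string_def using W(1) by (intro span_minimal) (auto simp: submodule_def)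
  then have "string w m = {0} \<or> string w m = W"
    using W(3)[OF string_submodule[OF w(3)]] by blast
  then show ?thesis using string_base[of w m] w by auto
qed

definition isotypic :: "nat \<Rightarrow> 'a set" where
  "isotypic m = span (\<Union>{W. irreducible_submodule W \<and> dim W = m + 1})"

lemma casimir_isotypic:
  assumes "w \<in> isotypic m"
  shows "casimir w = (real m * (real m + 2)) *\<^sub>R w"
  using assms unfolding isotypic_def
proof (induction rule: span_induct_alt)
  case base
  then show ?case by (simp add: casimir_def lin_simps)
next
  case (step c x y)
  from step(1) obtain W where W: "irreducible_submodule W" "dim W = m + 1" "x \<in> W" by auto
  obtain w k where w: "w \<in> lowest_weight k" "w \<noteq> 0" "W = string w k"
    using irreducible_submodule_string[OF W(1)] by blast
  have "k = m" using dim_string[OF w(1,2)] W(2) w(3) by simp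
  then have "casimir x = (real m * (real m + 2)) *\<^sub>R x"
    using casimir_string[OF w(1)] W(3) w(3) by blast
  moreover have "casimir (c *\<^sub>R x + y) = c *\<^sub>R casimir x + casimir y"
    by (simp add: casimir_def lin_simps algebra_simps)
  ultimately show ?case using step.IH by (simp add: algebra_simps)
qed

text \<open>On ker Y the Casimir equation reads (H - m - 2)(H + m) w = 0. So (H + m) w would be a
  vector of ker Y of positive weight m + 2, which must be 0.\<close>

lemma isotypic_kernel_Y: "{w \<in> isotypic m. Y w = 0} = lowest_weight m"
proof (intro equalityI subsetI)
  fix w assume "w \<in> {w \<in> isotypic m. Y w = 0}"
  then have w: "w \<in> isotypic m" "Y w = 0" by auto
  let ?u = "H w + real m *\<^sub>R w"
  have "H (H w) - 2 *\<^sub>R H w = (real m * (real m + 2)) *\<^sub>R w"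
    using casimir_isotypic[OF w(1)] w(2) by (simp add: casimir_def lin_simps)
  then have "H ?u = (real m + 2) *\<^sub>R ?u"
    by (simp add: lin_simps algebra_simps)
  moreover have "Y ?u = 0" using HY[of w] w(2) by (simp add: lin_simps)
  ultimately have "?u = 0" by (intro no_positive_lowest_weight[of ?u "real m + 2"]) auto
  then show "w \<in> lowest_weight m"
    using w(2) by (simp add: lowest_weight_def eq_neg_iff_add_eq_0)
next
  fix w assume w: "w \<in> lowest_weight m"
  have "w \<in> isotypic m"
  proof (cases "w = 0")
    case True
    then show ?thesis by (simp add: isotypic_def span_zero)
  next
    case False
    then show ?thesis
      using string_irreducible[OF w] dim_string[OF w] string_base[of w m]
      unfolding isotypic_def by (intro span_base) blast
  qed
  then show "w \<in> {w \<in> isotypic m. Y w = 0}" using w by (simp add: lowest_weight_def)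
qed

end

section \<open>Invariance of the signature\<close>

context so_star_element
begin

abbreviation kernel_pw :: "nat \<Rightarrow> (quat^'n) set" where
  "kernel_pw e \<equiv> {x. pw e x = 0}"

definition radical :: "nat \<Rightarrow> (quat^'n) set" where
  "radical e = {x \<in> kernel_pw e. \<forall>w\<in>kernel_pw e. skew_form x (pw (e - 1) w) = 0}"

text \<open>No spanning is required: a system of \<open>multi_part X e\<close> members already
  represents a basis of ker X^e modulo the radical, by dimension. Chain generators, their images
  under the group and the chosen bases are all of this kind.\<close>

definition signed_system :: "nat set \<Rightarrow> nat \<Rightarrow> (nat \<Rightarrow> quat^'n) \<Rightarrow> bool" where
  "signed_system J e u \<longleftrightarrow> finite J \<and> (\<forall>j\<in>J. pw e (u j) = 0) \<and>
    (\<forall>j\<in>J. \<forall>k\<in>J. j \<noteq> k \<longrightarrow> skew_form (u j) (pw (e - 1) (u k)) = 0) \<and>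
    (\<forall>j\<in>J. skew_form (u j) (pw (e - 1) (u j)) = 1 \<or> skew_form (u j) (pw (e - 1) (u j)) = - 1)"

definition positive_part :: "nat set \<Rightarrow> nat \<Rightarrow> (nat \<Rightarrow> quat^'n) \<Rightarrow> nat set" where
  "positive_part J e u = {j \<in> J. skew_form (u j) (pw (e - 1) (u j)) = 1}"

lemma H_subspace_kernel_pw: "H_subspace (kernel_pw e)"
  by (rule H_subspaceI) (auto simp: matrix_funpow_simps)

lemma H_subspace_radical: "H_subspace (radical e)"
  by (rule H_subspaceI)
    (auto simp: radical_def matrix_funpow_simps skew_form_simps skew_form_rscale_left)

lemma signed_system_subset: "signed_system J e u \<Longrightarrow> I \<subseteq> J \<Longrightarrow> signed_system I e u"
  unfolding signed_system_def by (blast intro: finite_subset)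

lemma signed_system_pair:
  assumes "signed_system J e u" "k \<in> J"
  shows "skew_form (u k) (pw (e - 1) (\<Sum>j\<in>J. u j *\<^sub>H a j)) = skew_form (u k) (pw (e - 1) (u k)) * a k"
proof -
  have "skew_form (u k) (pw (e - 1) (\<Sum>j\<in>J. u j *\<^sub>H a j)) =
      (\<Sum>j\<in>J. skew_form (u k) (pw (e - 1) (u j)) * a j)"
    by (simp add: pwf.sum_right pwf.rscale_right)
  also have "\<dots> = (\<Sum>j\<in>J. if j = k then skew_form (u k) (pw (e - 1) (u k)) * a k else 0)"
    using assms by (intro sum.cong) (auto simp: signed_system_def)
  also have "\<dots> = skew_form (u k) (pw (e - 1) (u k)) * a k"
    using assms by (simp add: signed_system_def)
  finally show ?thesis .
qed

lemma signed_system_independent: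
  assumes "signed_system J e u"
  shows "H_independent J u"
  unfolding H_independent_def
proof (intro allI impI ballI)
  fix a k assume "(\<Sum>j\<in>J. u j *\<^sub>H a j) = 0" "k \<in> J"
  then have "skew_form (u k) (pw (e - 1) (u k)) * a k = 0"
    using signed_system_pair[OF assms, of k a] by simp
  then show "a k = 0" using assms \<open>k \<in> J\<close> by (auto simp: signed_system_def)
qed

lemma signed_system_norm:
  assumes "signed_system J e u" and val: "\<And>j. j \<in> J \<Longrightarrow> skew_form (u j) (pw (e - 1) (u j)) = r *\<^sub>R 1"
    and z: "z = (\<Sum>j\<in>J. u j *\<^sub>H a j)"
  shows "qRe (skew_form z (pw (e - 1) z)) = r * (\<Sum>j\<in>J. qRe (qcnj (a j) * a j))"
proof -
  have "skew_form z (pw (e - 1) z) = (\<Sum>k\<in>J. qcnj (a k) * skew_form (u k) (pw (e - 1) z))"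
    by (subst (1) z) (simp only: pwf.sum_left pwf.rscale_left)
  also have "\<dots> = (\<Sum>k\<in>J. r *\<^sub>R (qcnj (a k) * a k))"
    unfolding z by (intro sum.cong refl) (simp only: signed_system_pair[OF assms(1)] val, simp)
  finally show ?thesis by (simp add: qRe_sum sum_distrib_left)
qed

text \<open>A positive definite subspace meets the sum of a negative definite subspace and the radical
  trivially.\<close>

lemma positive_part_le:
  assumes dim: "dim (kernel_pw e) \<le> 4 * t + dim (radical e)"
    and J: "signed_system J e u" "card J = t" and J': "signed_system J' e u'" "card J' = t"
  shows "card (positive_part J e u) \<le> card (positive_part J' e u')"
proof -
  let ?P = "positive_part J e u" and ?N = "J' - positive_part J' e u'"
  let ?SP = "H_span ?P u" and ?SN = "H_span ?N u'"
  let ?NR = "{x + y |x y. x \<in> ?SN \<and> y \<in> radical e}"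
  have sysP: "signed_system ?P e u" and sysN: "signed_system ?N e u'"
    using J J' by (auto intro: signed_system_subset simp: positive_part_def)
  have valP: "skew_form (u j) (pw (e - 1) (u j)) = 1 *\<^sub>R 1" if "j \<in> ?P" for j
    using that by (simp add: positive_part_def)
  have valN: "skew_form (u' j) (pw (e - 1) (u' j)) = (- 1) *\<^sub>R 1" if "j \<in> ?N" for j
    using that J' by (auto simp: positive_part_def signed_system_def)
  have fin: "finite ?P" "finite ?N" using sysP sysN by (auto simp: signed_system_def)
  note sub = H_subspace_imp_subspace[OF H_subspace_H_span] H_subspace_imp_subspace[OF H_subspace_radical]
  have subNR: "subspace ?NR" by (rule subspace_sums[OF sub])
  have dims: "dim ?SP = 4 * card ?P" "dim ?SN = 4 * card ?N"
    using dim_H_span fin signed_system_independent sysP sysN by blast+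
  have SN_ker: "?SN \<subseteq> kernel_pw e"
    by (rule H_span_subset[OF H_subspace_kernel_pw]) (use sysN in \<open>auto simp: signed_system_def\<close>)
  have SP_ker: "?SP \<subseteq> kernel_pw e"
    by (rule H_span_subset[OF H_subspace_kernel_pw]) (use sysP in \<open>auto simp: signed_system_def\<close>)
  have rad: "skew_form x (pw (e - 1) w) = 0" "skew_form w (pw (e - 1) x) = 0"
    if "x \<in> radical e" "w \<in> kernel_pw e" for x w
    using that skew_form_pw_swap_0 by (auto simp: radical_def)
  have "?SN \<inter> radical e \<subseteq> {0}"
  proof
    fix x assume x: "x \<in> ?SN \<inter> radical e"
    then obtain a where a: "x = (\<Sum>j\<in>?N. u' j *\<^sub>H a j)" using H_span_iff by blast
    have "a k = 0" if k: "k \<in> ?N" for k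
    proof -
      have "skew_form (u' k) (pw (e - 1) x) = 0"
        using x k sysN by (intro rad(2)) (auto simp: signed_system_def)
      then show ?thesis
        using signed_system_pair[OF sysN k, of a] valN[OF k] by (simp add: a)
    qed
    then show "x \<in> {0}" by (simp add: a)
  qed
  then have "dim (?SN \<inter> radical e) = 0" by (simp only: dim_eq_0)
  then have dimNR: "dim ?NR = 4 * card ?N + dim (radical e)"
    using dim_sums_Int[OF sub, of ?N u' e] dims(2) by (simp del: dim_eq_0)
  have "?SP \<inter> ?NR \<subseteq> {0}"
  proof
    fix z assume z: "z \<in> ?SP \<inter> ?NR"
    then obtain a where a: "z = (\<Sum>j\<in>?P. u j *\<^sub>H a j)" using H_span_iff by blast
    obtain x y where xy: "z = x + y" "x \<in> ?SN" "y \<in> radical e" using z by blast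
    then obtain b where b: "x = (\<Sum>j\<in>?N. u' j *\<^sub>H b j)" using H_span_iff by blast
    have ker: "x \<in> kernel_pw e" "y \<in> kernel_pw e" using xy SN_ker by (auto simp: radical_def)
    have "skew_form z (pw (e - 1) z) = skew_form x (pw (e - 1) x)"
      using rad[OF xy(3) ker(1)] rad[OF xy(3) ker(2)] unfolding xy(1)
      by (simp add: pwf.add_left pwf.add_right)
    then have "(\<Sum>j\<in>?P. qRe (qcnj (a j) * a j)) = - (\<Sum>j\<in>?N. qRe (qcnj (b j) * b j))"
      using signed_system_norm[OF sysP valP a] signed_system_norm[OF sysN valN b] by simp
    moreover have "0 \<le> (\<Sum>j\<in>?P. qRe (qcnj (a j) * a j))" "0 \<le> (\<Sum>j\<in>?N. qRe (qcnj (b j) * b j))"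
      by (simp_all add: sum_nonneg qRe_cnj_mult_nonneg)
    ultimately have "(\<Sum>j\<in>?P. qRe (qcnj (a j) * a j)) = 0" by linarith
    then have "\<forall>j\<in>?P. qRe (qcnj (a j) * a j) = 0"
      using fin by (simp add: sum_nonneg_eq_0_iff qRe_cnj_mult_nonneg)
    then show "z \<in> {0}" by (simp add: a qRe_cnj_mult_eq_0_iff)
  qed
  then have "dim (?SP \<inter> ?NR) = 0" by (simp only: dim_eq_0)
  then have "dim {x + y |x y. x \<in> ?SP \<and> y \<in> ?NR} = 4 * card ?P + dim ?NR"
    using dim_sums_Int[OF sub(1) subNR, of ?P u] dims(1) by (simp del: dim_eq_0)
  moreover have "{x + y |x y. x \<in> ?SP \<and> y \<in> ?NR} \<subseteq> kernel_pw e"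
    using SP_ker SN_ker by (auto simp: radical_def matrix_funpow_simps subset_iff)
  then have "dim {x + y |x y. x \<in> ?SP \<and> y \<in> ?NR} \<le> dim (kernel_pw e)" by (rule dim_subset)
  ultimately have "4 * card ?P + 4 * card ?N \<le> 4 * t" using dim dimNR by linarith
  moreover have "card ?N = t - card (positive_part J' e u')"
    using J' by (subst card_Diff_subset) (auto simp: positive_part_def signed_system_def)
  moreover have "card (positive_part J' e u') \<le> t"
    using J' by (auto simp: positive_part_def signed_system_def intro: card_mono)
  ultimately show ?thesis by linarith
qed

text \<open>Gram-Schmidt: as long as the complement in \<open>W\<close> is nonzero, nondegeneracy
  and \<open>pwf.anisotropic\<close> give a vector of nonzero value in it, and for odd
  \<open>k\<close> this value is real and can be scaled to 1 or -1.\<close>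

lemma orthonormal_basis:
  assumes W: "H_subspace W" and k: "odd k"
    and nondeg: "\<forall>x\<in>W. (\<forall>w\<in>W. skew_form x (pw k w) = 0) \<longrightarrow> x = 0"
  shows "\<exists>(t :: nat) u. (\<forall>j\<in>{1..t}. u j \<in> W) \<and>
    (\<forall>i\<in>{1..t}. \<forall>j\<in>{1..t}. i \<noteq> j \<longrightarrow> skew_form (u i) (pw k (u j)) = 0) \<and>
    (\<forall>j\<in>{1..t}. skew_form (u j) (pw k (u j)) = 1 \<or> skew_form (u j) (pw k (u j)) = - 1) \<and>
    H_span {1..t} u = W"
proof -
  define ortho where "ortho t u \<longleftrightarrow> (\<forall>j\<in>{1..t}. u j \<in> W) \<and>
    (\<forall>i\<in>{1..t}. \<forall>j\<in>{1..t}. i \<noteq> j \<longrightarrow> skew_form (u i) (pw k (u j)) = 0) \<and>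
    (\<forall>j\<in>{1..t}. skew_form (u j) (pw k (u j)) = 1 \<or> skew_form (u j) (pw k (u j)) = - 1)"
    for t :: nat and u
  define perp where "perp t u = {w \<in> W. \<forall>j\<in>{1..t}. skew_form (u j) (pw k w) = 0}"
    for t :: nat and u
  have sub: "H_subspace (perp t u)" for t u
    using W by (intro H_subspaceI)
      (auto simp: perp_def H_subspace_def subspace_0 subspace_add pwf.add_right pwf.rscale_right)
  \<comment> \<open>Each value 1 or -1 is its own inverse, so the product in the coefficient is the
    quotient of the usual projection formula.\<close>
  have resid: "w - (\<Sum>j\<in>{1..t}. u j *\<^sub>H (skew_form (u j) (pw k (u j)) * skew_form (u j) (pw k w))) \<in> perp t u"
    if o: "ortho t u" and w: "w \<in> W" for t u w
  proof -
    let ?c = "\<lambda>j. skew_form (u j) (pw k (u j)) * skew_form (u j) (pw k w)"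
    have "skew_form (u i) (pw k (\<Sum>j\<in>{1..t}. u j *\<^sub>H ?c j)) = skew_form (u i) (pw k w)"
      if i: "i \<in> {1..t}" for i
    proof -
      have "skew_form (u i) (pw k (\<Sum>j\<in>{1..t}. u j *\<^sub>H ?c j)) =
          (\<Sum>j\<in>{1..t}. skew_form (u i) (pw k (u j)) * ?c j)"
        by (simp only: pwf.sum_right pwf.rscale_right)
      also have "\<dots> = (\<Sum>j\<in>{1..t}. if j = i then skew_form (u i) (pw k w) else 0)"
      proof (rule sum.cong[OF refl])
        fix j assume j: "j \<in> {1..t}"
        show "skew_form (u i) (pw k (u j)) * ?c j = (if j = i then skew_form (u i) (pw k w) else 0)"
        proof (cases "j = i")
          case True
          have "skew_form (u i) (pw k (u i)) = 1 \<or> skew_form (u i) (pw k (u i)) = - 1"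
            using o i by (simp add: ortho_def)
          then show ?thesis using True by auto
        next
          case False
          then have "skew_form (u i) (pw k (u j)) = 0" using o i j by (simp add: ortho_def)
          then show ?thesis using False by simp
        qed
      qed
      also have "\<dots> = skew_form (u i) (pw k w)" using i by simp
      finally show ?thesis .
    qed
    moreover have "(\<Sum>j\<in>{1..t}. u j *\<^sub>H ?c j) \<in> W"
      using W o by (intro subspace_sum H_subspace_imp_subspace H_subspace_rscale) (auto simp: ortho_def)
    ultimately show ?thesis
      using W w by (simp add: perp_def pwf.diff_right H_subspace_def subspace_diff)
  qed
  have ex: "\<exists>t u. ortho t u \<and> perp t u = {0}" if "ortho t u" for t u
    using that
  proof (induction "dim (perp t u)" arbitrary: t u rule: less_induct)
    case less
    show ?case
    proof (cases "perp t u = {0}")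
      case False
      then obtain x where x: "x \<in> perp t u" "x \<noteq> 0"
        using subspace_0[OF H_subspace_imp_subspace[OF sub[of t u]]] by blast
      then have "x \<in> W" by (simp add: perp_def)
      then obtain w where w: "w \<in> W" "skew_form x (pw k w) \<noteq> 0"
        using nondeg x(2) by blast
      let ?s = "\<Sum>j\<in>{1..t}. u j *\<^sub>H (skew_form (u j) (pw k (u j)) * skew_form (u j) (pw k w))"
      have "skew_form x (pw k (u j)) = 0" if "j \<in> {1..t}" for j
        using x(1) that skew_form_pw_swap_0[of x k "u j"] by (simp add: perp_def)
      then have "skew_form x (pw k (w - ?s)) \<noteq> 0"
        using w(2) by (simp add: pwf.diff_right pwf.sum_right pwf.rscale_right)
      then obtain y where y: "y \<in> perp t u" "skew_form y (pw k y) \<noteq> 0"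
        using pwf.anisotropic[OF sub x(1) resid[OF less.prems w(1)]] by blast
      obtain z where z: "z \<in> perp t u" "skew_form z (pw k z) \<in> {1, - 1}"
        using normalize_sign[OF k sub y] by blast
      define u' where "u' = u(Suc t := z)"
      have z0: "skew_form (u j) (pw k z) = 0" "skew_form z (pw k (u j)) = 0" if "j \<in> {1..t}" for j
        using z(1) that skew_form_pw_swap_0[of z k "u j"] by (simp_all add: perp_def)
      have "ortho (Suc t) u'"
        using less.prems z z0 unfolding ortho_def u'_def
        by (auto simp: le_Suc_eq perp_def)
      moreover have "dim (perp (Suc t) u') < dim (perp t u)"
      proof (rule dim_psubset)
        have "perp (Suc t) u' \<subseteq> perp t u" by (auto simp: perp_def u'_def)
        moreover have "z \<notin> perp (Suc t) u'"
        proof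
          assume "z \<in> perp (Suc t) u'"
          then have "skew_form (u' (Suc t)) (pw k z) = 0" unfolding perp_def by simp
          then show False using z(2) by (auto simp: u'_def)
        qed
        ultimately show "span (perp (Suc t) u') \<subset> span (perp t u)"
          using z(1) sub by (auto simp: span_eq_iff[THEN iffD2] H_subspace_imp_subspace)
      qed
      ultimately show ?thesis using less.hyps by blast
    qed (use less.prems in blast)
  qed
  have "ortho 0 (\<lambda>_. 0)" by (simp add: ortho_def)
  from ex[OF this] obtain t u where tu: "ortho t u" "perp t u = {0}" by blast
  have "H_span {1..t} u = W"
  proof
    show "H_span {1..t} u \<subseteq> W"
      using tu(1) by (intro H_span_subset[OF W]) (simp add: ortho_def)
    show "W \<subseteq> H_span {1..t} u"
    proof
      fix w assume "w \<in> W"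
      then have eq: "w = (\<Sum>j\<in>{1..t}. u j *\<^sub>H (skew_form (u j) (pw k (u j)) * skew_form (u j) (pw k w)))"
        using resid[OF tu(1)] tu(2) by simp
      show "w \<in> H_span {1..t} u" by (subst eq) (rule H_span_sum)
    qed
  qed
  then show ?thesis using tu(1) unfolding ortho_def by blast
qed

end

section \<open>The signature read off from chain generators\<close>

context orthogonal_basis
begin

text \<open>Modulo the radical, ker X^e is spanned by the generators of the chains of size exactly
  e: subtracting from \<open>x\<close> its coordinates at these generators leaves an element of the
  radical.\<close>

lemma dim_kernel_le:
  assumes e: "0 < e"
  shows "dim (kernel_pw e) \<le> 4 * multi_part X e + dim (radical e)"
proof -
  let ?I = "{i. i < n \<and> d i = e}"
  have fin: "finite ?I" by simp
  have "kernel_pw e \<subseteq> {x + y |x y. x \<in> H_span ?I v \<and> y \<in> radical e}"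
  proof
    fix x assume x: "x \<in> kernel_pw e"
    define s where "s = (\<Sum>i\<in>?I. v i *\<^sub>H chain_coord d v x (i, 0))"
    define y where "y = x - s"
    have "s \<in> H_span ?I v" unfolding s_def by (rule H_span_sum)
    moreover have "s \<in> kernel_pw e"
      unfolding s_def using zero by (auto simp: matrix_funpow_simps intro!: sum.neutral)
    then have y: "pw e y = 0" using x by (simp add: y_def matrix_funpow_simps)
    have "skew_form y (pw (e - 1) w) = 0" if w: "w \<in> kernel_pw e" for w
    proof -
      \<comment> \<open>Expanding \<open>w\<close> in chains, each term dies for its own reason: for
        l > 0 because X^e kills \<open>y\<close>, for a shorter chain because X^(e-1) kills its
        generator, for size e by the choice of \<open>s\<close>, and for a longer chain because
        \<open>w\<close> has coordinate 0 at its generator.\<close>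
      have term0: "qcnj (chain_coord d v w p) * skew_form (chain v p) (pw (e - 1) y) = 0"
        if p: "p \<in> chain_index n d" for p
      proof -
        obtain i l where il: "p = (i, l)" "i < n" "l < d i"
          using p by (auto simp: chain_index_def)
        consider "0 < l" | "l = 0" "d i < e" | "l = 0" "d i = e" | "l = 0" "e < d i" by linarith
        then show ?thesis
        proof cases
          case 1
          then have "pw (l + (e - 1)) y = 0" using pw_mono_zero[OF y, of "l + (e - 1)"] e by simp
          then show ?thesis by (simp add: il form_chain skew_form_simps)
        next
          case 2
          then have "pw (e - 1) (v i) = 0" using pw_ge_zero[OF il(2), of "e - 1"] by simp
          then have "skew_form (v i) (pw (e - 1) y) = 0"
            using skew_form_pw_eq_0_iff[of "e - 1" "v i" y] by (simp add: skew_form_simps)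
          then show ?thesis by (simp add: il 2)
        next
          case 3
          have "skew_form (v i) (pw (e - 1) s) =
              (\<Sum>j\<in>?I. skew_form (v i) (pw (e - 1) (v j)) * chain_coord d v x (j, 0))"
            unfolding s_def by (simp only: pwf.sum_right pwf.rscale_right)
          also have "\<dots> = (\<Sum>j\<in>?I. if j = i then skew_form (v i) (pw (e - 1) x) else 0)"
          proof (rule sum.cong[OF refl])
            fix j assume "j \<in> ?I"
            then show "skew_form (v i) (pw (e - 1) (v j)) * chain_coord d v x (j, 0) =
                (if j = i then skew_form (v i) (pw (e - 1) x) else 0)"
              using orth[OF il(2), of j] nonzero[OF il(2)] 3
              by (auto simp: chain_coord_def[OF chains] mult.assoc[symmetric])
          qed
          also have "\<dots> = skew_form (v i) (pw (e - 1) x)" using il 3 by simp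
          finally have "skew_form (v i) (pw (e - 1) y) = 0" by (simp add: y_def pwf.diff_right)
          then show ?thesis by (simp add: il 3)
        next
          case 4
          then have "pw (d i - 1) w = 0" using w pw_mono_zero[of e w "d i - 1"] by simp
          then have "chain_coord d v w p = 0"
            by (simp add: chain_coord_def[OF chains] il 4 skew_form_simps)
          then show ?thesis by simp
        qed
      qed
      have "w = (\<Sum>p\<in>chain_index n d. chain v p *\<^sub>H chain_coord d v w p)"
        by (rule chains_expand[OF chains perp])
      then have "skew_form w (pw (e - 1) y) =
          skew_form (\<Sum>p\<in>chain_index n d. chain v p *\<^sub>H chain_coord d v w p) (pw (e - 1) y)"
        by simp
      also have "\<dots> = 0"
        unfolding skew_form_sum_left skew_form_rscale_left by (intro sum.neutral ballI term0)
      finally show ?thesis using skew_form_pw_swap_0 by blast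
    qed
    then have "y \<in> radical e" using y by (simp add: radical_def)
    ultimately show "x \<in> {x + y |x y. x \<in> H_span ?I v \<and> y \<in> radical e}"
      by (force simp: y_def)
  qed
  then have "dim (kernel_pw e) \<le> dim {x + y |x y. x \<in> H_span ?I v \<and> y \<in> radical e}"
    by (rule dim_subset)
  also have "\<dots> \<le> dim (H_span ?I v) + dim (radical e)"
    using dim_sums_Int[OF H_subspace_imp_subspace[OF H_subspace_H_span]
        H_subspace_imp_subspace[OF H_subspace_radical], of ?I v e] by linarith
  also have "dim (H_span ?I v) \<le> 4 * multi_part X e"
    using dim_H_span_le[OF fin, of v] by (simp add: multi_part)
  finally show ?thesis by simp
qed

lemma positive_part_eq:
  assumes "0 < e" "signed_system J e u" "card J = multi_part X e"
    "signed_system J' e u'" "card J' = multi_part X e"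
  shows "card (positive_part J e u) = card (positive_part J' e u')"
  using positive_part_le[OF dim_kernel_le[OF assms(1)] assms(2-5)]
    positive_part_le[OF dim_kernel_le[OF assms(1)] assms(4,5,2,3)] by simp

lemma signed_system_chains:
  assumes "even e"
  shows "signed_system {i. i < n \<and> d i = e} e v"
proof -
  have "skew_form (v j) (pw (e - 1) (v j)) = 1 \<or> skew_form (v j) (pw (e - 1) (v j)) = - 1"
    if "j < n \<and> d j = e" for j
    using sign[of j] that assms by simp
  then show ?thesis using zero orth by (auto simp: signed_system_def)
qed

end

section \<open>Lowest weight spaces of an arbitrary triple\<close>

locale triple_basis = orthogonal_basis X n d v for X :: "quat^'n^'n" and n d v +
  fixes H Y :: "quat^'n^'n"
  assumes triple: "sl2_triple X H Y"
begin

lemma H_skew: "skew_form (H *v x) y = - skew_form x (H *v y)"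
  using triple by (simp add: sl2_triple_def so_star_iff)

lemma triple_vector:
  "H *v (X *v w) = X *v (H *v w) + 2 *\<^sub>R (X *v w)"
  "H *v (Y *v w) = Y *v (H *v w) - 2 *\<^sub>R (Y *v w)"
  "X *v (Y *v w) = Y *v (X *v w) + H *v w"
proof -
  have "lie_bracket H X *v w = 2 *\<^sub>R (X *v w)" "lie_bracket H Y *v w = (- 2) *\<^sub>R (Y *v w)"
    "lie_bracket X Y *v w = H *v w"
    using triple by (simp_all only: sl2_triple_def scaleR_matrix_vector)
  then show "H *v (X *v w) = X *v (H *v w) + 2 *\<^sub>R (X *v w)"
    "H *v (Y *v w) = Y *v (H *v w) - 2 *\<^sub>R (Y *v w)"
    "X *v (Y *v w) = Y *v (X *v w) + H *v w"
    by (simp_all add: lie_bracket_def matrix_vector_mult_diff_rdistrib algebra_simps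
        flip: matrix_vector_mul_assoc)
qed

sublocale rep: sl2_rep "(*v) X" "(*v) H" "(*v) Y"
proof (rule sl2_rep.intro)
qed (rule matrix_vector_mul_linear triple_vector)+

lemma lowest_L_eq: "lowest_L X H Y m = rep.lowest_weight m"
proof -
  have "isotypic_M X H Y m = rep.isotypic m"
    by (simp add: isotypic_M_def rep.isotypic_def irreducible_sl2_submodule_def
        rep.irreducible_submodule_def sl2_submodule_def rep.submodule_def)
  then show ?thesis by (simp add: lowest_L_def rep.isotypic_kernel_Y)
qed

lemma H_subspace_lowest: "H_subspace (rep.lowest_weight m)"
  by (rule H_subspaceI)
    (auto simp: rep.lowest_weight_def matrix_vector_right_distrib matrix_vector_rscale
      rscale_scaleR_left scaleR_add_right)

lemma lowest_in_kernel: "rep.lowest_weight m \<subseteq> kernel_pw (Suc m)"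
  using rep.lowest_weight_X_zero by blast

text \<open>X^m x has weight m. It is orthogonal to lowest weight vectors of weight other than -m
  because H is skew, to those of weight -m by assumption, and to the higher string vectors because
  moving their powers of X across yields at least X^(m+1) x = 0. The strings span, so X^m x =
  0.\<close>

lemma lowest_nondegenerate:
  assumes x: "x \<in> rep.lowest_weight m"
    and x0: "\<And>w. w \<in> rep.lowest_weight m \<Longrightarrow> skew_form x (pw m w) = 0"
  shows "x = 0"
proof -
  let ?z = "pw m x"
  obtain K where K: "\<And>w. pw K w = 0" using rep.X_nilpotent by blast
  have Hz: "H *v ?z = real m *\<^sub>R ?z"
    using rep.H_X_pow[of m x] x
    by (simp add: rep.lowest_weight_def matrix_funpow_simps flip: scaleR_add_left scaleR_diff_left)
  have "skew_form ?z y = 0" for y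
  proof -
    have "y \<in> rep.chains_span K" using rep.chains_span_UNIV[OF K] by simp
    then show ?thesis unfolding rep.chains_span_def
    proof (induction rule: span_induct_alt)
      case base
      then show ?case by (simp add: skew_form_simps)
    next
      case (step c a b)
      then obtain m' l k where k: "k \<in> rep.lowest_weight m'" "a = pw l k" by blast
      have "skew_form ?z a = 0"
      proof (cases "l = 0")
        case l: True
        show ?thesis
        proof (cases "m' = m")
          case True
          then show ?thesis using x0[of k] k l by (simp add: skew_form_pw)
        next
          case False
          have "real m *\<^sub>R skew_form ?z k = skew_form (H *v ?z) k" by (simp add: Hz skew_form_simps)
          also have "\<dots> = real m' *\<^sub>R skew_form ?z k"
            using k(1) by (simp add: H_skew rep.lowest_weight_def skew_form_simps)
          finally show ?thesis using False k l by simp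
        qed
      next
        case False
        then have "pw l ?z = 0"
          using pw_mono_zero[OF rep.lowest_weight_X_zero[OF x], of "l + m"] by (simp add: pw_pw)
        then show ?thesis
          using skew_form_pw_eq_0_iff[of l ?z k] k by (simp add: skew_form_simps)
      qed
      then show ?case using step.IH by (simp add: skew_form_simps)
    qed
  qed
  then have "skew_form y ?z = 0" for y using skew_form_swap[of ?z y] by simp
  then have "?z = 0" by (rule skew_form_nondegenerate)
  then show ?thesis using rep.lowest_weight_X_nonzero[OF x, of m] by blast
qed

text \<open>Nondegeneracy makes the lowest weight space meet the radical trivially inside ker
  X^(m+1), so \<open>dim_kernel_le\<close> leaves room for at most this dimension.\<close>

lemma dim_lowest_le: "dim (rep.lowest_weight m) \<le> 4 * multi_part X (Suc m)"
proof -
  let ?S = "{x + y |x y. x \<in> rep.lowest_weight m \<and> y \<in> radical (Suc m)}"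
  note sub = H_subspace_imp_subspace[OF H_subspace_lowest] H_subspace_imp_subspace[OF H_subspace_radical]
  have "rep.lowest_weight m \<inter> radical (Suc m) \<subseteq> {0}"
    using lowest_nondegenerate lowest_in_kernel[of m] by (auto simp: radical_def subset_iff)
  then have "dim (rep.lowest_weight m \<inter> radical (Suc m)) = 0" by (simp only: dim_eq_0)
  then have "dim ?S = dim (rep.lowest_weight m) + dim (radical (Suc m))"
    using dim_sums_Int[OF sub, of m "Suc m"] by (simp del: dim_eq_0)
  moreover have "?S \<subseteq> kernel_pw (Suc m)"
    using lowest_in_kernel[of m]
    by (auto simp: radical_def linear_add[OF matrix_funpow_linear] subset_iff simp del: funpow.simps)
  then have "dim ?S \<le> dim (kernel_pw (Suc m))" by (rule dim_subset)
  ultimately show ?thesis using dim_kernel_le[of "Suc m"] by linarith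
qed

text \<open>Summing \<open>dim_lowest_le\<close> with weights \<open>m + 1\<close>, both sides become the dimension of the
  whole space.\<close>

lemma dim_lowest: "dim (rep.lowest_weight m) = 4 * multi_part X (Suc m)"
proof (rule ccontr)
  assume "\<not> ?thesis"
  then have less: "dim (rep.lowest_weight m) < 4 * multi_part X (Suc m)"
    using dim_lowest_le[of m] by simp
  obtain K where K: "\<And>w. pw K w = 0" using rep.X_nilpotent by blast
  \<comment> \<open>The gap makes m + 1 an actual part, hence m < K, and the strict inequality does
    occur among the summands below.\<close>
  have "card {i. i < n \<and> d i = Suc m} \<noteq> 0" using less by (auto simp: multi_part simp del: card_eq_0_iff card_0_eq)
  then have "{i. i < n \<and> d i = Suc m} \<noteq> {}" by (metis card.empty)
  then obtain i where i: "i < n" "d i = Suc m" by blast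
  have "m < K"
  proof (rule ccontr)
    assume "\<not> m < K"
    then have "pw m (v i) = 0" using pw_mono_zero[OF K] by simp
    then show False using nonzero[OF i(1)] i(2) by (simp add: skew_form_simps)
  qed
  have "DIM(quat^'n) \<le> (\<Sum>m<K. Suc m * dim (rep.lowest_weight m))"
    by (rule rep.dim_le_sum_lowest_weight[OF K])
  also have "\<dots> < (\<Sum>m<K. Suc m * (4 * multi_part X (Suc m)))"
    using \<open>m < K\<close> less
    by (intro sum_strict_mono_ex1 ballI mult_le_mono2 dim_lowest_le bexI[of _ m])
      (simp_all del: mult_Suc)
  also have "\<dots> = 4 * (\<Sum>m<K. \<Sum>i<n. if d i = Suc m then d i else 0)"
    by (simp add: multi_part sum_distrib_left sum.If_cases Int_def conj_commute mult.commute mult.left_commute)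
  also have "(\<Sum>m<K. \<Sum>i<n. if d i = Suc m then d i else 0) = (\<Sum>i<n. \<Sum>m<K. if d i = Suc m then d i else 0)"
    by (rule sum.swap)
  also have "\<dots> \<le> (\<Sum>i<n. d i)"
  proof (rule sum_mono)
    fix i
    have "(\<Sum>m<K. if d i = Suc m then d i else 0) = (\<Sum>m<K. if m = d i - 1 then (if d i = 0 then 0 else d i) else 0)"
      by (intro sum.cong) auto
    then show "(\<Sum>m<K. if d i = Suc m then d i else 0) \<le> d i" by simp
  qed
  finally show False using dim_UNIV_eq by simp
qed

text \<open>Ensures that the choice in \<open>chosen_basis\<close> is proper; the number of basis
  vectors is right because of \<open>dim_lowest\<close>.\<close>

lemma exists_signed_basis:
  assumes e: "even e" "0 < e"
  shows "\<exists>u. signed_basis X H Y e u"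
proof -
  let ?K = "rep.lowest_weight (e - 1)"
  have odd: "odd (e - 1)" using e by simp
  have nondeg: "\<forall>x\<in>?K. (\<forall>w\<in>?K. skew_form x (pw (e - 1) w) = 0) \<longrightarrow> x = 0"
    using lowest_nondegenerate by blast
  obtain t :: nat and u where u: "\<forall>j\<in>{1..t}. u j \<in> ?K"
    "\<forall>i\<in>{1..t}. \<forall>j\<in>{1..t}. i \<noteq> j \<longrightarrow> skew_form (u i) (pw (e - 1) (u j)) = 0"
    "\<forall>j\<in>{1..t}. skew_form (u j) (pw (e - 1) (u j)) = 1 \<or> skew_form (u j) (pw (e - 1) (u j)) = - 1"
    "H_span {1..t} u = ?K"
    using orthonormal_basis[OF H_subspace_lowest odd nondeg] by blast
  have "signed_system {1..t} e u"
    using u lowest_in_kernel[of "e - 1"] e by (auto simp: signed_system_def subset_iff simp del: funpow.simps)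
  then have ind: "H_independent {1..t} u" by (rule signed_system_independent)
  then have "4 * t = 4 * multi_part X e"
    using dim_H_span[of "{1..t}" u] dim_lowest[of "e - 1"] u(4) e by simp
  then have t: "t = multi_part X e" by simp
  show ?thesis
    unfolding signed_basis_def H_basis_def lowest_L_eq matpow_vector
    using u ind unfolding t by blast
qed

lemma signed_basis_system:
  assumes "signed_basis X H Y e u" "0 < e"
  shows "signed_system {1..multi_part X e} e u"
proof -
  have "H_span {1..multi_part X e} u = rep.lowest_weight (e - 1)"
    using assms by (simp add: signed_basis_def H_basis_def lowest_L_eq)
  then have "u j \<in> rep.lowest_weight (e - 1)" if "j \<in> {1..multi_part X e}" for j
    using H_span_base[of "{1..multi_part X e}" j u] that by simp
  then have "pw e (u j) = 0" if "j \<in> {1..multi_part X e}" for j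
    using lowest_in_kernel[of "e - 1"] that assms(2) by (auto simp: subset_iff simp del: funpow.simps)
  then show ?thesis
    using assms(1) unfolding signed_basis_def signed_system_def matpow_vector by blast
qed

end

section \<open>The two implications\<close>

context orthogonal_basis
begin

text \<open>Frees the sign count from the chosen triple and basis: any signed system of full size
  gives the same number.\<close>

lemma p_sign_eq:
  assumes e: "even e" "0 < e" and J: "signed_system J e u" "card J = multi_part X e"
  shows "p_sign X e = card (positive_part J e u)"
proof -
  let ?H = "fst (chosen_triple X)" and ?Y = "snd (chosen_triple X)"
  obtain H Y where "sl2_triple X H Y" using exists_sl2_triple by blast
  then have "case chosen_triple X of (H, Y) \<Rightarrow> sl2_triple X H Y"
    unfolding chosen_triple_def by (rule_tac someI[of _ "(H, Y)"]) simp
  then interpret triple_basis X n d v ?H ?Y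
    by unfold_locales (auto simp: case_prod_beta)
  have "signed_basis X ?H ?Y e (chosen_basis X e)"
    unfolding chosen_basis_def by (rule someI_ex[OF exists_signed_basis[OF e]])
  then have sys: "signed_system {1..multi_part X e} e (chosen_basis X e)"
    using e by (intro signed_basis_system)
  have "p_sign X e = card (positive_part {1..multi_part X e} e (chosen_basis X e))"
    by (simp add: p_sign_def positive_part_def matpow_vector)
  also have "\<dots> = card (positive_part J e u)"
    by (rule positive_part_eq[OF e(2) sys _ J]) simp
  finally show ?thesis .
qed

lemma p_sign_le: "p_sign X e \<le> multi_part X e"
proof -
  have "p_sign X e \<le> card {1..multi_part X e}"
    unfolding p_sign_def by (intro card_mono) auto
  then show ?thesis by simp
qed

text \<open>The images of the chain generators under g form another signed system, with all signs
  reversed. Computing \<open>p_sign\<close> from both systems gives p = t - p.\<close>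

lemma real_imp_balanced:
  assumes real: "Ad_real SO_star X" and e: "even e" "0 < e"
  shows "2 * p_sign X e = multi_part X e"
proof -
  obtain g where g: "g \<in> SO_star" "- X = Ad g X" using real by (auto simp: Ad_real_def)
  have gX: "g *v (X *v x) = - (X *v (g *v x))" for x by (rule SO_star_Ad_eq_minus[OF g])
  have g_pw: "g *v pw k x = (- 1) ^ k *\<^sub>R pw k (g *v x)" for k x
    by (induction k) (simp_all add: gX matrix_vector_scaleR)
  let ?J = "{i. i < n \<and> d i = e}" and ?u = "\<lambda>i. g *v v i"
  have sys: "signed_system ?J e v" using e by (intro signed_system_chains)
  have flip: "skew_form (?u i) (pw (e - 1) (?u j)) = - skew_form (v i) (pw (e - 1) (v j))" for i j
  proof -
    have "skew_form (v i) (pw (e - 1) (v j)) = skew_form (?u i) (g *v pw (e - 1) (v j))"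
      using g(1) by (simp add: SO_star_iff)
    then show ?thesis using e by (simp add: g_pw skew_form_simps)
  qed
  have "pw e (?u i) = 0" if "i \<in> ?J" for i
    using g_pw[of e "v i"] that sys by (simp add: signed_system_def)
  then have sys': "signed_system ?J e ?u"
    using sys unfolding signed_system_def flip by auto
  have card: "card ?J = multi_part X e" by (simp add: multi_part)
  have "positive_part ?J e ?u = ?J - positive_part ?J e v"
    using sys unfolding positive_part_def flip signed_system_def by (auto simp: quat_eq_iff)
  then have "card (positive_part ?J e ?u) = multi_part X e - card (positive_part ?J e v)"
    using card by (simp only:) (subst card_Diff_subset, auto simp: positive_part_def)
  then have "p_sign X e = multi_part X e - p_sign X e"
    using p_sign_eq[OF e sys card] p_sign_eq[OF e sys' card] by simp
  then show ?thesis using p_sign_le[of e] by linarith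
qed

lemma balanced_imp_strongly_real:
  assumes bal: "\<And>e. e \<in> even_parts X \<Longrightarrow> 2 * p_sign X e = multi_part X e"
  shows "strongly_Ad_real SO_star X"
proof -
  define val where "val i = skew_form (v i) (pw (d i - 1) (v i))" for i
  define P where "P e = {i. i < n \<and> d i = e \<and> val i = 1}" for e
  define N where "N e = {i. i < n \<and> d i = e \<and> val i \<noteq> 1}" for e
  have fin: "finite (P e)" "finite (N e)" for e by (auto simp: P_def N_def)
  have "\<exists>f. bij_betw f (P e) (N e)" if e: "even e" "0 < e" for e
  proof (cases "e \<in> even_parts X")
    case True
    let ?J = "{i. i < n \<and> d i = e}"
    have card: "card ?J = multi_part X e" by (simp add: multi_part)
    have "positive_part ?J e v = P e" by (auto simp: positive_part_def P_def val_def)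
    then have "p_sign X e = card (P e)"
      using p_sign_eq[OF e signed_system_chains[OF e(1)] card] by simp
    moreover have "?J = P e \<union> N e" "P e \<inter> N e = {}" by (auto simp: P_def N_def)
    then have "card (P e) + card (N e) = multi_part X e"
      using card_Un_disjoint[of "P e" "N e"] fin card by simp
    ultimately have "card (P e) = card (N e)" using bal[OF True] by linarith
    then show ?thesis using fin by (intro finite_same_card_bij)
  next
    case False
    then have "P e = {}" "N e = {}" using e by (auto simp: P_def N_def even_parts)
    then show ?thesis by (simp add: bij_betw_def)
  qed
  then obtain f where f: "\<And>e. even e \<Longrightarrow> 0 < e \<Longrightarrow> bij_betw (f e) (P e) (N e)" by metis
  \<comment> \<open>Even chains are exchanged along a bijection and its inverse between the two
    signs of equal size; odd chains stay fixed because (-1)^(d-1) = 1 demands no change of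
    value.\<close>
  define \<pi> where "\<pi> i = (if odd (d i) then i else if val i = 1 then f (d i) i
    else the_inv_into (P (d i)) (f (d i)) i)" for i
  have \<pi>_even: "\<pi> i < n \<and> d (\<pi> i) = d i \<and> \<pi> (\<pi> i) = i \<and> val (\<pi> i) = - val i"
    if i: "i < n" "even (d i)" for i
  proof -
    note fi = f[OF i(2) pos[OF i(1)]]
    have sgn: "val j = 1 \<or> val j = - 1" if "j < n" "d j = d i" for j
      using sign[OF that(1)] that i by (simp add: val_def)
    have ne: "(- 1 :: quat) \<noteq> 1" by (simp add: quat_eq_iff)
    show ?thesis
    proof (cases "val i = 1")
      case True
      then have iP: "i \<in> P (d i)" using i by (simp add: P_def)
      then have fN: "f (d i) i \<in> N (d i)" using fi by (auto simp: bij_betw_def)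
      then have "val (f (d i) i) = - 1" "f (d i) i < n" "d (f (d i) i) = d i"
        using sgn by (auto simp: N_def)
      moreover have "the_inv_into (P (d i)) (f (d i)) (f (d i) i) = i"
        using fi iP by (simp add: bij_betw_def the_inv_into_f_f)
      ultimately show ?thesis using True i ne by (simp add: \<pi>_def)
    next
      case False
      then have iN: "i \<in> N (d i)" using i by (simp add: N_def)
      let ?j = "the_inv_into (P (d i)) (f (d i)) i"
      have jP: "?j \<in> P (d i)"
        using fi iN by (auto simp: bij_betw_def intro: the_inv_into_into)
      have fj: "f (d i) ?j = i" using fi iN by (simp add: bij_betw_def f_the_inv_into_f)
      have "val i = - 1" using sgn[OF i(1)] False by simp
      then show ?thesis using False jP fj i by (simp add: \<pi>_def P_def)
    qed
  qed
  have \<pi>_odd: "\<pi> i = i" if "odd (d i)" for i using that by (simp add: \<pi>_def)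
  show ?thesis
  proof (rule strongly_real_if_swap[of \<pi>])
    fix i assume i: "i < n"
    show "\<pi> i < n" "\<pi> (\<pi> i) = i" "d (\<pi> i) = d i"
      using \<pi>_even[OF i] \<pi>_odd[of i] i by (cases "even (d i)"; simp)+
    show "skew_form (v (\<pi> i)) (pw (d i - 1) (v (\<pi> i))) =
        (- 1) ^ (d i - 1) *\<^sub>R skew_form (v i) (pw (d i - 1) (v i))"
    proof (cases "even (d i)")
      case True
      then show ?thesis using \<pi>_even[OF i True] pos[OF i] by (auto simp: val_def)
    next
      case False
      then show ?thesis using \<pi>_odd[of i] by simp
    qed
  qed
qed

end

theorem theorem5p7:
  fixes X :: "quat^'n^'n"
  assumes "X \<in> so_star" and "nilpotent_mat X"
  shows "(Ad_real SO_star X \<longleftrightarrow> strongly_Ad_real SO_star X) \<and>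
         (strongly_Ad_real SO_star X \<longleftrightarrow>
           (\<forall>\<eta>\<in>even_parts X. p_sign X \<eta> = q_sign X \<eta> \<and>
              real (q_sign X \<eta>) = real (multi_part X \<eta>) / 2))"
proof -
  interpret so_star_element X by unfold_locales (rule assms(1))
  obtain K where "matpow X K = 0" using assms(2) by (auto simp: nilpotent_mat_def)
  then have "pw K x = 0" for x by (simp flip: matpow_vector)
  then obtain n d v where "orthogonal_chains n d v" "chains_perp n v = {0}"
    using exists_orthogonal_chains by blast
  then interpret orthogonal_basis X n d v by unfold_locales
  have "p_sign X e = q_sign X e \<and> real (q_sign X e) = real (multi_part X e) / 2 \<longleftrightarrow>
      2 * p_sign X e = multi_part X e" for e
    using p_sign_le[of e] by (auto simp: q_sign_def)
  \<comment> \<open>Parts are positive, so an even part is at least 2 and e - 1 is a genuine odd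
    power.\<close>
  moreover have "even e \<and> 0 < e" if "e \<in> even_parts X" for e
    using that pos by (auto simp: even_parts)
  moreover have "Ad_real SO_star X" if "strongly_Ad_real SO_star X"
    using that by (auto simp: strongly_Ad_real_def Ad_real_def)
  ultimately show ?thesis
    using real_imp_balanced balanced_imp_strongly_real by metis
qed

end
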